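(* Let $k\ge 1$ be an integer and $p$ a prime number. Then $$1=\Bigl(\sum_J [\mathbb{Z}_p^k:J]^{-k}\Bigr)\cdot \mu_p(\mathrm{GL}_k(\mathbb{Z}_p)),$$ where $J$ ranges over all $\mathbb{Z}_p$-submodules of $\mathbb{Z}_p^k$ of rank $k$.
   Context: $\mathbb{Z}_p$ is the ring of $p$-adic integers and $\mathbb{Q}_p$ its fraction field. $\mu_p$ denotes the translation invariant (Haar) measure on $\mathbb{Q}_p$ normalized by $\mu_p(\mathbb{Z}_p)=1$, and also the product measure on the space $M_k(\mathbb{Q}_p)$ of $k\times k$ matrices, so that $\mu_p(M_k(\mathbb{Z}_p))=1$. The group $\mathrm{GL}_k(\mathbb{Z}_p)$ is regarded as an open subset of $M_k(\mathbb{Z}_p)$. $[\mathbb{Z}_p^k:J]$ is the index of $J$ in $\mathbb{Z}_p^k$. *)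

theory Defs
  imports
    "HOL-Analysis.Finite_Product_Measure"
    "HOL-Analysis.Infinite_Sum"
    "HOL-Library.Extended_Nat"
    "HOL-Computational_Algebra.Primes"
    "HOL-Algebra.Module"
    "HOL-Algebra.AbelCoset"
begin

section \<open>The ring of p-adic integers\<close>

text \<open>
  The inverse limit of the rings \<open>\<int>/p\<^sup>n\<int>\<close>: an element is a compatible sequence of
  residues, the \<open>n\<close>-th of which is represented by an integer in \<open>{0..<p\<^sup>n}\<close>.
\<close>

definition padic_int :: "nat \<Rightarrow> (nat \<Rightarrow> int) ring" where
  "padic_int p =
    \<lparr>carrier = {x. \<forall>n. x n \<in> {0..<int p ^ n} \<and> x (Suc n) mod int p ^ n = x n},
     mult = (\<lambda>x y n. (x n * y n) mod int p ^ n),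
     one = (\<lambda>n. 1 mod int p ^ n),
     zero = (\<lambda>n. 0),
     add = (\<lambda>x y n. (x n + y n) mod int p ^ n)\<rparr>"

section \<open>The fraction field of a domain\<close>

definition frac_rel :: "('a, 'm) ring_scheme \<Rightarrow> (('a \<times> 'a) \<times> ('a \<times> 'a)) set" where
  "frac_rel R =
    {((a, b), (c, d)) | a b c d.
       a \<in> carrier R \<and> b \<in> carrier R - {\<zero>\<^bsub>R\<^esub>} \<and>
       c \<in> carrier R \<and> d \<in> carrier R - {\<zero>\<^bsub>R\<^esub>} \<and>
       a \<otimes>\<^bsub>R\<^esub> d = c \<otimes>\<^bsub>R\<^esub> b}"

definition frac_of :: "('a, 'm) ring_scheme \<Rightarrow> 'a \<Rightarrow> 'a \<Rightarrow> ('a \<times> 'a) set" where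
  "frac_of R a b = frac_rel R `` {(a, b)}"

definition fraction_field :: "('a, 'm) ring_scheme \<Rightarrow> (('a \<times> 'a) set) ring" where
  "fraction_field R =
    \<lparr>carrier = (carrier R \<times> (carrier R - {\<zero>\<^bsub>R\<^esub>})) // frac_rel R,
     mult = (\<lambda>X Y. \<Union>(a, b)\<in>X. \<Union>(c, d)\<in>Y. frac_of R (a \<otimes>\<^bsub>R\<^esub> c) (b \<otimes>\<^bsub>R\<^esub> d)),
     one = frac_of R \<one>\<^bsub>R\<^esub> \<one>\<^bsub>R\<^esub>,
     zero = frac_of R \<zero>\<^bsub>R\<^esub> \<one>\<^bsub>R\<^esub>,
     add = (\<lambda>X Y. \<Union>(a, b)\<in>X. \<Union>(c, d)\<in>Y.
              frac_of R (a \<otimes>\<^bsub>R\<^esub> d \<oplus>\<^bsub>R\<^esub> c \<otimes>\<^bsub>R\<^esub> b) (b \<otimes>\<^bsub>R\<^esub> d))\<rparr>"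

section \<open>The field of p-adic numbers and its Haar measure\<close>

definition padic_field :: "nat \<Rightarrow> (((nat \<Rightarrow> int) \<times> (nat \<Rightarrow> int)) set) ring" where
  "padic_field p = fraction_field (padic_int p)"

definition padic_embed ::
    "nat \<Rightarrow> (nat \<Rightarrow> int) \<Rightarrow> ((nat \<Rightarrow> int) \<times> (nat \<Rightarrow> int)) set" where
  "padic_embed p a = frac_of (padic_int p) a \<one>\<^bsub>padic_int p\<^esub>"

text \<open>The cosets \<open>x + p\<^sup>n\<int>\<^sub>p\<close>, \<open>n \<ge> 0\<close>, form a neighbourhood basis of \<open>x\<close>.\<close>

definition padic_open :: "nat \<Rightarrow> ((nat \<Rightarrow> int) \<times> (nat \<Rightarrow> int)) set set \<Rightarrow> bool" where
  "padic_open p U \<longleftrightarrow>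
    U \<subseteq> carrier (padic_field p) \<and>
    (\<forall>x\<in>U. \<exists>n. \<forall>z\<in>carrier (padic_int p).
       x \<oplus>\<^bsub>padic_field p\<^esub> padic_embed p (add_pow (padic_int p) (p ^ n) z) \<in> U)"

definition padic_borel :: "nat \<Rightarrow> ((nat \<Rightarrow> int) \<times> (nat \<Rightarrow> int)) set measure" where
  "padic_borel p = sigma (carrier (padic_field p)) {U. padic_open p U}"

text \<open>
  These conditions determine the measure uniquely: \<open>\<mu>\<close> is finite on \<open>\<int>\<^sub>p\<close>, and countably many
  translates of \<open>\<int>\<^sub>p\<close> cover \<open>\<rat>\<^sub>p\<close>.
\<close>

definition padic_haar :: "nat \<Rightarrow> ((nat \<Rightarrow> int) \<times> (nat \<Rightarrow> int)) set measure \<Rightarrow> bool" where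
  "padic_haar p \<mu> \<longleftrightarrow>
    sets \<mu> = sets (padic_borel p) \<and>
    (\<forall>x\<in>carrier (padic_field p). \<forall>A\<in>sets \<mu>.
       emeasure \<mu> ((\<lambda>y. x \<oplus>\<^bsub>padic_field p\<^esub> y) ` A) = emeasure \<mu> A) \<and>
    emeasure \<mu> (padic_embed p ` carrier (padic_int p)) = 1"

section \<open>Square matrices and the general linear group\<close>

text \<open>A \<open>k \<times> k\<close> matrix is an extensional function on the index set \<open>{..<k} \<times> {..<k}\<close>.\<close>

definition mat_ring :: "('a, 'm) ring_scheme \<Rightarrow> nat \<Rightarrow> (nat \<times> nat \<Rightarrow> 'a) ring" where
  "mat_ring R k =
    \<lparr>carrier = {..<k} \<times> {..<k} \<rightarrow>\<^sub>E carrier R,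
     mult = (\<lambda>A B. \<lambda>(i, j)\<in>{..<k} \<times> {..<k}. \<Oplus>\<^bsub>R\<^esub>l\<in>{..<k}. A (i, l) \<otimes>\<^bsub>R\<^esub> B (l, j)),
     one = (\<lambda>(i, j)\<in>{..<k} \<times> {..<k}. if i = j then \<one>\<^bsub>R\<^esub> else \<zero>\<^bsub>R\<^esub>),
     zero = (\<lambda>ij\<in>{..<k} \<times> {..<k}. \<zero>\<^bsub>R\<^esub>),
     add = (\<lambda>A B. \<lambda>ij\<in>{..<k} \<times> {..<k}. A ij \<oplus>\<^bsub>R\<^esub> B ij)\<rparr>"

definition padic_mat_measure ::
    "((nat \<Rightarrow> int) \<times> (nat \<Rightarrow> int)) set measure \<Rightarrow> nat \<Rightarrow>
     (nat \<times> nat \<Rightarrow> ((nat \<Rightarrow> int) \<times> (nat \<Rightarrow> int)) set) measure" where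
  "padic_mat_measure \<mu> k = PiM ({..<k} \<times> {..<k}) (\<lambda>_. \<mu>)"

text \<open>\<open>GL\<^sub>k(\<int>\<^sub>p)\<close>, viewed inside \<open>M\<^sub>k(\<rat>\<^sub>p)\<close>.\<close>

definition padic_GL ::
    "nat \<Rightarrow> nat \<Rightarrow> (nat \<times> nat \<Rightarrow> ((nat \<Rightarrow> int) \<times> (nat \<Rightarrow> int)) set) set" where
  "padic_GL p k =
    (\<lambda>A. \<lambda>ij\<in>{..<k} \<times> {..<k}. padic_embed p (A ij)) ` Units (mat_ring (padic_int p) k)"

section \<open>Free modules, rank and index\<close>

text \<open>
  The fields \<open>mult\<close> and \<open>one\<close>, required by the record type, play no role in a module.
\<close>

definition free_module :: "('a, 'm) ring_scheme \<Rightarrow> nat \<Rightarrow> ('a, nat \<Rightarrow> 'a) module" where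
  "free_module R k =
    \<lparr>carrier = {..<k} \<rightarrow>\<^sub>E carrier R,
     mult = (\<lambda>x y. \<lambda>i\<in>{..<k}. x i \<otimes>\<^bsub>R\<^esub> y i),
     one = (\<lambda>i\<in>{..<k}. \<one>\<^bsub>R\<^esub>),
     zero = (\<lambda>i\<in>{..<k}. \<zero>\<^bsub>R\<^esub>),
     add = (\<lambda>x y. \<lambda>i\<in>{..<k}. x i \<oplus>\<^bsub>R\<^esub> y i),
     smult = (\<lambda>a x. \<lambda>i\<in>{..<k}. a \<otimes>\<^bsub>R\<^esub> x i)\<rparr>"

definition lin_indep ::
    "('a, 'm) ring_scheme \<Rightarrow> ('a, 'b, 'n) module_scheme \<Rightarrow> 'b set \<Rightarrow> bool" where
  "lin_indep R M S \<longleftrightarrow>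
    (\<forall>c\<in>S \<rightarrow> carrier R. (\<Oplus>\<^bsub>M\<^esub>v\<in>S. c v \<odot>\<^bsub>M\<^esub> v) = \<zero>\<^bsub>M\<^esub> \<longrightarrow> (\<forall>v\<in>S. c v = \<zero>\<^bsub>R\<^esub>))"

text \<open>The rank of a submodule over a domain, which is the dimension over the fraction field.\<close>

definition submodule_rank ::
    "('a, 'm) ring_scheme \<Rightarrow> ('a, 'b, 'n) module_scheme \<Rightarrow> 'b set \<Rightarrow> enat" where
  "submodule_rank R M J = (SUP S\<in>{S. S \<subseteq> J \<and> finite S \<and> lin_indep R M S}. enat (card S))"

definition submodule_index :: "('a, 'b, 'n) module_scheme \<Rightarrow> 'b set \<Rightarrow> nat" where
  "submodule_index M J = card (a_rcosets\<^bsub>M\<^esub> J)"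

definition full_rank_submodules :: "nat \<Rightarrow> nat \<Rightarrow> (nat \<Rightarrow> nat \<Rightarrow> int) set set" where
  "full_rank_submodules p k =
    {J. submodule J (padic_int p) (free_module (padic_int p) k) \<and>
        submodule_rank (padic_int p) (free_module (padic_int p) k) J = enat k}"

end

theory Submission
  imports Defs "HOL-Number_Theory.Cong" "HOL-Analysis.Infinite_Set_Sum"
begin

text \<open>
  Sort the integral matrices \<open>A\<close> by their column lattice \<open>J = A \<int>\<^sub>p\<^sup>k\<close>. If \<open>J\<close> has full rank and
  \<open>A\<close> is one matrix with this column lattice, then the others are the products \<open>A B\<close> with
  \<open>B \<in> GL\<^sub>k(\<int>\<^sub>p)\<close>, and multiplication by \<open>A\<close> maps the space of all matrices onto the matrices with
  columns in \<open>J\<close>, a subgroup of index \<open>[\<int>\<^sub>p\<^sup>k : J]\<^sup>k\<close>. Hence the matrices with column lattice \<open>J\<close> have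
  measure \<open>[\<int>\<^sub>p\<^sup>k : J]\<^sup>-\<^sup>k\<close> times that of \<open>GL\<^sub>k(\<int>\<^sub>p)\<close>. The matrices without full rank form a null
  set, and there are only countably many lattices, so summing over \<open>J\<close> gives the total measure 1.

  Except for the null set, all the sets that occur are unions of residue classes modulo some
  \<open>p\<^sup>n\<close>. Translation invariance determines the measure of such a class
  (\<open>emeasure_class\<close>, \<open>measure_saturated\<close>), and the comparison of two measures becomes
  one of finite cardinalities (\<open>spanning_count\<close>). There the group of matrices is tiled by cosets
  in two ways: by those of \<open>p M\<^sub>k(\<int>\<^sub>p)\<close>, on which membership in \<open>GL\<^sub>k(\<int>\<^sub>p)\<close> is constant
  (\<open>unit_tiling\<close>), and by those of the matrices with columns in \<open>J\<close> (\<open>cols_tiling\<close>);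
  multiplication by \<open>A\<close> carries the first tiling into each tile of the second (\<open>mult_tiling\<close>).

  The algebra rests on two facts. Over a domain, \<open>k + 1\<close> vectors of length \<open>k\<close> are dependent
  (\<open>exists_dependence\<close>); this identifies the submodules of rank \<open>k\<close> with those that contain some
  \<open>p\<^sup>m \<int>\<^sub>p\<^sup>k\<close> (\<open>full_rank_iff_lattice\<close>), and an exchange argument then produces \<open>k\<close> generators
  (\<open>lattice_has_basis\<close>). And a matrix which is injective modulo \<open>p\<close> is injective modulo every
  \<open>p\<^sup>n\<close>, hence bijective there by finiteness, hence invertible over the inverse limit \<open>\<int>\<^sub>p\<close>
  (\<open>surj_iff_inj_mod_p\<close>).

  For the null set: a matrix with dependent columns has a column that is a combination of the others,
  since a nonzero vector becomes primitive after division by a power of \<open>p\<close>. Modulo \<open>p\<^sup>n\<close> this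
  holds for a proportion of at most \<open>k / p\<^sup>n\<close> of all matrices (\<open>singular_mod_count\<close>).
\<close>

section \<open>The p-adic integers form a domain\<close>

locale padic =
  fixes p :: nat and R (structure)
  assumes p_prime: "prime p" and R_def: "R = padic_int p"
begin

lemma p_gt_1: "int p > 1"
  using p_prime prime_gt_1_nat by simp

lemma pow_pos [simp]: "int p ^ n > 0"
  using p_gt_1 by simp

lemma carrier_iff:
  "x \<in> carrier R \<longleftrightarrow> (\<forall>n. x n \<in> {0..<int p ^ n} \<and> x (Suc n) mod int p ^ n = x n)"
  by (simp add: R_def padic_int_def)

lemma add_eq: "x \<oplus> y = (\<lambda>n. (x n + y n) mod int p ^ n)"
  and mult_eq: "x \<otimes> y = (\<lambda>n. (x n * y n) mod int p ^ n)"
  and one_eq: "\<one> = (\<lambda>n. 1 mod int p ^ n)"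
  and zero_eq: "\<zero> = (\<lambda>n. 0)"
  by (simp_all add: R_def padic_int_def)

lemma level_mod [simp]: "x \<in> carrier R \<Longrightarrow> x n mod int p ^ n = x n"
  by (auto simp: carrier_iff)

lemma level_range: "x \<in> carrier R \<Longrightarrow> 0 \<le> x n \<and> x n < int p ^ n"
  by (auto simp: carrier_iff)

lemma level_compat:
  assumes "x \<in> carrier R" "m \<le> n" shows "x n mod int p ^ m = x m"
  using assms(2)
proof (induction n rule: dec_induct)
  case base
  then show ?case using assms(1) by simp
next
  case (step n)
  have "x (Suc n) mod int p ^ m = (x (Suc n) mod int p ^ n) mod int p ^ m"
    using step(1) by (simp add: mod_mod_cancel le_imp_power_dvd)
  also have "x (Suc n) mod int p ^ n = x n"
    using assms(1) by (auto simp: carrier_iff)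
  finally show ?case using step by simp
qed

lemma compatI:
  assumes "\<And>n. f (Suc n) mod int p ^ n = f n mod int p ^ n"
  shows "(\<lambda>n. f n mod int p ^ n) \<in> carrier R"
  using assms p_gt_1 by (simp add: carrier_iff mod_mod_cancel)

lemma carrier_cong: "x \<in> carrier R \<Longrightarrow> x (Suc n) mod int p ^ n = x n mod int p ^ n"
  by (auto simp: carrier_iff)

sublocale cring R
proof (intro cringI abelian_groupI comm_monoidI)
  show "\<zero> \<in> carrier R" "\<one> \<in> carrier R"
    unfolding one_eq zero_eq using compatI[of "\<lambda>_. 1"] compatI[of "\<lambda>_. 0"] by simp_all
  fix x y z assume xyz: "x \<in> carrier R" "y \<in> carrier R" "z \<in> carrier R"
  note simps = add_eq mult_eq one_eq zero_eq
  show "x \<oplus> y \<in> carrier R" unfolding add_eq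
    by (rule compatI) (intro mod_add_cong carrier_cong xyz)
  show "x \<otimes> y \<in> carrier R" unfolding mult_eq
    by (rule compatI) (intro mod_mult_cong carrier_cong xyz)
  show "x \<oplus> y = y \<oplus> x" "x \<otimes> y = y \<otimes> x" by (simp_all add: simps ac_simps)
  show "x \<oplus> y \<oplus> z = x \<oplus> (y \<oplus> z)" by (simp add: simps mod_simps add.assoc mult.assoc)
  show "x \<otimes> y \<otimes> z = x \<otimes> (y \<otimes> z)" by (simp add: simps mod_simps add.assoc mult.assoc)
  show "\<zero> \<oplus> x = x" "\<one> \<otimes> x = x" using xyz by (simp_all add: simps mod_simps)
  show "(x \<oplus> y) \<otimes> z = x \<otimes> z \<oplus> y \<otimes> z" by (simp add: simps mod_simps algebra_simps)
  show "\<exists>y\<in>carrier R. y \<oplus> x = \<zero>"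
  proof
    show "(\<lambda>n. (- x n) mod int p ^ n) \<in> carrier R"
      by (rule compatI) (intro mod_minus_cong carrier_cong xyz)
    show "(\<lambda>n. (- x n) mod int p ^ n) \<oplus> x = \<zero>" by (simp add: simps mod_simps)
  qed
qed

text \<open>
  A factor \<open>p\<close> of the product divides one of \<open>a\<close> and \<open>b\<close> and can be cancelled there, which lowers
  \<open>m\<close> or \<open>n\<close> by one. This is what makes the inverse limit a domain.
\<close>

lemma pow_dvd_mult:
  fixes a b :: int
  assumes "int p ^ (m + n) dvd a * b" shows "int p ^ m dvd a \<or> int p ^ n dvd b"
  using assms
proof (induction "m + n" arbitrary: m n a b)
  case 0
  then show ?case by simp
next
  case (Suc l)
  show ?case
  proof (cases "m = 0 \<or> n = 0")
    case False
    have pp: "prime (int p)" using p_prime by simp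
    have "int p dvd a * b"
      using Suc.prems unfolding Suc.hyps(2)[symmetric] by (auto intro: dvd_mult_left)
    then consider a' where "a = int p * a'" | b' where "b = int p * b'"
      unfolding prime_dvd_mult_iff[OF pp] by (auto elim!: dvdE)
    then show ?thesis
    proof cases
      case 1
      have "int p ^ ((m - 1) + n) dvd a' * b"
      proof -
        have "int p * int p ^ ((m - 1) + n) dvd int p * (a' * b)"
          using Suc.prems False 1 by (simp add: mult.assoc flip: power_Suc)
        then show ?thesis using p_gt_1 by simp
      qed
      moreover have "l = (m - 1) + n" using Suc.hyps(2) False by simp
      ultimately have "int p ^ (m - 1) dvd a' \<or> int p ^ n dvd b" using Suc.hyps(1) by blast
      moreover have "int p ^ m = int p * int p ^ (m - 1)"
        using False by (simp flip: power_Suc)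
      ultimately show ?thesis using 1 by (auto simp: mult_dvd_mono)
    next
      case 2
      have "int p ^ (m + (n - 1)) dvd a * b'"
      proof -
        have "int p * int p ^ (m + (n - 1)) dvd int p * (a * b')"
          using Suc.prems False 2 by (simp add: mult.left_commute flip: power_Suc)
        then show ?thesis using p_gt_1 by simp
      qed
      moreover have "l = m + (n - 1)" using Suc.hyps(2) False by simp
      ultimately have "int p ^ m dvd a \<or> int p ^ (n - 1) dvd b'" using Suc.hyps(1) by blast
      moreover have "int p ^ n = int p * int p ^ (n - 1)"
        using False by (simp flip: power_Suc)
      ultimately show ?thesis using 2 by (auto simp: mult_dvd_mono)
    qed
  qed auto
qed

sublocale domain R
proof
  show "\<one> \<noteq> \<zero>"
  proof
    assume "\<one> = \<zero>"
    then have "\<one> 1 = \<zero> (1::nat)" by simp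
    then show False using p_gt_1 by (simp add: one_eq zero_eq)
  qed
  fix a b assume ab: "a \<otimes> b = \<zero>" "a \<in> carrier R" "b \<in> carrier R"
  show "a = \<zero> \<or> b = \<zero>"
  proof (rule ccontr)
    assume "\<not> ?thesis"
    then obtain m n where mn: "a m \<noteq> 0" "b n \<noteq> 0" unfolding zero_eq by blast
    have "(a \<otimes> b) (m + n) = 0" using ab by (simp add: zero_eq)
    then have "int p ^ (m + n) dvd a (m + n) * b (m + n)" by (auto simp: mult_eq)
    then have "int p ^ m dvd a (m + n) \<or> int p ^ n dvd b (m + n)" by (rule pow_dvd_mult)
    then have "a (m + n) mod int p ^ m = 0 \<or> b (m + n) mod int p ^ n = 0" by auto
    then show False using mn ab level_compat by simp
  qed
qed

section \<open>Levels, powers of p and units\<close>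

definition of_integer :: "int \<Rightarrow> nat \<Rightarrow> int" where
  "of_integer r = (\<lambda>n. r mod int p ^ n)"

definition ppow :: "nat \<Rightarrow> nat \<Rightarrow> int" where
  "ppow m = of_integer (int p ^ m)"

lemma of_integer_closed [simp]: "of_integer r \<in> carrier R"
  unfolding of_integer_def by (rule compatI) simp

lemma ppow_closed [simp]: "ppow m \<in> carrier R"
  by (simp add: ppow_def)

lemma ppow_0: "ppow 0 = \<one>"
  by (simp add: ppow_def of_integer_def one_eq)

lemma ppow_add: "ppow (m + n) = ppow m \<otimes> ppow n"
  by (simp add: ppow_def of_integer_def mult_eq mod_simps power_add)

lemma ppow_nonzero [simp]: "ppow m \<noteq> \<zero>"
proof
  assume "ppow m = \<zero>"
  then have "ppow m (Suc m) = \<zero> (Suc m)" by simp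
  moreover have "int p ^ m mod int p ^ Suc m = int p ^ m"
    using p_gt_1 by (intro mod_pos_pos_trivial) auto
  ultimately have "int p ^ m = 0" by (simp add: ppow_def of_integer_def zero_eq del: power_Suc)
  then show False using p_gt_1 by simp
qed

lemma ppow_level: "(ppow m \<otimes> x) n = (int p ^ m * x n) mod int p ^ n"
  by (simp add: ppow_def of_integer_def mult_eq mod_simps)

text \<open>
  Divisibility by \<open>p\<^sup>n\<close> is visible at level \<open>n\<close> alone: the quotient is obtained by dividing the
  later levels \<open>m + n\<close> by \<open>p\<^sup>n\<close>.
\<close>

lemma level_zero_iff_ppow:
  assumes "x \<in> carrier R" shows "x n = 0 \<longleftrightarrow> (\<exists>y\<in>carrier R. x = ppow n \<otimes> y)"
proof
  assume x: "x n = 0"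
  have dvd: "int p ^ n dvd x (m + n)" for m
    using level_compat[of x n "m + n"] assms x by auto
  define y where "y m = x (m + n) div int p ^ n" for m
  have yx: "int p ^ n * y m = x (m + n)" for m using dvd by (simp add: y_def)
  have "y \<in> carrier R" unfolding carrier_iff
  proof (intro allI conjI)
    fix m
    have "0 \<le> int p ^ n * y m" "int p ^ n * y m < int p ^ n * int p ^ m"
      using level_range[OF assms, of "m + n"] unfolding yx by (simp_all add: power_add mult.commute)
    then show "y m \<in> {0..<int p ^ m}"
      using mult_less_cancel_left_pos[OF pow_pos, of n "y m"] zero_le_mult_iff[of "int p ^ n" "y m"]
        pow_pos[of n] by (simp del: pow_pos)
    have "int p ^ n * (y (Suc m) mod int p ^ m) = x (Suc (m + n)) mod int p ^ (m + n)"
      unfolding mult_mod_right yx by (simp add: power_add mult.commute)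
    also have "\<dots> = int p ^ n * y m"
      using carrier_cong[OF assms, of "m + n"] level_mod[OF assms, of "m + n"] yx[of m] by simp
    finally show "y (Suc m) mod int p ^ m = y m" using p_gt_1 by simp
  qed
  moreover have "x = ppow n \<otimes> y"
  proof
    fix m
    show "x m = (ppow n \<otimes> y) m"
      using level_compat[OF assms, of m "m + n"] by (simp add: ppow_level yx)
  qed
  ultimately show "\<exists>y\<in>carrier R. x = ppow n \<otimes> y" by blast
qed (auto simp: ppow_level)

lemma ppow_cancel:
  "\<lbrakk>x \<in> carrier R; y \<in> carrier R; ppow n \<otimes> x = ppow n \<otimes> y\<rbrakk> \<Longrightarrow> x = y"
  using m_lcancel[OF ppow_nonzero ppow_closed] by blast

lemma level_minus: "\<lbrakk>x \<in> carrier R; y \<in> carrier R\<rbrakk> \<Longrightarrow> (x \<ominus> y) n = (x n - y n) mod int p ^ n"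
proof -
  assume xy: "x \<in> carrier R" "y \<in> carrier R"
  then have "x n = ((x \<ominus> y) \<oplus> y) n"
    by (simp add: a_minus_def a_assoc l_neg)
  then have "x n = ((x \<ominus> y) n + y n) mod int p ^ n" by (simp add: add_eq)
  then have "(x n - y n) mod int p ^ n = (x \<ominus> y) n mod int p ^ n"
    by (simp add: mod_simps)
  then show ?thesis using xy by simp
qed

lemma level_eq_iff_ppow:
  assumes "x \<in> carrier R" "y \<in> carrier R"
  shows "x n = y n \<longleftrightarrow> (\<exists>z\<in>carrier R. y = x \<oplus> ppow n \<otimes> z)"
proof
  assume "x n = y n"
  then have "(y \<ominus> x) n = 0" using assms by (simp add: level_minus)
  then obtain z where z: "z \<in> carrier R" "y \<ominus> x = ppow n \<otimes> z"
    using assms level_zero_iff_ppow[of "y \<ominus> x" n] by auto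
  have "y = x \<oplus> (y \<ominus> x)" using assms by algebra
  then show "\<exists>z\<in>carrier R. y = x \<oplus> ppow n \<otimes> z" using z by auto
qed (use assms in \<open>auto simp: add_eq ppow_level mod_simps\<close>)

text \<open>
  The ring is local: an element which is nonzero modulo \<open>p\<close> is coprime to \<open>p\<close> at every level, and
  the inverses at the different levels are compatible because they are unique.
\<close>

lemma unit_if_level_1:
  assumes "x \<in> carrier R" "x 1 \<noteq> 0" shows "x \<in> Units R"
proof -
  have cop: "coprime (x n) (int p ^ n)" if "n > 0" for n
  proof -
    have "\<not> int p dvd x n"
      using assms level_compat[of x 1 n] that by auto
    then have "coprime (int p) (x n)" using p_prime by (simp add: prime_imp_coprime)
    then show ?thesis by (simp add: coprime_commute)
  qed
  have "\<exists>y. (x n * y) mod int p ^ n = 1 mod int p ^ n" for n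
  proof (cases "n = 0")
    case False
    then obtain u where "[x n * u = 1] (mod int p ^ n)"
      using cong_solve_coprime_int[OF cop[of n]] by blast
    then show ?thesis by (auto simp: cong_def)
  qed simp
  then obtain y where y: "\<And>n. (x n * y n) mod int p ^ n = 1 mod int p ^ n" by metis
  have yc: "(\<lambda>n. y n mod int p ^ n) \<in> carrier R"
  proof (rule compatI)
    fix n
    have "(x n * y (Suc n)) mod int p ^ n = (x (Suc n) * y (Suc n)) mod int p ^ n"
      using carrier_cong[OF assms(1)] by (metis mod_mult_cong)
    also have "\<dots> = (x (Suc n) * y (Suc n)) mod int p ^ Suc n mod int p ^ n"
      by (simp add: mod_mod_cancel)
    also have "\<dots> = 1 mod int p ^ n"
      by (simp only: y) (simp add: mod_mod_cancel)
    finally have "(x n * y (Suc n)) mod int p ^ n = (x n * y n) mod int p ^ n" using y by simp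
    then have "int p ^ n dvd x n * (y (Suc n) - y n)"
      by (simp add: mod_eq_dvd_iff algebra_simps)
    then have "int p ^ n dvd y (Suc n) - y n"
    proof (cases "n = 0")
      case False
      then have "coprime (int p ^ n) (x n)" using cop[of n] by (simp add: coprime_commute)
      then show ?thesis using \<open>int p ^ n dvd x n * (y (Suc n) - y n)\<close>
        using coprime_dvd_mult_right_iff by blast
    qed simp
    then show "y (Suc n) mod int p ^ n = y n mod int p ^ n" by (simp add: mod_eq_dvd_iff)
  qed
  have "x \<otimes> (\<lambda>n. y n mod int p ^ n) = \<one>"
    by (simp add: mult_eq one_eq mod_simps y)
  then show ?thesis using assms(1) yc m_comm unfolding Units_def by fastforce
qed

text \<open>
  Up to units, the only nonzero elements are the powers of \<open>p\<close>. This stands in for the valuation.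
\<close>

lemma nonzero_decomp:
  assumes "x \<in> carrier R" "x \<noteq> \<zero>"
  obtains n u where "u \<in> Units R" "x = ppow n \<otimes> u"
proof -
  obtain m where m: "x m \<noteq> 0" using assms by (auto simp: zero_eq)
  define l where "l = (LEAST m. x m \<noteq> 0)"
  have l: "x l \<noteq> 0" unfolding l_def using m by (rule LeastI)
  have "x 0 = 0" using level_range[OF assms(1), of 0] by simp
  then obtain n where n: "l = Suc n" using l by (cases l) auto
  have "x n = 0" using not_less_Least[of n "\<lambda>m. x m \<noteq> 0"] n l_def by auto
  then obtain u where u: "u \<in> carrier R" "x = ppow n \<otimes> u"
    using assms level_zero_iff_ppow by blast
  have "u 1 \<noteq> 0"
  proof
    assume "u 1 = 0"
    then obtain w where "w \<in> carrier R" "u = ppow 1 \<otimes> w"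
      using u level_zero_iff_ppow by blast
    then have "x = ppow (Suc n) \<otimes> w"
      using u ppow_add[of n 1] by (simp add: m_assoc)
    then show False using l n by (simp add: ppow_level)
  qed
  then show ?thesis using u that unit_if_level_1 by blast
qed

lemma finsum_level:
  assumes "finite S" "f \<in> S \<rightarrow> carrier R"
  shows "(\<Oplus>i\<in>S. f i) n = (\<Sum>i\<in>S. f i n) mod int p ^ n"
  using assms by (induction S rule: finite_induct) (auto simp: zero_eq add_eq mod_simps)

lemma add_pow_eq: "add_pow R (m::nat) x = (\<lambda>n. (int m * x n) mod int p ^ n)"
  by (induction m) (auto simp: zero_eq add_eq mod_simps algebra_simps)

end

section \<open>Linear dependence over a domain\<close>

text \<open>
  Gaussian elimination without division: a vector with nonzero last entry clears the last entries
  of the others by cross multiplication, and the others then satisfy a relation by induction.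
\<close>

lemma (in domain) exists_dependence:
  assumes "finite I" "card I > k" "\<And>i j. i \<in> I \<Longrightarrow> j < k \<Longrightarrow> v i j \<in> carrier R"
  shows "\<exists>c\<in>I \<rightarrow> carrier R. (\<exists>i\<in>I. c i \<noteq> \<zero>) \<and> (\<forall>j<k. (\<Oplus>i\<in>I. c i \<otimes> v i j) = \<zero>)"
  using assms(1-3)
proof (induction k arbitrary: I v)
  case 0
  then obtain i where "i \<in> I" by fastforce
  then show ?case by (intro bexI[of _ "\<lambda>_. \<one>"]) auto
next
  case (Suc k)
  have eliminate: "(d \<otimes> a) \<otimes> b = d \<otimes> (a \<otimes> b \<ominus> e \<otimes> f) \<oplus> (d \<otimes> e) \<otimes> f"
    if "d \<in> carrier R" "a \<in> carrier R" "b \<in> carrier R" "e \<in> carrier R" "f \<in> carrier R"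
    for a b d e f
    using that by algebra
  show ?case
  proof (cases "\<forall>i\<in>I. v i k = \<zero>")
    case True
    obtain c where c: "c \<in> I \<rightarrow> carrier R" "\<exists>i\<in>I. c i \<noteq> \<zero>"
        "\<And>j. j < k \<Longrightarrow> (\<Oplus>i\<in>I. c i \<otimes> v i j) = \<zero>"
      using Suc.IH[of I v] Suc.prems by auto
    have "(\<Oplus>i\<in>I. c i \<otimes> v i k) = (\<Oplus>i\<in>I. \<zero>)"
      using True c by (intro finsum_cong') (auto simp: Pi_iff)
    then show ?thesis using c by (intro bexI[of _ c]) (auto simp: less_Suc_eq)
  next
    case False
    then obtain l where l: "l \<in> I" "v l k \<noteq> \<zero>" by blast
    define I' where "I' = I - {l}"
    have I': "finite I'" "card I' > k" "l \<notin> I'" "I = insert l I'"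
      using Suc.prems l by (auto simp: I'_def card_Diff_singleton)
    have v [simp]: "v i j \<in> carrier R" if "i \<in> I" "j < Suc k" for i j
      using that Suc.prems by blast
    define w where "w i j = v l k \<otimes> v i j \<ominus> v i k \<otimes> v l j" for i j
    have w: "w i j \<in> carrier R" if "i \<in> I'" "j < Suc k" for i j
      using that l I' by (simp add: w_def)
    obtain d where d: "d \<in> I' \<rightarrow> carrier R" "\<exists>i\<in>I'. d i \<noteq> \<zero>"
        "\<And>j. j < k \<Longrightarrow> (\<Oplus>i\<in>I'. d i \<otimes> w i j) = \<zero>"
      using Suc.IH[OF I'(1,2), of w, OF w[OF _ less_SucI]] by blast
    have dk: "(\<Oplus>i\<in>I'. d i \<otimes> w i k) = \<zero>"
    proof -
      have "(\<Oplus>i\<in>I'. d i \<otimes> w i k) = (\<Oplus>i\<in>I'. \<zero>)"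
        using d l I' by (intro finsum_cong') (auto simp: Pi_iff w_def m_comm a_minus_def r_neg)
      then show ?thesis by simp
    qed
    define s where "s = (\<Oplus>i\<in>I'. d i \<otimes> v i k)"
    have s: "s \<in> carrier R" unfolding s_def using d I' by (intro finsum_closed) (auto simp: Pi_iff)
    define c where "c i = (if i = l then \<ominus> s else d i \<otimes> v l k)" for i
    have c: "c \<in> I \<rightarrow> carrier R" using d l I' s by (auto simp: Pi_iff c_def)
    have "(\<Oplus>i\<in>I. c i \<otimes> v i j) = \<zero>" if j: "j < Suc k" for j
    proof -
      have zero: "(\<Oplus>i\<in>I'. d i \<otimes> w i j) = \<zero>"
        using d dk j by (cases "j = k") auto
      have "(\<Oplus>i\<in>I'. c i \<otimes> v i j) = (\<Oplus>i\<in>I'. d i \<otimes> w i j \<oplus> (d i \<otimes> v i k) \<otimes> v l j)"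
      proof (intro finsum_cong' refl)
        fix i assume i: "i \<in> I'"
        have [simp]: "d i \<in> carrier R" "v i k \<in> carrier R" "v l j \<in> carrier R"
            "v i j \<in> carrier R" "v l k \<in> carrier R"
          using i d I' l j by (auto simp: Pi_iff)
        have "(d i \<otimes> v l k) \<otimes> v i j =
            d i \<otimes> (v l k \<otimes> v i j \<ominus> v i k \<otimes> v l j) \<oplus> (d i \<otimes> v i k) \<otimes> v l j"
          by (intro eliminate) simp_all
        then show "c i \<otimes> v i j = d i \<otimes> w i j \<oplus> (d i \<otimes> v i k) \<otimes> v l j"
          using i I' by (auto simp: c_def w_def)
      qed (use d w I' l j in \<open>auto simp: Pi_iff\<close>)
      also have "\<dots> = (\<Oplus>i\<in>I'. d i \<otimes> w i j) \<oplus> (\<Oplus>i\<in>I'. (d i \<otimes> v i k) \<otimes> v l j)"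
        by (rule finsum_addf) (use d w I' l j in \<open>auto simp: Pi_iff\<close>)
      also have "(\<Oplus>i\<in>I'. (d i \<otimes> v i k) \<otimes> v l j) = s \<otimes> v l j"
        unfolding s_def by (rule finsum_ldistr[symmetric]) (use d I' l j in \<open>auto simp: Pi_iff\<close>)
      finally have "(\<Oplus>i\<in>I'. c i \<otimes> v i j) = s \<otimes> v l j"
        using zero s l j by simp
      moreover have "(\<Oplus>i\<in>I. c i \<otimes> v i j) = c l \<otimes> v l j \<oplus> (\<Oplus>i\<in>I'. c i \<otimes> v i j)"
        unfolding I'(4) using I' c j by (intro finsum_insert) (auto simp: Pi_iff)
      ultimately show ?thesis
        using s l j by (simp add: c_def l_minus l_neg)
    qed
    moreover have "\<exists>i\<in>I. c i \<noteq> \<zero>"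
    proof -
      obtain i where i: "i \<in> I'" "d i \<noteq> \<zero>" using d by blast
      then have "c i \<noteq> \<zero>" using I' d l by (auto simp: Pi_iff c_def integral_iff)
      then show ?thesis using i I' by blast
    qed
    ultimately show ?thesis using c by blast
  qed
qed

section \<open>Matrices acting on a free module\<close>

locale free_mod = cring R for R :: "('a, 'm) ring_scheme" (structure) +
  fixes k :: nat and V :: "('a, nat \<Rightarrow> 'a) module"
  assumes V_def: "V = free_module R k"
begin

abbreviation "M \<equiv> mat_ring R k"

definition mat_vec :: "(nat \<times> nat \<Rightarrow> 'a) \<Rightarrow> (nat \<Rightarrow> 'a) \<Rightarrow> nat \<Rightarrow> 'a" where
  "mat_vec A x = (\<lambda>i\<in>{..<k}. \<Oplus>j\<in>{..<k}. A (i, j) \<otimes> x j)"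

definition col :: "(nat \<times> nat \<Rightarrow> 'a) \<Rightarrow> nat \<Rightarrow> nat \<Rightarrow> 'a" where
  "col A j = (\<lambda>i\<in>{..<k}. A (i, j))"

definition of_cols :: "(nat \<Rightarrow> nat \<Rightarrow> 'a) \<Rightarrow> nat \<times> nat \<Rightarrow> 'a" where
  "of_cols c = (\<lambda>(i, j)\<in>{..<k} \<times> {..<k}. c j i)"

definition unit_vec :: "nat \<Rightarrow> nat \<Rightarrow> 'a" where
  "unit_vec j = (\<lambda>i\<in>{..<k}. if i = j then \<one> else \<zero>)"

lemma V_carrier: "carrier V = {..<k} \<rightarrow>\<^sub>E carrier R"
  and V_add: "x \<oplus>\<^bsub>V\<^esub> y = (\<lambda>i\<in>{..<k}. x i \<oplus> y i)"
  and V_smult: "a \<odot>\<^bsub>V\<^esub> x = (\<lambda>i\<in>{..<k}. a \<otimes> x i)"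
  and V_zero: "\<zero>\<^bsub>V\<^esub> = (\<lambda>i\<in>{..<k}. \<zero>)"
  by (simp_all add: V_def free_module_def)

lemma V_entry [simp]: "x \<in> carrier V \<Longrightarrow> i < k \<Longrightarrow> x i \<in> carrier R"
  by (auto simp: V_carrier)

lemma V_ops_entry [simp]:
  assumes "i < k"
  shows "(x \<oplus>\<^bsub>V\<^esub> y) i = x i \<oplus> y i" "(a \<odot>\<^bsub>V\<^esub> x) i = a \<otimes> x i" "\<zero>\<^bsub>V\<^esub> i = \<zero>"
  using assms by (simp_all add: V_add V_smult V_zero)

lemma V_ext: "\<lbrakk>x \<in> carrier V; y \<in> carrier V; \<And>i. i < k \<Longrightarrow> x i = y i\<rbrakk> \<Longrightarrow> x = y"
  unfolding V_carrier by (rule PiE_ext) auto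

sublocale V: module R V
proof (intro moduleI abelian_groupI)
  show "cring R" ..
  show "\<zero>\<^bsub>V\<^esub> \<in> carrier V" by (auto simp: V_carrier V_zero)
  have add: "x \<oplus>\<^bsub>V\<^esub> y \<in> carrier V" if "x \<in> carrier V" "y \<in> carrier V" for x y
    using that by (auto simp: V_carrier V_add)
  then show "x \<oplus>\<^bsub>V\<^esub> y \<in> carrier V" if "x \<in> carrier V" "y \<in> carrier V" for x y
    using that .
  have sm: "a \<odot>\<^bsub>V\<^esub> x \<in> carrier V" if "a \<in> carrier R" "x \<in> carrier V" for a x
    using that by (auto simp: V_carrier V_smult)
  then show "a \<odot>\<^bsub>V\<^esub> x \<in> carrier V" if "a \<in> carrier R" "x \<in> carrier V" for a x
    using that .
  fix x assume x: "x \<in> carrier V"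
  show "\<zero>\<^bsub>V\<^esub> \<oplus>\<^bsub>V\<^esub> x = x" "\<one> \<odot>\<^bsub>V\<^esub> x = x"
    using x by (auto intro!: V_ext add sm simp: V_zero V_carrier PiE_iff)
  show "\<exists>y\<in>carrier V. y \<oplus>\<^bsub>V\<^esub> x = \<zero>\<^bsub>V\<^esub>"
  proof
    show "(\<lambda>i\<in>{..<k}. \<ominus> x i) \<in> carrier V" using x by (auto simp: V_carrier)
    show "(\<lambda>i\<in>{..<k}. \<ominus> x i) \<oplus>\<^bsub>V\<^esub> x = \<zero>\<^bsub>V\<^esub>"
      unfolding V_add V_zero using x by (intro restrict_ext) (simp add: l_neg)
  qed
  fix a b assume ab: "a \<in> carrier R" "b \<in> carrier R"
  show "(a \<oplus> b) \<odot>\<^bsub>V\<^esub> x = a \<odot>\<^bsub>V\<^esub> x \<oplus>\<^bsub>V\<^esub> b \<odot>\<^bsub>V\<^esub> x" "(a \<otimes> b) \<odot>\<^bsub>V\<^esub> x = a \<odot>\<^bsub>V\<^esub> (b \<odot>\<^bsub>V\<^esub> x)"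
    using x ab by (auto intro!: V_ext add sm simp: l_distr m_assoc)
next
  fix x y z assume x: "x \<in> carrier V" "y \<in> carrier V" "z \<in> carrier V"
  show "x \<oplus>\<^bsub>V\<^esub> y \<oplus>\<^bsub>V\<^esub> z = x \<oplus>\<^bsub>V\<^esub> (y \<oplus>\<^bsub>V\<^esub> z)"
    unfolding V_add using x by (intro restrict_ext) (simp add: a_assoc)
next
  fix x y assume x: "x \<in> carrier V" "y \<in> carrier V"
  show "x \<oplus>\<^bsub>V\<^esub> y = y \<oplus>\<^bsub>V\<^esub> x"
    unfolding V_add using x by (intro restrict_ext) (simp add: a_comm)
  fix a assume a: "a \<in> carrier R"
  show "a \<odot>\<^bsub>V\<^esub> (x \<oplus>\<^bsub>V\<^esub> y) = a \<odot>\<^bsub>V\<^esub> x \<oplus>\<^bsub>V\<^esub> a \<odot>\<^bsub>V\<^esub> y"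
    unfolding V_add V_smult using x a by (intro restrict_ext) (simp add: r_distr)
qed

lemma V_finsum_entry:
  assumes "finite S" "f \<in> S \<rightarrow> carrier V" "i < k"
  shows "(\<Oplus>\<^bsub>V\<^esub>s\<in>S. f s) i = (\<Oplus>s\<in>S. f s i)"
  using assms
proof (induction S rule: finite_induct)
  case (insert s S)
  then show ?case
    by (subst V.M.finsum_insert; (subst finsum_insert)?) (auto simp: Pi_iff)
qed auto

lemma M_carrier: "carrier M = {..<k} \<times> {..<k} \<rightarrow>\<^sub>E carrier R"
  and M_mult: "A \<otimes>\<^bsub>M\<^esub> B = (\<lambda>(i, j)\<in>{..<k} \<times> {..<k}. \<Oplus>l\<in>{..<k}. A (i, l) \<otimes> B (l, j))"
  and M_add: "A \<oplus>\<^bsub>M\<^esub> B = (\<lambda>ij\<in>{..<k} \<times> {..<k}. A ij \<oplus> B ij)"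
  and M_one: "\<one>\<^bsub>M\<^esub> = (\<lambda>(i, j)\<in>{..<k} \<times> {..<k}. if i = j then \<one> else \<zero>)"
  by (simp_all add: mat_ring_def)

lemma M_entry [simp]: "A \<in> carrier M \<Longrightarrow> i < k \<Longrightarrow> j < k \<Longrightarrow> A (i, j) \<in> carrier R"
  by (auto simp: M_carrier)

lemma col_entry [simp]: "i < k \<Longrightarrow> col A j i = A (i, j)"
  by (simp add: col_def)

lemma col_closed [simp]: "A \<in> carrier M \<Longrightarrow> j < k \<Longrightarrow> col A j \<in> carrier V"
  by (auto simp: V_carrier M_carrier col_def)

lemma of_cols_closed [simp]: "(\<And>j. j < k \<Longrightarrow> c j \<in> carrier V) \<Longrightarrow> of_cols c \<in> carrier M"
  by (auto simp: V_carrier M_carrier of_cols_def)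

lemma col_of_cols [simp]: "j < k \<Longrightarrow> c j \<in> carrier V \<Longrightarrow> col (of_cols c) j = c j"
  by (rule V_ext) (auto simp: V_carrier of_cols_def col_def)

lemma M_ext:
  assumes "A \<in> carrier M" "B \<in> carrier M" "\<And>j. j < k \<Longrightarrow> col A j = col B j"
  shows "A = B"
proof (rule PiE_ext)
  show "A \<in> {..<k} \<times> {..<k} \<rightarrow>\<^sub>E carrier R" "B \<in> {..<k} \<times> {..<k} \<rightarrow>\<^sub>E carrier R"
    using assms by (simp_all add: M_carrier)
  fix ij assume "ij \<in> {..<k} \<times> {..<k}"
  then obtain i j where ij: "ij = (i, j)" "i < k" "j < k" by auto
  then show "A ij = B ij"
    using fun_cong[OF assms(3)[OF ij(3)], of i] by simp
qed

lemma unit_vec_closed [simp]: "unit_vec j \<in> carrier V"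
  by (auto simp: V_carrier unit_vec_def)

lemma M_mult_closed [simp]: "A \<in> carrier M \<Longrightarrow> B \<in> carrier M \<Longrightarrow> A \<otimes>\<^bsub>M\<^esub> B \<in> carrier M"
  by (auto simp: M_carrier M_mult PiE_iff Pi_iff intro!: finsum_closed)

lemma M_add_closed [simp]: "A \<in> carrier M \<Longrightarrow> B \<in> carrier M \<Longrightarrow> A \<oplus>\<^bsub>M\<^esub> B \<in> carrier M"
  by (auto simp: M_carrier M_add)

lemma M_one_closed [simp]: "\<one>\<^bsub>M\<^esub> \<in> carrier M"
  by (auto simp: M_carrier M_one)

lemma col_add: "j < k \<Longrightarrow> col (A \<oplus>\<^bsub>M\<^esub> B) j = col A j \<oplus>\<^bsub>V\<^esub> col B j"
  by (auto simp: col_def M_add V_add)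

lemma col_one: "j < k \<Longrightarrow> col \<one>\<^bsub>M\<^esub> j = unit_vec j"
  by (auto simp: col_def M_one unit_vec_def)

lemma col_mult:
  assumes "A \<in> carrier M" "B \<in> carrier M" "j < k"
  shows "col (A \<otimes>\<^bsub>M\<^esub> B) j = mat_vec A (col B j)"
  unfolding col_def mat_vec_def
  using assms by (intro restrict_ext) (auto simp: M_mult intro!: finsum_cong')

lemma mat_vec_closed [simp]: "A \<in> carrier M \<Longrightarrow> x \<in> carrier V \<Longrightarrow> mat_vec A x \<in> carrier V"
  by (auto simp: mat_vec_def V_carrier PiE_iff M_carrier intro!: finsum_closed)

lemma mat_vec_finsum:
  assumes "A \<in> carrier M" "x \<in> carrier V"
  shows "mat_vec A x = (\<Oplus>\<^bsub>V\<^esub>j\<in>{..<k}. x j \<odot>\<^bsub>V\<^esub> col A j)"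
proof (rule V_ext)
  have *: "(\<lambda>j. x j \<odot>\<^bsub>V\<^esub> col A j) \<in> {..<k} \<rightarrow> carrier V" using assms by auto
  then show "(\<Oplus>\<^bsub>V\<^esub>j\<in>{..<k}. x j \<odot>\<^bsub>V\<^esub> col A j) \<in> carrier V"
    by (rule V.M.finsum_closed)
  fix i assume i: "i < k"
  show "mat_vec A x i = (\<Oplus>\<^bsub>V\<^esub>j\<in>{..<k}. x j \<odot>\<^bsub>V\<^esub> col A j) i"
    unfolding V_finsum_entry[OF finite_lessThan * i] mat_vec_def
    using i assms by (auto intro!: finsum_cong' simp: m_comm)
qed (use assms in auto)

lemma mat_vec_add:
  assumes "A \<in> carrier M" "x \<in> carrier V" "y \<in> carrier V"
  shows "mat_vec A (x \<oplus>\<^bsub>V\<^esub> y) = mat_vec A x \<oplus>\<^bsub>V\<^esub> mat_vec A y"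
proof (rule V_ext)
  fix i assume i: "i < k"
  have "(\<Oplus>j\<in>{..<k}. A (i, j) \<otimes> (x \<oplus>\<^bsub>V\<^esub> y) j) =
      (\<Oplus>j\<in>{..<k}. A (i, j) \<otimes> x j \<oplus> A (i, j) \<otimes> y j)"
    using assms i by (intro finsum_cong') (auto simp: r_distr)
  also have "\<dots> = (\<Oplus>j\<in>{..<k}. A (i, j) \<otimes> x j) \<oplus> (\<Oplus>j\<in>{..<k}. A (i, j) \<otimes> y j)"
    using assms i by (intro finsum_addf) auto
  finally show "mat_vec A (x \<oplus>\<^bsub>V\<^esub> y) i = (mat_vec A x \<oplus>\<^bsub>V\<^esub> mat_vec A y) i"
    using i by (simp add: mat_vec_def)
qed (use assms in auto)

lemma mat_vec_smult:
  assumes "A \<in> carrier M" "x \<in> carrier V" "a \<in> carrier R"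
  shows "mat_vec A (a \<odot>\<^bsub>V\<^esub> x) = a \<odot>\<^bsub>V\<^esub> mat_vec A x"
proof (rule V_ext)
  fix i assume i: "i < k"
  have "(\<Oplus>j\<in>{..<k}. A (i, j) \<otimes> (a \<odot>\<^bsub>V\<^esub> x) j) = (\<Oplus>j\<in>{..<k}. a \<otimes> (A (i, j) \<otimes> x j))"
    using assms i by (intro finsum_cong') (auto simp: m_lcomm)
  also have "\<dots> = a \<otimes> (\<Oplus>j\<in>{..<k}. A (i, j) \<otimes> x j)"
    using assms i by (intro finsum_rdistr[symmetric]) auto
  finally show "mat_vec A (a \<odot>\<^bsub>V\<^esub> x) i = (a \<odot>\<^bsub>V\<^esub> mat_vec A x) i"
    using i by (simp add: mat_vec_def)
qed (use assms in auto)

lemma mat_vec_zero [simp]: "A \<in> carrier M \<Longrightarrow> mat_vec A \<zero>\<^bsub>V\<^esub> = \<zero>\<^bsub>V\<^esub>"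
  using mat_vec_smult[of A "\<zero>\<^bsub>V\<^esub>" \<zero>] by simp

lemma V_uminus: "x \<in> carrier V \<Longrightarrow> \<ominus>\<^bsub>V\<^esub> x = (\<ominus> \<one>) \<odot>\<^bsub>V\<^esub> x"
  by (simp add: V.smult_l_minus)

lemma mat_vec_diff:
  assumes "A \<in> carrier M" "x \<in> carrier V" "y \<in> carrier V"
  shows "mat_vec A (x \<ominus>\<^bsub>V\<^esub> y) = mat_vec A x \<ominus>\<^bsub>V\<^esub> mat_vec A y"
  using assms by (simp add: a_minus_def V_uminus mat_vec_add mat_vec_smult)

lemma mat_vec_of_finsum:
  assumes "A \<in> carrier M" "finite S" "f \<in> S \<rightarrow> carrier V"
  shows "mat_vec A (\<Oplus>\<^bsub>V\<^esub>s\<in>S. f s) = (\<Oplus>\<^bsub>V\<^esub>s\<in>S. mat_vec A (f s))"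
  using assms(2,3)
proof (induction S rule: finite_induct)
  case (insert s S)
  have "(\<Oplus>\<^bsub>V\<^esub>s\<in>S. f s) \<in> carrier V" using insert by (intro V.M.finsum_closed) auto
  then show ?case using insert assms(1)
    by (subst V.M.finsum_insert; (subst V.M.finsum_insert)?) (auto simp: mat_vec_add Pi_iff)
qed (use assms in auto)

text \<open>
  Linearity gives associativity with no exchange of double sums: both sides are the combination of
  the columns of the product with coefficients \<open>x\<close>.
\<close>

lemma mat_vec_mult:
  assumes "A \<in> carrier M" "B \<in> carrier M" "x \<in> carrier V"
  shows "mat_vec (A \<otimes>\<^bsub>M\<^esub> B) x = mat_vec A (mat_vec B x)"
proof -
  have "mat_vec A (mat_vec B x) = (\<Oplus>\<^bsub>V\<^esub>j\<in>{..<k}. mat_vec A (x j \<odot>\<^bsub>V\<^esub> col B j))"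
    using assms by (subst mat_vec_finsum[of B]) (auto intro!: mat_vec_of_finsum)
  also have "\<dots> = (\<Oplus>\<^bsub>V\<^esub>j\<in>{..<k}. x j \<odot>\<^bsub>V\<^esub> col (A \<otimes>\<^bsub>M\<^esub> B) j)"
    using assms by (intro V.M.finsum_cong') (auto simp: mat_vec_smult col_mult)
  also have "\<dots> = mat_vec (A \<otimes>\<^bsub>M\<^esub> B) x"
    using assms by (intro mat_vec_finsum[symmetric]) auto
  finally show ?thesis by simp
qed

lemma mat_vec_one [simp]: "x \<in> carrier V \<Longrightarrow> mat_vec \<one>\<^bsub>M\<^esub> x = x"
proof (rule V_ext)
  fix i assume x: "x \<in> carrier V" and i: "i < k"
  have "(\<Oplus>j\<in>{..<k}. \<one>\<^bsub>M\<^esub> (i, j) \<otimes> x j) = (\<Oplus>j\<in>{..<k}. if i = j then x j else \<zero>)"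
    using x i by (intro finsum_cong') (auto simp: M_one)
  also have "\<dots> = x i"
    using x i by (intro finsum_singleton) auto
  finally show "mat_vec \<one>\<^bsub>M\<^esub> x i = x i" using i by (simp add: mat_vec_def)
qed auto

lemma mat_vec_unit_vec [simp]: "A \<in> carrier M \<Longrightarrow> j < k \<Longrightarrow> mat_vec A (unit_vec j) = col A j"
proof (rule V_ext)
  fix i assume A: "A \<in> carrier M" and j: "j < k" and i: "i < k"
  have "(\<Oplus>l\<in>{..<k}. A (i, l) \<otimes> unit_vec j l) = (\<Oplus>l\<in>{..<k}. if j = l then A (i, l) else \<zero>)"
    using A i j by (intro finsum_cong') (auto simp: unit_vec_def)
  also have "\<dots> = A (i, j)"
    using A i j by (intro finsum_singleton) auto
  finally show "mat_vec A (unit_vec j) i = col A j i" using i by (simp add: mat_vec_def)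
qed auto

lemma mat_vec_scalar:
  assumes "a \<in> carrier R" "x \<in> carrier V"
  shows "mat_vec (of_cols (\<lambda>j. a \<odot>\<^bsub>V\<^esub> unit_vec j)) x = a \<odot>\<^bsub>V\<^esub> x"
proof -
  have "mat_vec (of_cols (\<lambda>j. a \<odot>\<^bsub>V\<^esub> unit_vec j)) x
      = (\<Oplus>\<^bsub>V\<^esub>j\<in>{..<k}. a \<odot>\<^bsub>V\<^esub> (x j \<odot>\<^bsub>V\<^esub> col \<one>\<^bsub>M\<^esub> j))"
    using assms
    by (subst mat_vec_finsum) (auto intro!: V.M.finsum_cong' simp: col_one V.smult_assoc1[symmetric] m_comm)
  also have "\<dots> = a \<odot>\<^bsub>V\<^esub> mat_vec \<one>\<^bsub>M\<^esub> x"
    using assms by (subst mat_vec_finsum) (auto intro!: V.finsum_smult_ldistr[symmetric])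
  finally show ?thesis using assms by simp
qed

lemma submodule_finsum:
  assumes J: "submodule J R V" and "finite S" "f \<in> S \<rightarrow> J"
  shows "(\<Oplus>\<^bsub>V\<^esub>s\<in>S. f s) \<in> J"
proof -
  have sub: "J \<subseteq> carrier V" using V.submoduleE(1)[OF J] .
  have zero: "\<zero>\<^bsub>V\<^esub> \<in> J"
    using V.submoduleE(2,4)[OF J] sub by (metis V.smult_l_null zero_closed ex_in_conv subsetD)
  show ?thesis using assms(2,3)
  proof (induction S rule: finite_induct)
    case (insert s S)
    then show ?case using V.submoduleE(5)[OF J] sub
      by (subst V.M.finsum_insert) auto
  qed (use zero in auto)
qed

lemma mat_vec_in_submodule:
  assumes "submodule J R V" "A \<in> carrier M" "\<And>j. j < k \<Longrightarrow> col A j \<in> J" "x \<in> carrier V"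
  shows "mat_vec A x \<in> J"
  unfolding mat_vec_finsum[OF assms(2,4)]
  using assms V.submoduleE(4)[OF assms(1)] by (intro submodule_finsum) auto

lemma image_submodule:
  assumes "A \<in> carrier M" shows "submodule (mat_vec A ` carrier V) R V"
proof (rule V.submoduleI)
  show "mat_vec A ` carrier V \<subseteq> carrier V" using assms by auto
  show "\<zero>\<^bsub>V\<^esub> \<in> mat_vec A ` carrier V"
    using mat_vec_zero[OF assms] V.M.zero_closed by (metis imageI)
  fix a b assume "a \<in> mat_vec A ` carrier V"
  then obtain x where x: "a = mat_vec A x" "x \<in> carrier V" by auto
  show "c \<odot>\<^bsub>V\<^esub> a \<in> mat_vec A ` carrier V" if "c \<in> carrier R" for c
    using x that mat_vec_smult[OF assms x(2) that] by (metis V.smult_closed imageI)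
  then show "\<ominus>\<^bsub>V\<^esub> a \<in> mat_vec A ` carrier V"
    using V_uminus[of a] x assms by auto
  show "a \<oplus>\<^bsub>V\<^esub> b \<in> mat_vec A ` carrier V" if "b \<in> mat_vec A ` carrier V"
    using that x mat_vec_add[OF assms x(2)] by (auto simp: image_iff) (metis V.M.a_closed)
qed

lemma V_diff_eq_zero_iff:
  assumes "x \<in> carrier V" "y \<in> carrier V"
  shows "x \<ominus>\<^bsub>V\<^esub> y = \<zero>\<^bsub>V\<^esub> \<longleftrightarrow> x = y"
proof
  have "x = (x \<ominus>\<^bsub>V\<^esub> y) \<oplus>\<^bsub>V\<^esub> y"
    using assms by (simp add: a_minus_def V.M.a_assoc V.M.l_neg)
  then show "x = y" if "x \<ominus>\<^bsub>V\<^esub> y = \<zero>\<^bsub>V\<^esub>" using that assms by simp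
qed (use assms in \<open>simp add: a_minus_def V.M.r_neg\<close>)

lemma mat_vec_inj_if_kernel:
  assumes "A \<in> carrier M" "\<And>x. x \<in> carrier V \<Longrightarrow> mat_vec A x = \<zero>\<^bsub>V\<^esub> \<Longrightarrow> x = \<zero>\<^bsub>V\<^esub>"
  shows "inj_on (mat_vec A) (carrier V)"
proof (rule inj_onI)
  fix x y assume xy: "x \<in> carrier V" "y \<in> carrier V" "mat_vec A x = mat_vec A y"
  then have "mat_vec A (x \<ominus>\<^bsub>V\<^esub> y) = \<zero>\<^bsub>V\<^esub>"
    using assms by (simp add: mat_vec_diff V_diff_eq_zero_iff)
  then have "x \<ominus>\<^bsub>V\<^esub> y = \<zero>\<^bsub>V\<^esub>" using assms xy by auto
  then show "x = y" using xy by (simp add: V_diff_eq_zero_iff)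
qed

end

section \<open>Reduction modulo powers of p\<close>

context padic
begin

definition vecs :: "'i set \<Rightarrow> ('i \<Rightarrow> nat \<Rightarrow> int) set" where
  "vecs I = I \<rightarrow>\<^sub>E carrier R"

definition red :: "'i set \<Rightarrow> nat \<Rightarrow> ('i \<Rightarrow> nat \<Rightarrow> int) \<Rightarrow> 'i \<Rightarrow> int" where
  "red I n x = (\<lambda>i\<in>I. x i n)"

definition lift :: "'i set \<Rightarrow> ('i \<Rightarrow> int) \<Rightarrow> 'i \<Rightarrow> nat \<Rightarrow> int" where
  "lift I r = (\<lambda>i\<in>I. of_integer (r i))"

text \<open>
  The sets that are unions of classes modulo \<open>p\<^sup>n\<close>. Recording the modulus \<open>n\<close>, in place of mere
  openness, reduces their measure to a count. The index set is left open because the same notion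
  serves for vectors and for matrices.
\<close>

definition saturated :: "'i set \<Rightarrow> nat \<Rightarrow> ('i \<Rightarrow> nat \<Rightarrow> int) set \<Rightarrow> bool" where
  "saturated I n S \<longleftrightarrow> S \<subseteq> vecs I \<and> (\<forall>x\<in>S. \<forall>y\<in>vecs I. red I n x = red I n y \<longrightarrow> y \<in> S)"

lemma vecs_entry: "x \<in> vecs I \<Longrightarrow> i \<in> I \<Longrightarrow> x i \<in> carrier R"
  by (auto simp: vecs_def)

lemma lift_closed [simp]: "lift I r \<in> vecs I"
  by (auto simp: lift_def vecs_def)

lemma red_lift [simp]: "r \<in> I \<rightarrow>\<^sub>E {0..<int p ^ n} \<Longrightarrow> red I n (lift I r) = r"
  by (rule PiE_ext[of _ I "\<lambda>_. UNIV"])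
    (auto simp: red_def lift_def of_integer_def PiE_iff)

lemma red_in: "x \<in> vecs I \<Longrightarrow> red I n x \<in> I \<rightarrow>\<^sub>E {0..<int p ^ n}"
  using level_range by (auto simp: red_def vecs_entry)

lemma red_eq_iff: "red I n x = red I n y \<longleftrightarrow> (\<forall>i\<in>I. x i n = y i n)"
  by (auto simp: red_def restrict_def fun_eq_iff)

lemma red_image: "red I n ` vecs I = I \<rightarrow>\<^sub>E {0..<int p ^ n}"
proof
  show "I \<rightarrow>\<^sub>E {0..<int p ^ n} \<subseteq> red I n ` vecs I"
    using red_lift lift_closed by (metis imageI subsetI)
qed (use red_in in blast)

lemma finite_red_image: "finite I \<Longrightarrow> finite (red I n ` vecs I)"
  by (simp add: red_image finite_PiE)

lemma card_red_image: "finite I \<Longrightarrow> card (red I n ` vecs I) = (p ^ n) ^ card I"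
  by (simp add: red_image card_PiE nat_power_eq)

lemma red_mono:
  assumes "x \<in> vecs I" "y \<in> vecs I" "red I n x = red I n y" "m \<le> n"
  shows "red I m x = red I m y"
  unfolding red_eq_iff
proof
  fix i assume i: "i \<in> I"
  then have "x i n mod int p ^ m = y i n mod int p ^ m" using assms(3) by (simp add: red_eq_iff)
  then show "x i m = y i m"
    using i assms level_compat[OF vecs_entry] by metis
qed

lemma vecs_ext:
  assumes "x \<in> vecs I" "y \<in> vecs I" "\<And>n. red I n x = red I n y" shows "x = y"
  using assms(1,2) unfolding vecs_def
proof (rule PiE_ext)
  show "x i = y i" if "i \<in> I" for i
    using assms(3) that by (auto simp: red_eq_iff)
qed

lemma red_eq_imp_ppow:
  assumes "x \<in> vecs I" "y \<in> vecs I" "red I n x = red I n y"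
  obtains z where "z \<in> vecs I" "\<And>i. i \<in> I \<Longrightarrow> y i = x i \<oplus> ppow n \<otimes> z i"
proof -
  have "\<forall>i\<in>I. \<exists>z. z \<in> carrier R \<and> y i = x i \<oplus> ppow n \<otimes> z"
  proof
    fix i assume i: "i \<in> I"
    then have "x i n = y i n" using assms(3) by (simp add: red_eq_iff)
    then show "\<exists>z. z \<in> carrier R \<and> y i = x i \<oplus> ppow n \<otimes> z"
      using level_eq_iff_ppow[of "x i" "y i" n] i assms by (auto simp: vecs_entry)
  qed
  then obtain z where z: "\<And>i. i \<in> I \<Longrightarrow> z i \<in> carrier R \<and> y i = x i \<oplus> ppow n \<otimes> z i"
    by metis
  show ?thesis by (rule that[of "restrict z I"]) (use z in \<open>auto simp: vecs_def\<close>)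
qed

lemma saturated_mono: "saturated I m S \<Longrightarrow> m \<le> n \<Longrightarrow> saturated I n S"
  unfolding saturated_def using red_mono by (meson subsetD)

lemma saturated_red_iff:
  assumes "saturated I n S" "x \<in> vecs I" shows "red I n x \<in> red I n ` S \<longleftrightarrow> x \<in> S"
  using assms unfolding saturated_def by auto

text \<open>
  Such a set is determined by its image in a finite set. The finiteness of the index, the
  countability of the set of lattices and the existence of a maximal lattice below all come from this.
\<close>

lemma finite_saturated: assumes "finite I" shows "finite {S. saturated I n S}"
proof (rule inj_on_finite)
  show "finite (Pow (red I n ` vecs I))" using finite_red_image[OF assms] by simp
  show "image (red I n) ` {S. saturated I n S} \<subseteq> Pow (red I n ` vecs I)"
    by (auto simp: saturated_def)
  show "inj_on (image (red I n)) {S. saturated I n S}"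
  proof (rule inj_onI)
    fix S T assume ST: "S \<in> {S. saturated I n S}" "T \<in> {S. saturated I n S}"
      "red I n ` S = red I n ` T"
    have eq: "S = {x \<in> vecs I. red I n x \<in> red I n ` S}" if "saturated I n S" for S
      using saturated_red_iff[OF that] that by (auto simp: saturated_def)
    show "S = T" using eq[of S] eq[of T] ST unfolding ST(3) by blast
  qed
qed

end

section \<open>Invertible matrices over the p-adic integers\<close>

locale padic_lattice = padic p R for p and R (structure) +
  fixes k :: nat and V :: "(nat \<Rightarrow> int, nat \<Rightarrow> nat \<Rightarrow> int) module"
  assumes V_def: "V = free_module R k"
begin

sublocale free_mod R k V
  by unfold_locales (rule V_def)

abbreviation "redV \<equiv> red {..<k}"
abbreviation "redM \<equiv> red ({..<k} \<times> {..<k})"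

lemma vecs_V: "vecs {..<k} = carrier V"
  by (simp add: vecs_def V_carrier)

lemma vecs_M: "vecs ({..<k} \<times> {..<k}) = carrier M"
  by (simp add: vecs_def M_carrier)

lemma redV_eq_iff:
  assumes "x \<in> carrier V" "y \<in> carrier V"
  shows "redV n x = redV n y \<longleftrightarrow> (\<exists>z\<in>carrier V. y = x \<oplus>\<^bsub>V\<^esub> ppow n \<odot>\<^bsub>V\<^esub> z)"
proof
  assume "redV n x = redV n y"
  then obtain z where z: "z \<in> carrier V" "\<And>i. i < k \<Longrightarrow> y i = x i \<oplus> ppow n \<otimes> z i"
    using red_eq_imp_ppow[of x "{..<k}" y n] assms by (auto simp: vecs_V)
  then have "y = x \<oplus>\<^bsub>V\<^esub> ppow n \<odot>\<^bsub>V\<^esub> z"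
    using assms by (intro V_ext) auto
  then show "\<exists>z\<in>carrier V. y = x \<oplus>\<^bsub>V\<^esub> ppow n \<odot>\<^bsub>V\<^esub> z" using z by blast
next
  assume "\<exists>z\<in>carrier V. y = x \<oplus>\<^bsub>V\<^esub> ppow n \<odot>\<^bsub>V\<^esub> z"
  then obtain z where z: "z \<in> carrier V" "y = x \<oplus>\<^bsub>V\<^esub> ppow n \<odot>\<^bsub>V\<^esub> z" by blast
  show "redV n x = redV n y"
    unfolding red_eq_iff z(2) using assms z(1)
    by (auto simp: level_eq_iff_ppow)
qed

lemma redV_zero_iff:
  assumes "x \<in> carrier V"
  shows "redV n x = redV n \<zero>\<^bsub>V\<^esub> \<longleftrightarrow> (\<exists>z\<in>carrier V. x = ppow n \<odot>\<^bsub>V\<^esub> z)"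
  using redV_eq_iff[of "\<zero>\<^bsub>V\<^esub>" x n] assms by (auto simp: eq_commute)

lemma V_ppow_cancel:
  assumes "x \<in> carrier V" "y \<in> carrier V" "ppow n \<odot>\<^bsub>V\<^esub> x = ppow n \<odot>\<^bsub>V\<^esub> y"
  shows "x = y"
proof (rule V_ext[OF assms(1,2)])
  fix i assume i: "i < k"
  then have "ppow n \<otimes> x i = ppow n \<otimes> y i" using fun_cong[OF assms(3), of i] by simp
  then show "x i = y i" using ppow_cancel[of "x i" "y i" n] assms i by simp
qed

lemma V_ppow_add:
  "x \<in> carrier V \<Longrightarrow> ppow (m + n) \<odot>\<^bsub>V\<^esub> x = ppow m \<odot>\<^bsub>V\<^esub> (ppow n \<odot>\<^bsub>V\<^esub> x)"
  by (simp add: ppow_add V.smult_assoc1)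

lemma mat_vec_level:
  assumes "A \<in> carrier M" "x \<in> carrier V" "i < k"
  shows "mat_vec A x i n = (\<Sum>j<k. A (i, j) n * x j n) mod int p ^ n"
proof -
  have "mat_vec A x i n = (\<Sum>j<k. (A (i, j) \<otimes> x j) n) mod int p ^ n"
    using assms by (simp add: mat_vec_def finsum_level Pi_iff)
  then show ?thesis by (simp add: mult_eq mod_sum_eq)
qed

lemma redV_mat_vec_cong:
  assumes "A \<in> carrier M" "A' \<in> carrier M" "x \<in> carrier V" "x' \<in> carrier V"
    and "redM n A = redM n A'" "redV n x = redV n x'"
  shows "redV n (mat_vec A x) = redV n (mat_vec A' x')"
  using assms by (simp add: red_eq_iff mat_vec_level)

lemma redV_diff:
  assumes "x \<in> carrier V" "y \<in> carrier V"
  shows "redV n x = redV n y \<longleftrightarrow> redV n (x \<ominus>\<^bsub>V\<^esub> y) = redV n \<zero>\<^bsub>V\<^esub>"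
proof -
  have 1: "x = (x \<ominus>\<^bsub>V\<^esub> y) \<oplus>\<^bsub>V\<^esub> y"
    using assms by (simp add: a_minus_def V.M.a_assoc V.M.l_neg)
  have 2: "(y \<oplus>\<^bsub>V\<^esub> z) \<ominus>\<^bsub>V\<^esub> y = z" if "z \<in> carrier V" for z
    using assms that V.M.a_comm[of y z] by (simp add: a_minus_def V.M.a_assoc V.M.r_neg)
  have "redV n x = redV n y \<longleftrightarrow> (\<exists>z\<in>carrier V. x = y \<oplus>\<^bsub>V\<^esub> ppow n \<odot>\<^bsub>V\<^esub> z)"
    using redV_eq_iff[of y x n] assms by (simp add: eq_commute)
  also have "\<dots> \<longleftrightarrow> (\<exists>z\<in>carrier V. x \<ominus>\<^bsub>V\<^esub> y = ppow n \<odot>\<^bsub>V\<^esub> z)"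
    using 1 2 assms by (metis V.M.a_comm V.smult_closed ppow_closed)
  also have "\<dots> \<longleftrightarrow> redV n (x \<ominus>\<^bsub>V\<^esub> y) = redV n \<zero>\<^bsub>V\<^esub>"
    using redV_zero_iff[of "x \<ominus>\<^bsub>V\<^esub> y" n] assms by simp
  finally show ?thesis .
qed

definition inj_mod_p :: "(nat \<times> nat \<Rightarrow> nat \<Rightarrow> int) \<Rightarrow> bool" where
  "inj_mod_p B \<longleftrightarrow>
    (\<forall>x\<in>carrier V. redV 1 (mat_vec B x) = redV 1 \<zero>\<^bsub>V\<^esub> \<longrightarrow> redV 1 x = redV 1 \<zero>\<^bsub>V\<^esub>)"

lemma inj_mod_p_cong:
  assumes "A \<in> carrier M" "B \<in> carrier M" "redM 1 A = redM 1 B" "inj_mod_p A"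
  shows "inj_mod_p B"
  using assms redV_mat_vec_cong[OF assms(1,2) _ _ assms(3)] unfolding inj_mod_p_def by metis

text \<open>
  Successive approximation: once \<open>x\<close> is divisible by \<open>p\<^sup>n\<close>, the hypothesis modulo \<open>p\<close> applies to
  \<open>x / p\<^sup>n\<close> and yields one more factor \<open>p\<close>.
\<close>

lemma inj_mod_p_level_zero:
  assumes "B \<in> carrier M" "inj_mod_p B" "x \<in> carrier V" "redV n (mat_vec B x) = redV n \<zero>\<^bsub>V\<^esub>"
  shows "redV n x = redV n \<zero>\<^bsub>V\<^esub>"
  using assms(3,4)
proof (induction n arbitrary: x)
  case 0
  have "x i 0 = 0" if "i < k" for i
    using level_range[of "x i" 0] 0 that by simp
  then show ?case by (auto simp: red_eq_iff zero_eq)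
next
  case (Suc n)
  have "redV n (mat_vec B x) = redV n \<zero>\<^bsub>V\<^esub>"
    by (rule red_mono[of _ _ _ "Suc n"]) (use Suc.prems assms(1) in \<open>auto simp: vecs_V\<close>)
  then obtain y where y: "y \<in> carrier V" "x = ppow n \<odot>\<^bsub>V\<^esub> y"
    using Suc redV_zero_iff by blast
  obtain w where w: "w \<in> carrier V" "mat_vec B x = ppow (n + 1) \<odot>\<^bsub>V\<^esub> w"
    using Suc.prems assms(1) redV_zero_iff[of "mat_vec B x" "Suc n"] by auto
  have "ppow n \<odot>\<^bsub>V\<^esub> mat_vec B y = ppow n \<odot>\<^bsub>V\<^esub> (ppow 1 \<odot>\<^bsub>V\<^esub> w)"
    using w y assms(1) V_ppow_add[of w n 1] by (simp add: mat_vec_smult)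
  then have "mat_vec B y = ppow 1 \<odot>\<^bsub>V\<^esub> w"
    using w y assms(1) V_ppow_cancel[of "mat_vec B y" "ppow 1 \<odot>\<^bsub>V\<^esub> w" n] by simp
  then have "redV 1 (mat_vec B y) = redV 1 \<zero>\<^bsub>V\<^esub>"
    using redV_zero_iff[OF mat_vec_closed[OF assms(1) y(1)]] w(1) by blast
  then have "redV 1 y = redV 1 \<zero>\<^bsub>V\<^esub>"
    using assms(2) y(1) unfolding inj_mod_p_def by blast
  then obtain z where z: "z \<in> carrier V" "y = ppow 1 \<odot>\<^bsub>V\<^esub> z"
    using y redV_zero_iff by blast
  then have "x = ppow (n + 1) \<odot>\<^bsub>V\<^esub> z" using y V_ppow_add[of z n 1] by simp
  then show ?case using z Suc.prems redV_zero_iff[of x "Suc n"] by auto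
qed

lemma inj_mod_p_level:
  assumes "B \<in> carrier M" "inj_mod_p B" "x \<in> carrier V" "y \<in> carrier V"
    and "redV n (mat_vec B x) = redV n (mat_vec B y)"
  shows "redV n x = redV n y"
  using assms inj_mod_p_level_zero[of B "x \<ominus>\<^bsub>V\<^esub> y" n]
  by (simp add: redV_diff[of "mat_vec B x"] redV_diff[of x] mat_vec_diff)

lemma inj_mod_p_inj:
  assumes "B \<in> carrier M" "inj_mod_p B" shows "inj_on (mat_vec B) (carrier V)"
proof (rule inj_onI)
  fix x y assume xy: "x \<in> carrier V" "y \<in> carrier V" "mat_vec B x = mat_vec B y"
  have "redV n x = redV n y" for n
    using inj_mod_p_level[OF assms xy(1,2)] xy(3) by simp
  then show "x = y" using vecs_ext[of x "{..<k}" y] xy by (simp add: vecs_V)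
qed

text \<open>
  The endomap of the finite set of vectors modulo \<open>p\<^sup>n\<close> through which injectivity and surjectivity
  are compared.
\<close>

definition mat_vec_mod :: "nat \<Rightarrow> (nat \<times> nat \<Rightarrow> nat \<Rightarrow> int) \<Rightarrow> (nat \<Rightarrow> int) \<Rightarrow> nat \<Rightarrow> int" where
  "mat_vec_mod n B r = redV n (mat_vec B (lift {..<k} r))"

lemma mat_vec_mod_red:
  assumes "B \<in> carrier M" "x \<in> carrier V"
  shows "mat_vec_mod n B (redV n x) = redV n (mat_vec B x)"
proof -
  have "redV n (lift {..<k} (redV n x)) = redV n x"
    using assms red_in[of x "{..<k}" n] by (simp add: vecs_V)
  moreover have "lift {..<k} (redV n x) \<in> carrier V"
    using lift_closed[of "{..<k}"] by (simp add: vecs_V)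
  ultimately show ?thesis unfolding mat_vec_mod_def
    using redV_mat_vec_cong[OF assms(1) assms(1) _ assms(2) refl] by blast
qed

text \<open>
  Modulo each \<open>p\<^sup>n\<close> an injective endomap of a finite set is onto; the preimages of \<open>y\<close> found in
  this way are unique modulo \<open>p\<^sup>n\<close>, hence compatible, and form a preimage in the inverse limit.
\<close>

lemma inj_mod_p_surj:
  assumes B: "B \<in> carrier M" "inj_mod_p B" shows "mat_vec B ` carrier V = carrier V"
proof
  show "carrier V \<subseteq> mat_vec B ` carrier V"
  proof
    fix y assume y: "y \<in> carrier V"
    have "\<exists>x. x \<in> carrier V \<and> redV n (mat_vec B x) = redV n y" for n
    proof -
      have "inj_on (mat_vec_mod n B) (redV n ` carrier V)"
      proof (rule inj_onI)
        fix r s assume rs: "r \<in> redV n ` carrier V" "s \<in> redV n ` carrier V"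
          "mat_vec_mod n B r = mat_vec_mod n B s"
        then obtain u w where uw: "u \<in> carrier V" "w \<in> carrier V" "r = redV n u" "s = redV n w"
          by blast
        then show "r = s"
          using rs(3) inj_mod_p_level[OF B uw(1,2)] B by (simp add: mat_vec_mod_red)
      qed
      moreover have "mat_vec_mod n B ` redV n ` carrier V \<subseteq> redV n ` carrier V"
        using B by (auto simp: mat_vec_mod_red)
      moreover have "finite (redV n ` carrier V)"
        using finite_red_image[of "{..<k}"] by (simp add: vecs_V)
      ultimately have "mat_vec_mod n B ` redV n ` carrier V = redV n ` carrier V"
        by (intro endo_inj_surj)
      then have "redV n y \<in> mat_vec_mod n B ` redV n ` carrier V" using y by blast
      then show ?thesis using B by (auto simp: mat_vec_mod_red)
    qed
    then obtain x where x: "\<And>n. x n \<in> carrier V" "\<And>n. redV n (mat_vec B (x n)) = redV n y"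
      by metis
    have step: "redV n (x (Suc n)) = redV n (x n)" for n
    proof -
      have "redV n (mat_vec B (x (Suc n))) = redV n y"
        using red_mono[of "mat_vec B (x (Suc n))" "{..<k}" y "Suc n" n] x B y by (simp add: vecs_V)
      then show ?thesis using inj_mod_p_level[OF B x(1) x(1)] x(2) by simp
    qed
    define z where "z = (\<lambda>i\<in>{..<k}. \<lambda>n. x n i n)"
    have z: "z \<in> carrier V"
    proof -
      have "(\<lambda>n. x n i n) \<in> carrier R" if i: "i < k" for i
        unfolding carrier_iff
      proof (intro allI conjI)
        fix n
        have xi: "x n i \<in> carrier R" for n using x i by simp
        show "x n i n \<in> {0..<int p ^ n}" using level_range[OF xi] by simp
        have "x (Suc n) i (Suc n) mod int p ^ n = x (Suc n) i n"
          using level_compat[OF xi] by simp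
        also have "\<dots> = x n i n" using step[of n] i by (simp add: red_eq_iff)
        finally show "x (Suc n) i (Suc n) mod int p ^ n = x n i n" .
      qed
      then show ?thesis by (auto simp: z_def V_carrier)
    qed
    have "mat_vec B z = y"
    proof (rule vecs_ext[of _ "{..<k}"])
      fix n
      have "redV n z = redV n (x n)" by (simp add: red_eq_iff z_def)
      then have "redV n (mat_vec B z) = redV n (mat_vec B (x n))"
        using redV_mat_vec_cong[OF B(1) B(1) z x(1)] by simp
      then show "redV n (mat_vec B z) = redV n y" using x by simp
    qed (use z y B in \<open>auto simp: vecs_V\<close>)
    then show "y \<in> mat_vec B ` carrier V" using z by blast
  qed
qed (use B in auto)

text \<open>
  A surjective endomap of the finite set of vectors modulo \<open>p\<close> is injective.
\<close>

lemma surj_inj_mod_p: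
  assumes B: "B \<in> carrier M" "mat_vec B ` carrier V = carrier V" shows "inj_mod_p B"
proof -
  let ?F = "redV 1 ` carrier V"
  have "?F \<subseteq> mat_vec_mod 1 B ` ?F"
  proof
    fix r assume "r \<in> ?F"
    then obtain y where y: "y \<in> carrier V" "r = redV 1 y" by blast
    then obtain x where x: "x \<in> carrier V" "y = mat_vec B x" using B(2) by blast
    then have "r = mat_vec_mod 1 B (redV 1 x)" using B(1) y by (simp add: mat_vec_mod_red)
    then show "r \<in> mat_vec_mod 1 B ` ?F" using x by blast
  qed
  moreover have "mat_vec_mod 1 B ` ?F \<subseteq> ?F" using B by (auto simp: mat_vec_mod_red)
  ultimately have "card (mat_vec_mod 1 B ` ?F) = card ?F" by (metis subset_antisym)
  moreover have "finite ?F"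
    using finite_red_image[of "{..<k}"] by (simp add: vecs_V)
  ultimately have inj: "inj_on (mat_vec_mod 1 B) ?F" by (simp add: eq_card_imp_inj_on)
  then have "redV 1 x = redV 1 y"
    if "x \<in> carrier V" "y \<in> carrier V" "redV 1 (mat_vec B x) = redV 1 (mat_vec B y)" for x y
    using inj_onD[OF inj, of "redV 1 x" "redV 1 y"] that
    by (simp add: mat_vec_mod_red[OF B(1)])
  from this[OF _ V.M.zero_closed] show ?thesis
    unfolding inj_mod_p_def mat_vec_zero[OF B(1)] by blast
qed

lemma surj_iff_inj_mod_p:
  "B \<in> carrier M \<Longrightarrow> mat_vec B ` carrier V = carrier V \<longleftrightarrow> inj_mod_p B"
  using surj_inj_mod_p inj_mod_p_surj by blast

text \<open>
  A right inverse consists of preimages of the unit vectors. It is also a left inverse because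
  a surjective matrix is injective.
\<close>

lemma Units_M: "Units M = {B \<in> carrier M. mat_vec B ` carrier V = carrier V}"
proof (intro subset_antisym subsetI)
  fix B assume "B \<in> Units M"
  then obtain C where B: "B \<in> carrier M" and C: "C \<in> carrier M" "B \<otimes>\<^bsub>M\<^esub> C = \<one>\<^bsub>M\<^esub>"
    unfolding Units_def by auto
  have "x \<in> mat_vec B ` carrier V" if x: "x \<in> carrier V" for x
  proof
    show "x = mat_vec B (mat_vec C x)" using mat_vec_mult[OF B C(1) x] x by (simp add: C(2))
  qed (use C x in simp)
  then show "B \<in> {B \<in> carrier M. mat_vec B ` carrier V = carrier V}" using B by auto
next
  fix B assume "B \<in> {B \<in> carrier M. mat_vec B ` carrier V = carrier V}"
  then have B: "B \<in> carrier M" and surj: "mat_vec B ` carrier V = carrier V" by auto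
  have inj: "inj_on (mat_vec B) (carrier V)"
    using B surj by (simp add: inj_mod_p_inj surj_inj_mod_p)
  have "\<exists>c. c \<in> carrier V \<and> mat_vec B c = unit_vec j" for j
    using surj unit_vec_closed[of j] by (metis imageE)
  then obtain c where c: "\<And>j. c j \<in> carrier V" "\<And>j. mat_vec B (c j) = unit_vec j" by metis
  define C where "C = of_cols c"
  have C: "C \<in> carrier M" unfolding C_def using c by simp
  have BC: "B \<otimes>\<^bsub>M\<^esub> C = \<one>\<^bsub>M\<^esub>"
    using B C c by (intro M_ext) (auto simp: col_mult col_one C_def)
  moreover have "C \<otimes>\<^bsub>M\<^esub> B = \<one>\<^bsub>M\<^esub>"
  proof (rule M_ext)
    fix j assume j: "j < k"
    have "mat_vec B (mat_vec C (col B j)) = mat_vec B (unit_vec j)"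
      using mat_vec_mult[OF B C, of "col B j"] B j by (simp add: BC)
    then have "mat_vec C (col B j) = unit_vec j"
      using inj_onD[OF inj] B C j by simp
    then show "col (C \<otimes>\<^bsub>M\<^esub> B) j = col \<one>\<^bsub>M\<^esub> j"
      using B C j by (simp add: col_mult col_one)
  qed (use B C in auto)
  ultimately show "B \<in> Units M" using B C unfolding Units_def by auto
qed

end

section \<open>Lattices\<close>

context padic_lattice
begin

text \<open>
  Equivalent to full rank by \<open>full_rank_iff_lattice\<close>; in this form \<open>J\<close> is visible modulo \<open>p\<^sup>m\<close>.
\<close>

definition lattice :: "(nat \<Rightarrow> nat \<Rightarrow> int) set \<Rightarrow> bool" where
  "lattice J \<longleftrightarrow> submodule J R V \<and> (\<exists>m. \<forall>x\<in>carrier V. ppow m \<odot>\<^bsub>V\<^esub> x \<in> J)"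

lemma submodule_saturated:
  assumes J: "submodule J R V" and m: "\<And>x. x \<in> carrier V \<Longrightarrow> ppow m \<odot>\<^bsub>V\<^esub> x \<in> J"
  shows "saturated {..<k} m J"
  unfolding saturated_def vecs_V
proof (intro conjI ballI impI)
  show "J \<subseteq> carrier V" by (rule V.submoduleE(1)[OF J])
  fix x y assume xy: "x \<in> J" "y \<in> carrier V" "redV m x = redV m y"
  then obtain z where "z \<in> carrier V" "y = x \<oplus>\<^bsub>V\<^esub> ppow m \<odot>\<^bsub>V\<^esub> z"
    using \<open>J \<subseteq> carrier V\<close> redV_eq_iff[of x y m] by blast
  then show "y \<in> J" using V.submoduleE(5)[OF J xy(1) m] by simp
qed

lemma lattice_mono:
  "\<lbrakk>lattice L; submodule J R V; L \<subseteq> J\<rbrakk> \<Longrightarrow> lattice J"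
  unfolding lattice_def by blast

lemma latticeI:
  assumes J: "submodule J R V" and m: "\<And>i. i < k \<Longrightarrow> \<exists>m. ppow m \<odot>\<^bsub>V\<^esub> unit_vec i \<in> J"
  shows "lattice J"
proof -
  obtain m where m: "\<And>i. i < k \<Longrightarrow> ppow (m i) \<odot>\<^bsub>V\<^esub> unit_vec i \<in> J" using m by metis
  define N where "N = (\<Sum>i<k. m i)"
  have N: "ppow N \<odot>\<^bsub>V\<^esub> unit_vec i \<in> J" if i: "i < k" for i
  proof -
    have "m i \<le> N" unfolding N_def using i by (intro member_le_sum) auto
    then have "ppow N \<odot>\<^bsub>V\<^esub> unit_vec i = ppow (N - m i) \<odot>\<^bsub>V\<^esub> (ppow (m i) \<odot>\<^bsub>V\<^esub> unit_vec i)"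
      using V_ppow_add[of "unit_vec i" "N - m i" "m i"] by simp
    then show ?thesis using V.submoduleE(4)[OF J _ m[OF i], of "ppow (N - m i)"] by simp
  qed
  have "ppow N \<odot>\<^bsub>V\<^esub> x \<in> J" if x: "x \<in> carrier V" for x
    unfolding mat_vec_scalar[OF ppow_closed x, symmetric]
    using N x by (intro mat_vec_in_submodule[OF J]) auto
  then show ?thesis using J unfolding lattice_def by blast
qed

lemma exists_dependence_mat_vec:
  assumes A: "A \<in> carrier M" and y: "y \<in> carrier V"
  obtains c d where "c \<in> carrier V" "d \<in> carrier R" "c \<noteq> \<zero>\<^bsub>V\<^esub> \<or> d \<noteq> \<zero>"
    "mat_vec A c \<oplus>\<^bsub>V\<^esub> d \<odot>\<^bsub>V\<^esub> y = \<zero>\<^bsub>V\<^esub>"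
proof -
  define v where "v i j = (if i < k then A (j, i) else y j)" for i j
  have v: "v i j \<in> carrier R" if "j < k" for i j using that A y by (simp add: v_def)
  obtain c where c: "c \<in> {..k} \<rightarrow> carrier R" "\<exists>i\<in>{..k}. c i \<noteq> \<zero>"
    "\<And>j. j < k \<Longrightarrow> (\<Oplus>i\<in>{..k}. c i \<otimes> v i j) = \<zero>"
    using exists_dependence[of "{..k}" k v] v by auto
  let ?c = "restrict c {..<k}"
  have c': "?c \<in> carrier V" using c(1) by (auto simp: V_carrier)
  have "?c \<noteq> \<zero>\<^bsub>V\<^esub> \<or> c k \<noteq> \<zero>"
  proof (rule ccontr)
    assume *: "\<not> ?thesis"
    then have "c i = \<zero>" if "i < k" for i
      using that by (metis V_ops_entry(3) lessThan_iff restrict_apply')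
    then show False using c(2) * by (auto simp: le_less)
  qed
  moreover have "mat_vec A ?c \<oplus>\<^bsub>V\<^esub> c k \<odot>\<^bsub>V\<^esub> y = \<zero>\<^bsub>V\<^esub>"
  proof (rule V_ext)
    fix j assume j: "j < k"
    have ins: "{..k} = insert k {..<k}" by auto
    have "(\<Oplus>i\<in>{..<k}. A (j, i) \<otimes> ?c i) = (\<Oplus>i\<in>{..<k}. c i \<otimes> v i j)"
      using A c(1) j by (intro finsum_cong') (auto simp: v_def m_comm Pi_iff)
    moreover have "(\<Oplus>i\<in>{..k}. c i \<otimes> v i j) = c k \<otimes> v k j \<oplus> (\<Oplus>i\<in>{..<k}. c i \<otimes> v i j)"
      unfolding ins using c(1) v[OF j] by (intro finsum_insert) (auto simp: Pi_iff)
    moreover have "(\<Oplus>i\<in>{..<k}. c i \<otimes> v i j) \<in> carrier R"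
      using c(1) v[OF j] by (intro finsum_closed) (auto simp: Pi_iff)
    moreover have "c k \<in> carrier R" "y j \<in> carrier R" using c(1) y j by auto
    ultimately show "(mat_vec A ?c \<oplus>\<^bsub>V\<^esub> c k \<odot>\<^bsub>V\<^esub> y) j = \<zero>\<^bsub>V\<^esub> j"
      using c(3)[OF j] j by (simp add: mat_vec_def v_def a_comm)
  qed (use A c c' y in \<open>auto intro!: V.M.a_closed V.smult_closed\<close>)
  ultimately show ?thesis using c(1) c' by (intro that[of ?c "c k"]) auto
qed

text \<open>
  Each unit vector satisfies a relation with the columns of \<open>A\<close>, in which its own coefficient is
  nonzero because the columns are independent. Up to a unit this coefficient is a power of \<open>p\<close>.
\<close>

lemma lattice_if_kernel_zero:
  assumes A: "A \<in> carrier M" and ker: "\<And>x. x \<in> carrier V \<Longrightarrow> mat_vec A x = \<zero>\<^bsub>V\<^esub> \<Longrightarrow> x = \<zero>\<^bsub>V\<^esub>"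
  shows "lattice (mat_vec A ` carrier V)"
proof (rule latticeI)
  show sub: "submodule (mat_vec A ` carrier V) R V" by (rule image_submodule[OF A])
  fix i assume i: "i < k"
  obtain c d where c: "c \<in> carrier V" "d \<in> carrier R" "c \<noteq> \<zero>\<^bsub>V\<^esub> \<or> d \<noteq> \<zero>"
    "mat_vec A c \<oplus>\<^bsub>V\<^esub> d \<odot>\<^bsub>V\<^esub> unit_vec i = \<zero>\<^bsub>V\<^esub>"
    using exists_dependence_mat_vec[OF A unit_vec_closed[of i]] by blast
  have "d \<noteq> \<zero>"
  proof
    assume "d = \<zero>"
    then show False using c A ker[of c] by simp
  qed
  then obtain m u where u: "u \<in> Units R" "d = ppow m \<otimes> u" using c nonzero_decomp by blast
  have "\<ominus>\<^bsub>V\<^esub> mat_vec A c = d \<odot>\<^bsub>V\<^esub> unit_vec i"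
    using c A by (intro V.M.minus_equality) (auto simp: V.M.a_comm)
  moreover have "\<ominus>\<^bsub>V\<^esub> mat_vec A c \<in> mat_vec A ` carrier V" using V.submoduleE(3)[OF sub] c by blast
  ultimately have "inv u \<odot>\<^bsub>V\<^esub> (d \<odot>\<^bsub>V\<^esub> unit_vec i) \<in> mat_vec A ` carrier V"
    using V.submoduleE(4)[OF sub] u by simp
  moreover have "inv u \<otimes> d = ppow m"
    using u m_lcomm[of "inv u" "ppow m" u] by (simp add: Units_closed)
  then have "inv u \<odot>\<^bsub>V\<^esub> (d \<odot>\<^bsub>V\<^esub> unit_vec i) = ppow m \<odot>\<^bsub>V\<^esub> unit_vec i"
    using u c by (simp add: V.smult_assoc1[symmetric])
  ultimately show "\<exists>m. ppow m \<odot>\<^bsub>V\<^esub> unit_vec i \<in> mat_vec A ` carrier V" by auto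
qed

lemma V_smult_eq_zero:
  assumes "a \<in> carrier R" "a \<noteq> \<zero>" "x \<in> carrier V" "a \<odot>\<^bsub>V\<^esub> x = \<zero>\<^bsub>V\<^esub>"
  shows "x = \<zero>\<^bsub>V\<^esub>"
proof (rule V_ext[OF assms(3)])
  fix i assume i: "i < k"
  then have "a \<otimes> x i = \<zero>" using fun_cong[OF assms(4), of i] by simp
  then show "x i = \<zero>\<^bsub>V\<^esub> i" using assms i by (simp add: integral_iff)
qed simp

text \<open>
  The vectors \<open>b\<^sub>j\<close> that \<open>A\<close> maps to \<open>p\<^sup>m e\<^sub>j\<close> are independent, and together with a vector \<open>x\<close>
  of the kernel they are \<open>k + 1\<close> dependent vectors. Applying \<open>A\<close> to the relation shows that only \<open>x\<close>
  enters into it.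
\<close>

lemma kernel_zero_if_lattice:
  assumes A: "A \<in> carrier M" and lat: "lattice (mat_vec A ` carrier V)"
    and x: "x \<in> carrier V" "mat_vec A x = \<zero>\<^bsub>V\<^esub>"
  shows "x = \<zero>\<^bsub>V\<^esub>"
proof -
  obtain m where m: "\<And>x. x \<in> carrier V \<Longrightarrow> ppow m \<odot>\<^bsub>V\<^esub> x \<in> mat_vec A ` carrier V"
    using lat unfolding lattice_def by blast
  have "\<exists>b. b \<in> carrier V \<and> mat_vec A b = ppow m \<odot>\<^bsub>V\<^esub> unit_vec j" for j
    using m[OF unit_vec_closed[of j]] by (metis imageE)
  then obtain b where b: "\<And>j. b j \<in> carrier V" "\<And>j. mat_vec A (b j) = ppow m \<odot>\<^bsub>V\<^esub> unit_vec j"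
    by metis
  define B where "B = of_cols b"
  have B: "B \<in> carrier M" using b by (simp add: B_def)
  have AB: "A \<otimes>\<^bsub>M\<^esub> B = of_cols (\<lambda>j. ppow m \<odot>\<^bsub>V\<^esub> unit_vec j)"
    using A B b by (intro M_ext) (auto simp: col_mult B_def)
  obtain c d where c: "c \<in> carrier V" "d \<in> carrier R" "c \<noteq> \<zero>\<^bsub>V\<^esub> \<or> d \<noteq> \<zero>"
    "mat_vec B c \<oplus>\<^bsub>V\<^esub> d \<odot>\<^bsub>V\<^esub> x = \<zero>\<^bsub>V\<^esub>"
    using exists_dependence_mat_vec[OF B x(1)] by blast
  have "mat_vec A (mat_vec B c \<oplus>\<^bsub>V\<^esub> d \<odot>\<^bsub>V\<^esub> x) = ppow m \<odot>\<^bsub>V\<^esub> c"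
    using A B c(1-3) x mat_vec_mult[OF A B c(1)] by (simp add: mat_vec_add mat_vec_smult AB mat_vec_scalar)
  then have "ppow m \<odot>\<^bsub>V\<^esub> c = \<zero>\<^bsub>V\<^esub>" using c A by simp
  then have "c = \<zero>\<^bsub>V\<^esub>" using c(1) V_smult_eq_zero[of "ppow m" c] by simp
  then have "d \<noteq> \<zero>" "d \<odot>\<^bsub>V\<^esub> x = \<zero>\<^bsub>V\<^esub>" using c x B by auto
  then show ?thesis using V_smult_eq_zero c x by blast
qed

text \<open>
  Among the finitely many lattices between \<open>p\<^sup>m \<int>\<^sub>p\<^sup>k\<close> and \<open>J\<close> that have \<open>k\<close> generators, choose a
  maximal one, \<open>L\<close>. If \<open>L\<close> were smaller than \<open>J\<close>, some \<open>w \<in> J\<close> outside \<open>L\<close> would satisfy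
  \<open>p w = \<Sum>c\<^sub>j a\<^sub>j\<close> in terms of the generators of \<open>L\<close>, with some \<open>c\<^sub>i\<close> a unit as \<open>w \<notin> L\<close>.
  Exchanging \<open>a\<^sub>i\<close> for \<open>w\<close> would give a larger lattice with \<open>k\<close> generators.
\<close>

lemma lattice_has_basis:
  assumes "lattice J" shows "\<exists>A\<in>carrier M. mat_vec A ` carrier V = J"
proof -
  obtain m where J: "submodule J R V" and m: "\<And>x. x \<in> carrier V \<Longrightarrow> ppow m \<odot>\<^bsub>V\<^esub> x \<in> J"
    using assms unfolding lattice_def by blast
  define \<L> where "\<L> = {L. L \<subseteq> J \<and> (\<exists>A\<in>carrier M. L = mat_vec A ` carrier V) \<and>
    (\<forall>x\<in>carrier V. ppow m \<odot>\<^bsub>V\<^esub> x \<in> L)}"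
  have "\<L> \<subseteq> {S. saturated {..<k} m S}"
    unfolding \<L>_def using image_submodule by (auto intro!: submodule_saturated)
  then have "finite \<L>" using finite_saturated[of "{..<k}" m] by (meson finite_lessThan finite_subset)
  moreover have "(\<lambda>x. ppow m \<odot>\<^bsub>V\<^esub> x) ` carrier V \<in> \<L>"
    unfolding \<L>_def using m mat_vec_scalar[of "ppow m"]
    by (auto intro!: bexI[of _ "of_cols (\<lambda>j. ppow m \<odot>\<^bsub>V\<^esub> unit_vec j)"] image_cong)
  ultimately obtain L where L: "L \<in> \<L>" and max: "\<And>L'. L' \<in> \<L> \<Longrightarrow> L \<subseteq> L' \<Longrightarrow> L = L'"
    using finite_has_maximal[of \<L>] by blast
  then obtain A where A: "A \<in> carrier M" "L = mat_vec A ` carrier V" and LJ: "L \<subseteq> J"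
    and Lm: "\<And>x. x \<in> carrier V \<Longrightarrow> ppow m \<odot>\<^bsub>V\<^esub> x \<in> L" unfolding \<L>_def by blast
  have "L = J"
  proof (rule ccontr)
    assume "L \<noteq> J"
    then obtain v where v: "v \<in> J" "v \<notin> L" using LJ by blast
    have vV: "v \<in> carrier V" using v V.submoduleE(1)[OF J] by blast
    define n where "n = (LEAST n. ppow n \<odot>\<^bsub>V\<^esub> v \<in> L)"
    have n: "ppow n \<odot>\<^bsub>V\<^esub> v \<in> L" unfolding n_def using Lm[OF vV] by (rule LeastI)
    then have "n \<noteq> 0" using v vV by (metis V.smult_one ppow_0)
    then obtain n' where n': "n = n' + 1" by (cases n) auto
    define w where "w = ppow n' \<odot>\<^bsub>V\<^esub> v"
    have w: "w \<notin> L" "w \<in> J" "w \<in> carrier V"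
      using not_less_Least[of n' "\<lambda>n. ppow n \<odot>\<^bsub>V\<^esub> v \<in> L"] n' n_def v vV V.submoduleE(4)[OF J]
      by (auto simp: w_def)
    have "ppow 1 \<odot>\<^bsub>V\<^esub> w = ppow n \<odot>\<^bsub>V\<^esub> v"
      unfolding w_def n' using V_ppow_add[OF vV, of 1 n'] by (simp add: add.commute)
    then obtain c where c: "c \<in> carrier V" "mat_vec A c = ppow 1 \<odot>\<^bsub>V\<^esub> w" using n A by auto
    have "\<exists>i<k. c i 1 \<noteq> 0"
    proof (rule ccontr)
      assume "\<not> ?thesis"
      then have "redV 1 c = redV 1 \<zero>\<^bsub>V\<^esub>" by (auto simp: red_eq_iff zero_eq)
      then obtain b where b: "b \<in> carrier V" "c = ppow 1 \<odot>\<^bsub>V\<^esub> b"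
        using redV_zero_iff[OF c(1)] by blast
      then have "ppow 1 \<odot>\<^bsub>V\<^esub> mat_vec A b = ppow 1 \<odot>\<^bsub>V\<^esub> w" using c A by (simp add: mat_vec_smult)
      then have "w = mat_vec A b" using V_ppow_cancel[of w "mat_vec A b" 1] w A b by simp
      then show False using w A b by blast
    qed
    then obtain i where i: "i < k" "c i \<in> Units R" using c unit_if_level_1 by auto
    define A' where "A' = of_cols (\<lambda>j. if j = i then w else col A j)"
    have A': "A' \<in> carrier M" unfolding A'_def using w A by (intro of_cols_closed) auto
    have colA': "col A' j = (if j = i then w else col A j)" if "j < k" for j
      unfolding A'_def using w A that by (intro col_of_cols) auto
    let ?L = "mat_vec A' ` carrier V"
    have sub: "submodule ?L R V" by (rule image_submodule[OF A'])
    have in_L': "col A' j \<in> ?L" if "j < k" for j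
      using mat_vec_unit_vec[OF A' that] by (metis imageI unit_vec_closed)
    have wL': "w \<in> ?L" using in_L'[OF i(1)] colA' i by simp
    have "col A i \<in> ?L"
    proof -
      define s where "s = (\<Oplus>\<^bsub>V\<^esub>j\<in>{..<k} - {i}. c j \<odot>\<^bsub>V\<^esub> col A j)"
      have s: "s \<in> ?L" unfolding s_def
      proof (rule submodule_finsum[OF sub])
        show "(\<lambda>j. c j \<odot>\<^bsub>V\<^esub> col A j) \<in> {..<k} - {i} \<rightarrow> ?L"
        proof
          fix j assume j: "j \<in> {..<k} - {i}"
          then have "col A j \<in> ?L" using in_L'[of j] colA'[of j] by auto
          then show "c j \<odot>\<^bsub>V\<^esub> col A j \<in> ?L"
            using V.submoduleE(4)[OF sub V_entry[OF c(1)]] j by blast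
        qed
      qed simp
      have sV: "s \<in> carrier V" using s A' by auto
      have ins: "{..<k} = insert i ({..<k} - {i})" using i by auto
      have "mat_vec A c = c i \<odot>\<^bsub>V\<^esub> col A i \<oplus>\<^bsub>V\<^esub> s"
        unfolding mat_vec_finsum[OF A(1) c(1)] s_def
        by (subst ins, rule V.M.finsum_insert) (use i c A in auto)
      then have "c i \<odot>\<^bsub>V\<^esub> col A i = ppow 1 \<odot>\<^bsub>V\<^esub> w \<oplus>\<^bsub>V\<^esub> \<ominus>\<^bsub>V\<^esub> s"
        using c i A sV by (simp add: V.M.a_assoc V.M.r_neg)
      also have "\<dots> \<in> ?L"
        using V.submoduleE(3-5)[OF sub] wL' s by simp
      finally have "inv (c i) \<odot>\<^bsub>V\<^esub> (c i \<odot>\<^bsub>V\<^esub> col A i) \<in> ?L"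
        using V.submoduleE(4)[OF sub] i by simp
      then show ?thesis using i A c by (simp add: V.smult_assoc1[symmetric])
    qed
    then have "col A j \<in> ?L" if "j < k" for j 
      using in_L'[OF that] colA'[OF that] by (cases "j = i") auto
    then have "L \<subseteq> ?L" using A mat_vec_in_submodule[OF sub A(1)] by blast
    moreover have "?L \<in> \<L>"
    proof -
      have "col A j \<in> J" if "j < k" for j
        using LJ A mat_vec_unit_vec[OF A(1) that] by (metis imageI subsetD unit_vec_closed)
      then have "?L \<subseteq> J" using mat_vec_in_submodule[OF J A'] colA' w by auto
      then show ?thesis unfolding \<L>_def using A' Lm \<open>L \<subseteq> ?L\<close> by blast
    qed
    ultimately have "L = ?L" using max by blast
    then show False using w wL' by blast
  qed
  then show ?thesis using A by blast
qed

section \<open>Lattices are the submodules of full rank\<close>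

lemma lin_indep_card_le:
  assumes "finite S" "S \<subseteq> carrier V" "lin_indep R V S" shows "card S \<le> k"
proof (rule ccontr)
  assume "\<not> card S \<le> k"
  then have "k < card S" by simp
  moreover have "s j \<in> carrier R" if "s \<in> S" "j < k" for s j using that assms(2) by auto
  ultimately obtain c where c: "c \<in> S \<rightarrow> carrier R" "\<exists>s\<in>S. c s \<noteq> \<zero>"
    "\<And>j. j < k \<Longrightarrow> (\<Oplus>s\<in>S. c s \<otimes> s j) = \<zero>"
    using exists_dependence[OF assms(1), of k "\<lambda>s. s"] by blast
  have cV: "(\<lambda>s. c s \<odot>\<^bsub>V\<^esub> s) \<in> S \<rightarrow> carrier V" using c(1) assms(2) by (auto simp: Pi_iff)
  have "(\<Oplus>\<^bsub>V\<^esub>s\<in>S. c s \<odot>\<^bsub>V\<^esub> s) = \<zero>\<^bsub>V\<^esub>"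
  proof (rule V_ext)
    fix j assume "j < k"
    then show "(\<Oplus>\<^bsub>V\<^esub>s\<in>S. c s \<odot>\<^bsub>V\<^esub> s) j = \<zero>\<^bsub>V\<^esub> j"
      using V_finsum_entry[OF assms(1) cV] c(3) by simp
  qed (use cV V.M.finsum_closed in auto)
  then show False using assms(3) c unfolding lin_indep_def by blast
qed

lemma lin_indep_cols:
  assumes A: "A \<in> carrier M" and ker: "\<And>x. x \<in> carrier V \<Longrightarrow> mat_vec A x = \<zero>\<^bsub>V\<^esub> \<Longrightarrow> x = \<zero>\<^bsub>V\<^esub>"
  shows "inj_on (col A) {..<k}" "lin_indep R V (col A ` {..<k})"
proof -
  show inj: "inj_on (col A) {..<k}"
  proof (rule inj_onI)
    fix i j assume ij: "i \<in> {..<k}" "j \<in> {..<k}" "col A i = col A j"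
    then have "mat_vec A (unit_vec i) = mat_vec A (unit_vec j)" using A by simp
    then have "unit_vec i = unit_vec j"
      using inj_onD[OF mat_vec_inj_if_kernel[OF A ker]] by simp
    then have "unit_vec i i = unit_vec j i" by simp
    then show "i = j" using ij by (simp add: unit_vec_def split: if_splits)
  qed
  show "lin_indep R V (col A ` {..<k})" unfolding lin_indep_def
  proof (intro ballI impI)
    fix c s assume c: "c \<in> col A ` {..<k} \<rightarrow> carrier R"
      and zero: "(\<Oplus>\<^bsub>V\<^esub>v\<in>col A ` {..<k}. c v \<odot>\<^bsub>V\<^esub> v) = \<zero>\<^bsub>V\<^esub>"
      and s: "s \<in> col A ` {..<k}"
    define x where "x = (\<lambda>j\<in>{..<k}. c (col A j))"
    have x: "x \<in> carrier V" using c by (auto simp: x_def V_carrier)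
    have "mat_vec A x = (\<Oplus>\<^bsub>V\<^esub>j\<in>{..<k}. c (col A j) \<odot>\<^bsub>V\<^esub> col A j)"
      unfolding mat_vec_finsum[OF A x] using c A by (intro V.M.finsum_cong') (auto simp: x_def Pi_iff)
    also have "\<dots> = (\<Oplus>\<^bsub>V\<^esub>v\<in>col A ` {..<k}. c v \<odot>\<^bsub>V\<^esub> v)"
      using c A inj by (intro V.M.finsum_reindex[symmetric]) (auto simp: Pi_iff)
    finally have "x = \<zero>\<^bsub>V\<^esub>" using zero ker x by simp
    then have "x j = \<zero>" if "j < k" for j using that by simp
    then show "c s = \<zero>" using s by (auto simp: x_def)
  qed
qed

lemma lattice_if_lin_indep:
  assumes J: "submodule J R V" and S: "S \<subseteq> J" "finite S" "card S = k" "lin_indep R V S"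
  shows "lattice J"
proof -
  have SV: "S \<subseteq> carrier V" using S V.submoduleE(1)[OF J] by blast
  obtain h where h: "bij_betw h {..<k} S"
    using S ex_bij_betw_nat_finite[of S] by (auto simp: atLeast0LessThan)
  have hS: "h j \<in> S" if "j < k" for j using that h bij_betwE by blast
  define A where "A = of_cols h"
  have A: "A \<in> carrier M" unfolding A_def using hS SV by (intro of_cols_closed) auto
  have colA: "col A j = h j" if "j < k" for j
    unfolding A_def using hS SV that by (intro col_of_cols) auto
  have "lattice (mat_vec A ` carrier V)"
  proof (rule lattice_if_kernel_zero[OF A])
    fix x assume x: "x \<in> carrier V" "mat_vec A x = \<zero>\<^bsub>V\<^esub>"
    define c where "c s = x (inv_into {..<k} h s)" for s
    have ch: "c (h j) = x j" if "j < k" for j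
      using h that by (simp add: c_def bij_betw_def inv_into_f_f)
    have c: "c \<in> S \<rightarrow> carrier R"
      using ch x h by (auto simp: bij_betw_def)
    have "(\<Oplus>\<^bsub>V\<^esub>s\<in>h ` {..<k}. c s \<odot>\<^bsub>V\<^esub> s) = (\<Oplus>\<^bsub>V\<^esub>j\<in>{..<k}. c (h j) \<odot>\<^bsub>V\<^esub> h j)"
      using h c hS SV by (intro V.M.finsum_reindex) (auto simp: bij_betw_def Pi_iff subset_iff)
    also have "\<dots> = mat_vec A x"
      unfolding mat_vec_finsum[OF A x(1)] using x A
      by (intro V.M.finsum_cong') (use subsetD[OF SV hS] in \<open>auto simp: ch colA\<close>)
    finally have "(\<Oplus>\<^bsub>V\<^esub>s\<in>S. c s \<odot>\<^bsub>V\<^esub> s) = \<zero>\<^bsub>V\<^esub>" using x h by (simp add: bij_betw_def)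
    then have "\<forall>s\<in>S. c s = \<zero>" using S(4) c unfolding lin_indep_def by blast
    then show "x = \<zero>\<^bsub>V\<^esub>" using ch hS x by (intro V_ext) auto
  qed
  moreover have "mat_vec A ` carrier V \<subseteq> J"
    using mat_vec_in_submodule[OF J A] colA hS S by auto
  ultimately show ?thesis using J lattice_mono by blast
qed

lemma full_rank_iff_lattice: "J \<in> full_rank_submodules p k \<longleftrightarrow> lattice J"
proof -
  have eq: "J \<in> full_rank_submodules p k \<longleftrightarrow> submodule J R V \<and> submodule_rank R V J = enat k"
    by (simp add: full_rank_submodules_def R_def V_def)
  let ?I = "{S. S \<subseteq> J \<and> finite S \<and> lin_indep R V S}"
  have le: "card S \<le> k" if "submodule J R V" "S \<in> ?I" for S
    using that lin_indep_card_le V.submoduleE(1)[OF that(1)] by auto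
  show ?thesis
  proof
    assume "J \<in> full_rank_submodules p k"
    then have J: "submodule J R V" and rank: "(SUP S\<in>?I. enat (card S)) = enat k"
      using eq by (auto simp: submodule_rank_def)
    have "\<exists>S\<in>?I. card S = k"
    proof (rule ccontr)
      assume "\<not> ?thesis"
      then have lt: "card S < k" if "S \<in> ?I" for S using le[OF J that] that by fastforce
      have "{} \<in> ?I" by (auto simp: lin_indep_def)
      then have "k > 0" using lt by fastforce
      have "(SUP S\<in>?I. enat (card S)) \<le> enat (k - 1)"
      proof (rule SUP_least)
        show "enat (card S) \<le> enat (k - 1)" if "S \<in> ?I" for S using lt[OF that] by simp
      qed
      then show False using rank \<open>k > 0\<close> by simp
    qed
    then show "lattice J" using lattice_if_lin_indep[OF J] by blast
  next
    assume lat: "lattice J"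
    then obtain m where J: "submodule J R V" and m: "\<And>x. x \<in> carrier V \<Longrightarrow> ppow m \<odot>\<^bsub>V\<^esub> x \<in> J"
      unfolding lattice_def by blast
    define A where "A = of_cols (\<lambda>j. ppow m \<odot>\<^bsub>V\<^esub> unit_vec j)"
    have A: "A \<in> carrier M" by (simp add: A_def)
    have ker: "x = \<zero>\<^bsub>V\<^esub>" if "x \<in> carrier V" "mat_vec A x = \<zero>\<^bsub>V\<^esub>" for x
      using that V_smult_eq_zero[of "ppow m" x] by (simp add: A_def mat_vec_scalar)
    note ind = lin_indep_cols[OF A ker]
    have "col A ` {..<k} \<in> ?I" using ind(2) m by (auto simp: A_def)
    moreover have "card (col A ` {..<k}) = k" using ind(1) by (simp add: card_image)
    ultimately have "enat k \<le> (SUP S\<in>?I. enat (card S))"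
      by (metis (no_types, lifting) SUP_upper)
    moreover have "(SUP S\<in>?I. enat (card S)) \<le> enat k"
      using le[OF J] by (intro SUP_least) simp
    ultimately show "J \<in> full_rank_submodules p k"
      using eq J by (simp add: submodule_rank_def)
  qed
qed

end

section \<open>Counting matrices modulo powers of p\<close>

context padic_lattice
begin

abbreviation "KK \<equiv> {..<k} \<times> {..<k}"

definition residue_count :: "nat \<Rightarrow> (nat \<times> nat \<Rightarrow> nat \<Rightarrow> int) set \<Rightarrow> nat" where
  "residue_count n S = card (redM n ` S)"

lemma M_add_entry [simp]: "i < k \<Longrightarrow> j < k \<Longrightarrow> (A \<oplus>\<^bsub>M\<^esub> B) (i, j) = A (i, j) \<oplus> B (i, j)"
  by (simp add: M_add)

lemma redM_eq_iff: "redM n A = redM n B \<longleftrightarrow> (\<forall>i<k. \<forall>j<k. A (i, j) n = B (i, j) n)"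
  by (auto simp: red_eq_iff)

lemma redM_eq_imp_ppow:
  assumes "A \<in> carrier M" "B \<in> carrier M" "redM n A = redM n B"
  obtains Z where "Z \<in> carrier M" "\<And>i j. i < k \<Longrightarrow> j < k \<Longrightarrow> B (i, j) = A (i, j) \<oplus> ppow n \<otimes> Z (i, j)"
proof -
  obtain Z where "Z \<in> carrier M" "\<And>ij. ij \<in> KK \<Longrightarrow> B ij = A ij \<oplus> ppow n \<otimes> Z ij"
    using red_eq_imp_ppow[of A KK B n] assms unfolding vecs_M by blast
  then show ?thesis using that[of Z] by simp
qed

lemma M_eqI:
  assumes "A \<in> carrier M" "B \<in> carrier M" "\<And>i j. i < k \<Longrightarrow> j < k \<Longrightarrow> A (i, j) = B (i, j)"
  shows "A = B"
  using assms by (intro M_ext V_ext) auto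

text \<open>
  As a bijection, the decomposition of \<open>S\<close> into translates of \<open>H\<close> includes their disjointness and is
  carried along by every injective additive map.
\<close>

definition tiling ::
    "(nat \<times> nat \<Rightarrow> nat \<Rightarrow> int) set \<Rightarrow> (nat \<times> nat \<Rightarrow> nat \<Rightarrow> int) set \<Rightarrow>
     (nat \<times> nat \<Rightarrow> nat \<Rightarrow> int) set \<Rightarrow> bool" where
  "tiling T H S \<longleftrightarrow> bij_betw (\<lambda>(t, h). t \<oplus>\<^bsub>M\<^esub> h) (T \<times> H) S"

lemma tilingI:
  assumes "\<And>t h. t \<in> T \<Longrightarrow> h \<in> H \<Longrightarrow> t \<oplus>\<^bsub>M\<^esub> h \<in> S"
    and "\<And>x. x \<in> S \<Longrightarrow> \<exists>t\<in>T. \<exists>h\<in>H. x = t \<oplus>\<^bsub>M\<^esub> h"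
    and "\<And>t h t' h'. \<lbrakk>t \<in> T; h \<in> H; t' \<in> T; h' \<in> H; t \<oplus>\<^bsub>M\<^esub> h = t' \<oplus>\<^bsub>M\<^esub> h'\<rbrakk> \<Longrightarrow> t = t' \<and> h = h'"
  shows "tiling T H S"
  unfolding tiling_def bij_betw_def inj_on_def using assms by (auto simp: image_iff)

lemma tilingD:
  assumes "tiling T H S"
  shows "\<And>t h. t \<in> T \<Longrightarrow> h \<in> H \<Longrightarrow> t \<oplus>\<^bsub>M\<^esub> h \<in> S"
    and "\<And>x. x \<in> S \<Longrightarrow> \<exists>t\<in>T. \<exists>h\<in>H. x = t \<oplus>\<^bsub>M\<^esub> h"
    and "\<And>t h t' h'. \<lbrakk>t \<in> T; h \<in> H; t' \<in> T; h' \<in> H; t \<oplus>\<^bsub>M\<^esub> h = t' \<oplus>\<^bsub>M\<^esub> h'\<rbrakk> \<Longrightarrow> t = t' \<and> h = h'"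
  using assms unfolding tiling_def bij_betw_def inj_on_def by (auto 0 3 simp: image_iff)

text \<open>
  Within a fixed translate, changing a matrix by a multiple of \<open>p\<^sup>n\<close> only changes the \<open>H\<close>-component.
\<close>

lemma tiling_shift:
  assumes H: "saturated KK n H" and T: "t \<in> carrier M" "h \<in> H" "y \<in> carrier M"
    and eq: "redM n (t \<oplus>\<^bsub>M\<^esub> h) = redM n y"
  obtains h' where "h' \<in> H" "y = t \<oplus>\<^bsub>M\<^esub> h'" "redM n h' = redM n h"
proof -
  have h: "h \<in> carrier M" using H T(2) by (auto simp: saturated_def vecs_M)
  obtain Z where Z: "Z \<in> carrier M"
    "\<And>i j. i < k \<Longrightarrow> j < k \<Longrightarrow> y (i, j) = (t \<oplus>\<^bsub>M\<^esub> h) (i, j) \<oplus> ppow n \<otimes> Z (i, j)"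
    using redM_eq_imp_ppow[OF M_add_closed[OF T(1) h] T(3) eq] by blast
  \<comment> \<open>the whole difference between \<open>y\<close> and \<open>t + h\<close> is absorbed into the second summand\<close>
  define h' where "h' = (\<lambda>ij\<in>KK. h ij \<oplus> ppow n \<otimes> Z ij)"
  have h': "h' \<in> carrier M" using h Z unfolding h'_def by (auto simp: M_carrier)
  have red: "redM n h' = redM n h" using h Z unfolding redM_eq_iff h'_def
    by (auto simp: add_eq ppow_level mod_simps)
  then have "h' \<in> H" using H T(2) h' by (auto simp: saturated_def vecs_M)
  moreover have "y = t \<oplus>\<^bsub>M\<^esub> h'"
    using T h' h Z by (intro M_eqI) (auto simp: h'_def a_assoc)
  ultimately show ?thesis using that red by blast
qed

lemma tiling_saturated:
  assumes "tiling T H S" "saturated KK n H" "T \<subseteq> carrier M"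
  shows "saturated KK n S"
  unfolding saturated_def vecs_M
proof (intro conjI subsetI ballI impI)
  have H: "H \<subseteq> carrier M" using assms(2) by (auto simp: saturated_def vecs_M)
  show "x \<in> carrier M" if "x \<in> S" for x
    using tilingD(2)[OF assms(1) that] assms(3) H M_add_closed by blast
  fix x y assume xy: "x \<in> S" "y \<in> carrier M" "redM n x = redM n y"
  obtain t h where th: "t \<in> T" "h \<in> H" "x = t \<oplus>\<^bsub>M\<^esub> h" using tilingD(2)[OF assms(1) xy(1)] by blast
  obtain h' where "h' \<in> H" "y = t \<oplus>\<^bsub>M\<^esub> h'"
    using tiling_shift[OF assms(2), of t h y] th xy assms(3) by blast
  then show "y \<in> S" using tilingD(1)[OF assms(1) th(1)] by simp
qed

text \<open>
  Reduction modulo \<open>p\<^sup>n\<close> keeps the translates of a saturated set disjoint and of equal size. This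
  is the finite form of translation invariance together with additivity.
\<close>

lemma tiling_count:
  assumes til: "tiling T H S" and H: "saturated KK n H" and T: "T \<subseteq> carrier M" "finite T"
  shows "residue_count n S = card T * residue_count n H"
proof -
  have HM: "H \<subseteq> carrier M" using H by (auto simp: saturated_def vecs_M)
  define g where "g = (\<lambda>(t, r). \<lambda>ij\<in>KK. (t ij n + r ij) mod int p ^ n)"
  have g: "g (t, redM n h) = redM n (t \<oplus>\<^bsub>M\<^esub> h)" for t h
    unfolding g_def red_def by (auto simp: M_add add_eq)
  have "redM n ` S = g ` (T \<times> redM n ` H)"
  proof (intro subset_antisym subsetI)
    fix r assume "r \<in> redM n ` S"
    then obtain x where "x \<in> S" "r = redM n x" by blast
    moreover then obtain t h where "t \<in> T" "h \<in> H" "x = t \<oplus>\<^bsub>M\<^esub> h" using tilingD(2)[OF til] by blast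
    ultimately have "r = g (t, redM n h)" "(t, redM n h) \<in> T \<times> redM n ` H" by (simp_all add: g)
    then show "r \<in> g ` (T \<times> redM n ` H)" by blast
  next
    fix r assume "r \<in> g ` (T \<times> redM n ` H)"
    then obtain t h where "t \<in> T" "h \<in> H" "r = g (t, redM n h)" by blast
    then show "r \<in> redM n ` S" using tilingD(1)[OF til] by (simp add: g)
  qed
  moreover have "inj_on g (T \<times> redM n ` H)"
  proof (rule inj_onI)
    fix u u' assume "u \<in> T \<times> redM n ` H" "u' \<in> T \<times> redM n ` H" "g u = g u'"
    then obtain t h t' h' where u: "u = (t, redM n h)" "t \<in> T" "h \<in> H"
        "u' = (t', redM n h')" "t' \<in> T" "h' \<in> H"
        and eq: "redM n (t \<oplus>\<^bsub>M\<^esub> h) = redM n (t' \<oplus>\<^bsub>M\<^esub> h')"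
      by (auto simp: g)
    have "t \<in> carrier M" "t' \<oplus>\<^bsub>M\<^esub> h' \<in> carrier M" using u T HM M_add_closed by blast+
    then obtain h'' where h'': "h'' \<in> H" "t' \<oplus>\<^bsub>M\<^esub> h' = t \<oplus>\<^bsub>M\<^esub> h''" "redM n h'' = redM n h"
      using tiling_shift[OF H _ u(3) _ eq] by blast
    then have "t' = t \<and> h' = h''" using tilingD(3)[OF til] u by blast
    then show "u = u'" using u h'' by simp
  qed
  ultimately show ?thesis by (simp add: residue_count_def card_image card_cartesian_product)
qed

section \<open>Matrices with columns in a lattice\<close>

definition cols :: "(nat \<Rightarrow> nat \<Rightarrow> int) set \<Rightarrow> (nat \<times> nat \<Rightarrow> nat \<Rightarrow> int) set" where
  "cols L = {A \<in> carrier M. \<forall>j<k. col A j \<in> L}"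

lemma of_cols_in_cols: "L \<subseteq> carrier V \<Longrightarrow> (\<And>j. j < k \<Longrightarrow> c j \<in> L) \<Longrightarrow> of_cols c \<in> cols L"
  unfolding cols_def by (auto simp: subset_iff)

lemma card_cols:
  assumes "T \<subseteq> carrier V" "finite T"
  shows "finite (cols T)" "card (cols T) = card T ^ k"
proof -
  have "bij_betw of_cols ({..<k} \<rightarrow>\<^sub>E T) (cols T)"
  proof (rule bij_betw_byWitness[where f' = "\<lambda>A. \<lambda>j\<in>{..<k}. col A j"])
    show "\<forall>c\<in>{..<k} \<rightarrow>\<^sub>E T. (\<lambda>j\<in>{..<k}. col (of_cols c) j) = c"
    proof
      fix c assume c: "c \<in> {..<k} \<rightarrow>\<^sub>E T"
      then have "(\<lambda>j\<in>{..<k}. col (of_cols c) j) = (\<lambda>j\<in>{..<k}. c j)"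
        using assms(1) by (intro restrict_ext) (auto intro!: col_of_cols)
      then show "(\<lambda>j\<in>{..<k}. col (of_cols c) j) = c" using c by (metis PiE_restrict)
    qed
    show "\<forall>A\<in>cols T. of_cols (\<lambda>j\<in>{..<k}. col A j) = A"
      by (auto simp: cols_def intro!: M_ext)
    show "of_cols ` ({..<k} \<rightarrow>\<^sub>E T) \<subseteq> cols T"
      using of_cols_in_cols[OF assms(1)] by auto
    show "(\<lambda>A. \<lambda>j\<in>{..<k}. col A j) ` cols T \<subseteq> {..<k} \<rightarrow>\<^sub>E T"
      by (auto simp: cols_def)
  qed
  moreover have "finite ({..<k} \<rightarrow>\<^sub>E T)" "card ({..<k} \<rightarrow>\<^sub>E T) = card T ^ k"
    using assms by (simp_all add: finite_PiE card_PiE)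
  ultimately show "finite (cols T)" "card (cols T) = card T ^ k"
    using bij_betw_finite bij_betw_same_card by metis+
qed

lemma cols_saturated:
  assumes "saturated {..<k} n L" shows "saturated KK n (cols L)"
  unfolding saturated_def vecs_M
proof (intro conjI ballI impI)
  fix A B assume AB: "A \<in> cols L" "B \<in> carrier M" "redM n A = redM n B"
  have "col B j \<in> L" if j: "j < k" for j
  proof -
    have "redV n (col A j) = redV n (col B j)" using AB(3) j by (simp add: red_eq_iff)
    then show ?thesis using assms AB j unfolding saturated_def cols_def vecs_V by auto
  qed
  then show "B \<in> cols L" using AB by (simp add: cols_def)
qed (auto simp: cols_def)

text \<open>
  A matrix is a \<open>k\<close>-tuple of columns, so coset representatives are chosen column by column. This is
  where the exponent \<open>k\<close> of the index comes from.
\<close>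

lemma cols_tiling:
  assumes T: "T \<subseteq> carrier V" and L: "L \<subseteq> carrier V"
    and bij: "bij_betw (\<lambda>(t, h). t \<oplus>\<^bsub>V\<^esub> h) (T \<times> L) L'"
  shows "tiling (cols T) (cols L) (cols L')"
proof (rule tilingI)
  fix t h assume "t \<in> cols T" "h \<in> cols L"
  then show "t \<oplus>\<^bsub>M\<^esub> h \<in> cols L'"
    using bij unfolding cols_def bij_betw_def by (auto simp: col_add image_iff)
next
  fix x assume x: "x \<in> cols L'"
  have "\<exists>u. \<exists>w. u \<in> T \<and> w \<in> L \<and> col x j = u \<oplus>\<^bsub>V\<^esub> w" if "j < k" for j
    using bij x that unfolding cols_def bij_betw_def by (auto simp: image_iff) blast
  then obtain u w where uw: "\<And>j. j < k \<Longrightarrow> u j \<in> T" "\<And>j. j < k \<Longrightarrow> w j \<in> L"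
    "\<And>j. j < k \<Longrightarrow> col x j = u j \<oplus>\<^bsub>V\<^esub> w j" by metis
  have "of_cols u \<in> cols T" "of_cols w \<in> cols L"
    using of_cols_in_cols uw T L by blast+
  moreover have "x = of_cols u \<oplus>\<^bsub>M\<^esub> of_cols w"
  proof (rule M_ext)
    fix j assume j: "j < k"
    have "u j \<in> carrier V" "w j \<in> carrier V" using uw j T L by auto
    then show "col x j = col (of_cols u \<oplus>\<^bsub>M\<^esub> of_cols w) j"
      using uw(3)[OF j] j by (simp add: col_add)
  qed (use x \<open>of_cols u \<in> cols T\<close> \<open>of_cols w \<in> cols L\<close> in \<open>auto simp: cols_def\<close>)
  ultimately show "\<exists>t\<in>cols T. \<exists>h\<in>cols L. x = t \<oplus>\<^bsub>M\<^esub> h" by blast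
next
  fix t h t' h' assume th: "t \<in> cols T" "h \<in> cols L" "t' \<in> cols T" "h' \<in> cols L"
    and eq: "t \<oplus>\<^bsub>M\<^esub> h = t' \<oplus>\<^bsub>M\<^esub> h'"
  have "col t j = col t' j \<and> col h j = col h' j" if j: "j < k" for j
  proof -
    have "col t j \<oplus>\<^bsub>V\<^esub> col h j = col t' j \<oplus>\<^bsub>V\<^esub> col h' j"
      using arg_cong[OF eq, of "\<lambda>X. col X j"] j by (simp add: col_add)
    moreover have "(col t j, col h j) \<in> T \<times> L" "(col t' j, col h' j) \<in> T \<times> L"
      using th j by (auto simp: cols_def)
    ultimately show ?thesis
      using inj_onD[of "\<lambda>(t, h). t \<oplus>\<^bsub>V\<^esub> h" "T \<times> L" "(col t j, col h j)" "(col t' j, col h' j)"]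
        bij unfolding bij_betw_def by simp
  qed
  then show "t = t' \<and> h = h'" using th by (auto simp: cols_def intro!: M_ext)
qed

text \<open>
  The cosets of \<open>J\<close> are finitely many, as each of them is saturated at the level of \<open>J\<close>.
\<close>

lemma coset_reps:
  assumes J: "lattice J"
  obtains T where "T \<subseteq> carrier V" "finite T" "card T = submodule_index V J"
    "bij_betw (\<lambda>(t, h). t \<oplus>\<^bsub>V\<^esub> h) (T \<times> J) (carrier V)"
proof -
  obtain m where sub: "submodule J R V" and m: "\<And>x. x \<in> carrier V \<Longrightarrow> ppow m \<odot>\<^bsub>V\<^esub> x \<in> J"
    using J unfolding lattice_def by blast
  have JV: "J \<subseteq> carrier V" by (rule V.submoduleE(1)[OF sub])
  have grp: "subgroup J (add_monoid V)" using sub unfolding submodule_def by simp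
  let ?Q = "a_rcosets\<^bsub>V\<^esub> J"
  have Q: "?Q = (\<lambda>a. J +>\<^bsub>V\<^esub> a) ` carrier V" unfolding A_RCOSETS_def' by auto
  have coset: "J +>\<^bsub>V\<^esub> a = (\<lambda>h. h \<oplus>\<^bsub>V\<^esub> a) ` J" for a unfolding a_r_coset_def' by auto
  have "?Q \<subseteq> {S. saturated {..<k} m S}"
  proof
    fix C assume "C \<in> ?Q"
    then obtain a where a: "a \<in> carrier V" "C = (\<lambda>h. h \<oplus>\<^bsub>V\<^esub> a) ` J" using Q coset by auto
    have "y \<in> C" if xy: "x \<in> C" "y \<in> carrier V" "redV m x = redV m y" for x y
    proof -
      obtain h where h: "h \<in> J" "x = h \<oplus>\<^bsub>V\<^esub> a" using xy a by blast
      have x: "x \<in> carrier V" using h a JV by auto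
      obtain z where z: "z \<in> carrier V" "y = x \<oplus>\<^bsub>V\<^esub> ppow m \<odot>\<^bsub>V\<^esub> z"
        using redV_eq_iff[OF x xy(2)] xy(3) by blast
      have "y = (h \<oplus>\<^bsub>V\<^esub> ppow m \<odot>\<^bsub>V\<^esub> z) \<oplus>\<^bsub>V\<^esub> a"
        using z h a JV by (simp add: V.M.a_ac subset_iff)
      moreover have "h \<oplus>\<^bsub>V\<^esub> ppow m \<odot>\<^bsub>V\<^esub> z \<in> J" using V.submoduleE(5)[OF sub h(1) m[OF z(1)]] .
      ultimately show ?thesis using a by blast
    qed
    moreover have "C \<subseteq> carrier V" using a JV by auto
    ultimately show "C \<in> {S. saturated {..<k} m S}"
      unfolding saturated_def vecs_V by blast
  qed
  then have fin: "finite ?Q" using finite_saturated[OF finite_lessThan] by (rule finite_subset)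
  define f where "f C = (SOME a. a \<in> carrier V \<and> C = J +>\<^bsub>V\<^esub> a)" for C
  have f: "f C \<in> carrier V \<and> C = J +>\<^bsub>V\<^esub> f C" if "C \<in> ?Q" for C
  proof -
    have "\<exists>a. a \<in> carrier V \<and> C = J +>\<^bsub>V\<^esub> a" using that Q by blast
    then show ?thesis unfolding f_def by (rule someI_ex)
  qed
  define T where "T = f ` ?Q"
  have "inj_on f ?Q" by (rule inj_onI) (metis f)
  then have "card T = submodule_index V J" by (simp add: T_def card_image submodule_index_def)
  moreover have TV: "T \<subseteq> carrier V" using f by (auto simp: T_def)
  moreover have "bij_betw (\<lambda>(t, h). t \<oplus>\<^bsub>V\<^esub> h) (T \<times> J) (carrier V)"
    unfolding bij_betw_def
  proof
    show "inj_on (\<lambda>(t, h). t \<oplus>\<^bsub>V\<^esub> h) (T \<times> J)"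
    proof (rule inj_onI, clarify)
      fix t h t' h' assume *: "t \<in> T" "t' \<in> T" "h \<in> J" "h' \<in> J" "t \<oplus>\<^bsub>V\<^esub> h = t' \<oplus>\<^bsub>V\<^esub> h'"
      then obtain C C' where C: "C \<in> ?Q" "t = f C" "C' \<in> ?Q" "t' = f C'" unfolding T_def by blast
      have car: "t \<in> carrier V" "t' \<in> carrier V" "h \<in> carrier V" "h' \<in> carrier V"
        using * TV JV by auto
      have "t' = (h \<oplus>\<^bsub>V\<^esub> \<ominus>\<^bsub>V\<^esub> h') \<oplus>\<^bsub>V\<^esub> t"
      proof -
        have "t' = (t' \<oplus>\<^bsub>V\<^esub> h') \<oplus>\<^bsub>V\<^esub> \<ominus>\<^bsub>V\<^esub> h'" using car by (simp add: V.M.a_assoc V.M.r_neg)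
        also have "\<dots> = (h \<oplus>\<^bsub>V\<^esub> \<ominus>\<^bsub>V\<^esub> h') \<oplus>\<^bsub>V\<^esub> t"
          using car by (simp add: *(5)[symmetric] V.M.a_ac)
        finally show ?thesis .
      qed
      moreover have "h \<oplus>\<^bsub>V\<^esub> \<ominus>\<^bsub>V\<^esub> h' \<in> J" using * V.submoduleE(3,5)[OF sub] by blast
      ultimately have "t' \<in> J +>\<^bsub>V\<^esub> t" unfolding coset by blast
      then have "J +>\<^bsub>V\<^esub> t = J +>\<^bsub>V\<^esub> t'"
        using V.M.a_repr_independence[OF _ car(1) grp] by blast
      then have "C = C'" using f C by metis
      then show "t = t' \<and> h = h'" using C * car by auto
    qed
    show "(\<lambda>(t, h). t \<oplus>\<^bsub>V\<^esub> h) ` (T \<times> J) = carrier V"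
    proof (intro subset_antisym subsetI)
      fix x assume x: "x \<in> carrier V"
      then have Cx: "J +>\<^bsub>V\<^esub> x \<in> ?Q" using Q by blast
      define t where "t = f (J +>\<^bsub>V\<^esub> x)"
      have t: "t \<in> carrier V" "J +>\<^bsub>V\<^esub> x = J +>\<^bsub>V\<^esub> t" "t \<in> T"
        using f[OF Cx] Cx unfolding t_def T_def by blast+
      have "\<zero>\<^bsub>V\<^esub> \<in> J" using subgroup.one_closed[OF grp] by simp
      then have "x \<in> J +>\<^bsub>V\<^esub> x" unfolding coset using x by (auto intro!: image_eqI[of _ _ "\<zero>\<^bsub>V\<^esub>"])
      then have "x \<in> J +>\<^bsub>V\<^esub> t" unfolding t(2) .
      then obtain h where h: "h \<in> J" "x = h \<oplus>\<^bsub>V\<^esub> t" unfolding coset by blast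
      then have "x = t \<oplus>\<^bsub>V\<^esub> h" using V.M.a_comm[of h t] t(1) subsetD[OF JV h(1)] by simp
      then have "x = (\<lambda>(t, h). t \<oplus>\<^bsub>V\<^esub> h) (t, h)" "(t, h) \<in> T \<times> J" using t(3) h(1) by auto
      then show "x \<in> (\<lambda>(t, h). t \<oplus>\<^bsub>V\<^esub> h) ` (T \<times> J)" by (rule image_eqI)
    qed (use TV JV in auto)
  qed
  ultimately show ?thesis using that fin by (simp add: T_def)
qed

lemma submodule_index_pos:
  assumes "lattice J" shows "submodule_index V J > 0"
proof -
  obtain T where T: "finite T" "card T = submodule_index V J"
    "bij_betw (\<lambda>(t, h). t \<oplus>\<^bsub>V\<^esub> h) (T \<times> J) (carrier V)"
    using coset_reps[OF assms] by metis
  have "T \<noteq> {}" using T(3) V.M.zero_closed by (auto simp: bij_betw_def)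
  then show ?thesis using T(1,2) card_gt_0_iff by metis
qed

section \<open>Matrices spanning a given lattice\<close>

definition spanning :: "(nat \<Rightarrow> nat \<Rightarrow> int) set \<Rightarrow> (nat \<times> nat \<Rightarrow> nat \<Rightarrow> int) set" where
  "spanning J = {A \<in> carrier M. mat_vec A ` carrier V = J}"

definition digits :: "(nat \<times> nat \<Rightarrow> nat \<Rightarrow> int) set" where
  "digits = lift KK ` (KK \<rightarrow>\<^sub>E {0..<int p})"

definition pM :: "(nat \<times> nat \<Rightarrow> nat \<Rightarrow> int) set" where
  "pM = {B \<in> carrier M. \<forall>i<k. \<forall>j<k. B (i, j) 1 = 0}"

lemma pM_saturated: "saturated KK 1 pM"
  unfolding saturated_def vecs_M pM_def by (auto simp: redM_eq_iff)

lemma redM_add_pM: "t \<in> carrier M \<Longrightarrow> h \<in> pM \<Longrightarrow> redM 1 (t \<oplus>\<^bsub>M\<^esub> h) = redM 1 t"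
  using level_mod[of _ 1] by (auto simp: redM_eq_iff pM_def add_eq)

lemma digits: "digits \<subseteq> carrier M" "finite digits" "digits \<noteq> {}"
proof -
  show "digits \<subseteq> carrier M" using lift_closed[of KK] by (auto simp: digits_def vecs_M)
  show "finite digits" by (simp add: digits_def finite_PiE)
  show "digits \<noteq> {}" using p_gt_1 by (auto simp: digits_def PiE_eq_empty_iff)
qed

lemma M_add_left_cancel:
  assumes "t \<in> carrier M" "h \<in> carrier M" "h' \<in> carrier M" "t \<oplus>\<^bsub>M\<^esub> h = t \<oplus>\<^bsub>M\<^esub> h'"
  shows "h = h'"
proof (rule M_eqI[OF assms(2,3)])
  fix i j assume ij: "i < k" "j < k"
  then have "t (i, j) \<oplus> h (i, j) = t (i, j) \<oplus> h' (i, j)"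
    using fun_cong[OF assms(4), of "(i, j)"] by simp
  then show "h (i, j) = h' (i, j)"
    using r_neg1[of "t (i, j)"] ij assms(1-3) by (metis M_entry)
qed

lemma digit_tiling: "tiling digits pM (carrier M)"
proof (rule tilingI)
  show "t \<oplus>\<^bsub>M\<^esub> h \<in> carrier M" if "t \<in> digits" "h \<in> pM" for t h
    using that digits(1) by (auto simp: pM_def)
  fix x assume x: "x \<in> carrier M"
  define t where "t = lift KK (redM 1 x)"
  have r: "redM 1 x \<in> KK \<rightarrow>\<^sub>E {0..<int p ^ 1}" using red_in[of x KK 1] x by (simp add: vecs_M)
  have t: "t \<in> digits" using r unfolding t_def digits_def by simp
  have tM: "t \<in> carrier M" using t digits(1) by blast
  have "redM 1 t = redM 1 x" unfolding t_def by (rule red_lift[OF r])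
  then obtain Z where Z: "Z \<in> carrier M"
    "\<And>i j. i < k \<Longrightarrow> j < k \<Longrightarrow> x (i, j) = t (i, j) \<oplus> ppow 1 \<otimes> Z (i, j)"
    using redM_eq_imp_ppow[OF tM x] by blast
  define h where "h = (\<lambda>ij\<in>KK. ppow 1 \<otimes> Z ij)"
  have "h \<in> carrier M" using Z unfolding h_def by (auto simp: M_carrier)
  then have "h \<in> pM" by (simp add: pM_def h_def ppow_level)
  moreover have "x = t \<oplus>\<^bsub>M\<^esub> h"
    using x tM \<open>h \<in> carrier M\<close> Z by (intro M_eqI) (auto simp: h_def)
  ultimately show "\<exists>t\<in>digits. \<exists>h\<in>pM. x = t \<oplus>\<^bsub>M\<^esub> h" using t by blast
next
  fix t h t' h' assume th: "t \<in> digits" "h \<in> pM" "t' \<in> digits" "h' \<in> pM"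
    and eq: "t \<oplus>\<^bsub>M\<^esub> h = t' \<oplus>\<^bsub>M\<^esub> h'"
  obtain r r' where r: "t = lift KK r" "r \<in> KK \<rightarrow>\<^sub>E {0..<int p ^ 1}"
    "t' = lift KK r'" "r' \<in> KK \<rightarrow>\<^sub>E {0..<int p ^ 1}"
    using th unfolding digits_def by auto
  have M: "t \<in> carrier M" "t' \<in> carrier M" "h \<in> carrier M" "h' \<in> carrier M"
    using th digits(1) by (auto simp: pM_def)
  have "redM 1 t = redM 1 t'"
    using redM_add_pM[OF M(1) th(2)] redM_add_pM[OF M(2) th(4)] eq by simp
  then have "t = t'" using r(2,4) unfolding r(1,3) red_lift[OF r(2)] red_lift[OF r(4)] by simp
  then show "t = t' \<and> h = h'" using M_add_left_cancel[OF M(1,3,4)] eq by simp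
qed

lemma spanning_V_iff: "B \<in> spanning (carrier V) \<longleftrightarrow> B \<in> carrier M \<and> inj_mod_p B"
  unfolding spanning_def using surj_iff_inj_mod_p by auto

lemma spanning_V_saturated: "saturated KK 1 (spanning (carrier V))"
  unfolding saturated_def vecs_M spanning_V_iff
  using inj_mod_p_cong spanning_V_iff by blast

text \<open>
  Invertibility depends on the residue modulo \<open>p\<close> only, so \<open>GL\<^sub>k(\<int>\<^sub>p)\<close> is a union of tiles.
\<close>

lemma unit_tiling: "tiling (digits \<inter> spanning (carrier V)) pM (spanning (carrier V))"
proof -
  have iff: "t \<oplus>\<^bsub>M\<^esub> h \<in> spanning (carrier V) \<longleftrightarrow> t \<in> spanning (carrier V)"
    if th: "t \<in> digits" "h \<in> pM" for t h
  proof -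
    have M: "t \<in> carrier M" "t \<oplus>\<^bsub>M\<^esub> h \<in> carrier M" using th digits(1) by (auto simp: pM_def)
    then show ?thesis
      using redM_add_pM[OF M(1) th(2)] spanning_V_saturated
      unfolding saturated_def vecs_M by metis
  qed
  show ?thesis
  proof (rule tilingI)
    fix x assume x: "x \<in> spanning (carrier V)"
    then have "x \<in> carrier M" by (simp add: spanning_def)
    then obtain t h where "t \<in> digits" "h \<in> pM" "x = t \<oplus>\<^bsub>M\<^esub> h"
      using tilingD(2)[OF digit_tiling] by blast
    then show "\<exists>t\<in>digits \<inter> spanning (carrier V). \<exists>h\<in>pM. x = t \<oplus>\<^bsub>M\<^esub> h" using x iff by blast
  qed (use iff tilingD(3)[OF digit_tiling] in blast)+
qed

lemma M_mult_add:
  "\<lbrakk>A \<in> carrier M; B \<in> carrier M; C \<in> carrier M\<rbrakk>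
    \<Longrightarrow> A \<otimes>\<^bsub>M\<^esub> (B \<oplus>\<^bsub>M\<^esub> C) = A \<otimes>\<^bsub>M\<^esub> B \<oplus>\<^bsub>M\<^esub> A \<otimes>\<^bsub>M\<^esub> C"
  by (intro M_ext) (auto simp: col_mult col_add mat_vec_add)

lemma M_mult_inj:
  assumes A: "A \<in> carrier M" and inj: "inj_on (mat_vec A) (carrier V)"
  shows "inj_on (\<lambda>B. A \<otimes>\<^bsub>M\<^esub> B) (carrier M)"
proof (rule inj_onI)
  fix B C assume BC: "B \<in> carrier M" "C \<in> carrier M" "A \<otimes>\<^bsub>M\<^esub> B = A \<otimes>\<^bsub>M\<^esub> C"
  show "B = C"
  proof (rule M_ext[OF BC(1,2)])
    fix j assume j: "j < k"
    then have "mat_vec A (col B j) = mat_vec A (col C j)"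
      using arg_cong[OF BC(3), of "\<lambda>X. col X j"] col_mult[OF A BC(1)] col_mult[OF A BC(2)] by simp
    then show "col B j = col C j" using inj_onD[OF inj] BC j by simp
  qed
qed

lemma mult_tiling:
  assumes A: "A \<in> carrier M" and inj: "inj_on (mat_vec A) (carrier V)"
    and TH: "T \<subseteq> carrier M" "H \<subseteq> carrier M" and til: "tiling T H S"
  shows "tiling ((\<lambda>B. A \<otimes>\<^bsub>M\<^esub> B) ` T) ((\<lambda>B. A \<otimes>\<^bsub>M\<^esub> B) ` H) ((\<lambda>B. A \<otimes>\<^bsub>M\<^esub> B) ` S)"
proof (rule tilingI)
  have add: "A \<otimes>\<^bsub>M\<^esub> t \<oplus>\<^bsub>M\<^esub> A \<otimes>\<^bsub>M\<^esub> h = A \<otimes>\<^bsub>M\<^esub> (t \<oplus>\<^bsub>M\<^esub> h)" if "t \<in> T" "h \<in> H" for t h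
    using that TH A by (intro M_mult_add[symmetric]) auto
  fix x y assume "x \<in> (\<lambda>B. A \<otimes>\<^bsub>M\<^esub> B) ` T" "y \<in> (\<lambda>B. A \<otimes>\<^bsub>M\<^esub> B) ` H"
  then obtain t h where th: "t \<in> T" "h \<in> H" "x = A \<otimes>\<^bsub>M\<^esub> t" "y = A \<otimes>\<^bsub>M\<^esub> h" by blast
  then show "x \<oplus>\<^bsub>M\<^esub> y \<in> (\<lambda>B. A \<otimes>\<^bsub>M\<^esub> B) ` S" using add tilingD(1)[OF til] by auto
  fix x' y' assume "x' \<in> (\<lambda>B. A \<otimes>\<^bsub>M\<^esub> B) ` T" "y' \<in> (\<lambda>B. A \<otimes>\<^bsub>M\<^esub> B) ` H"
    and eq: "x \<oplus>\<^bsub>M\<^esub> y = x' \<oplus>\<^bsub>M\<^esub> y'"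
  then obtain t' h' where th': "t' \<in> T" "h' \<in> H" "x' = A \<otimes>\<^bsub>M\<^esub> t'" "y' = A \<otimes>\<^bsub>M\<^esub> h'" by blast
  have "A \<otimes>\<^bsub>M\<^esub> (t \<oplus>\<^bsub>M\<^esub> h) = A \<otimes>\<^bsub>M\<^esub> (t' \<oplus>\<^bsub>M\<^esub> h')" using eq th th' add by simp
  then have "t \<oplus>\<^bsub>M\<^esub> h = t' \<oplus>\<^bsub>M\<^esub> h'"
    using inj_onD[OF M_mult_inj[OF A inj]] th th' TH by (meson M_add_closed subsetD)
  then show "x = x' \<and> y = y'" using tilingD(3)[OF til] th th' by blast
next
  fix x assume "x \<in> (\<lambda>B. A \<otimes>\<^bsub>M\<^esub> B) ` S"
  then obtain s where s: "s \<in> S" "x = A \<otimes>\<^bsub>M\<^esub> s" by blast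
  then obtain t h where th: "t \<in> T" "h \<in> H" "s = t \<oplus>\<^bsub>M\<^esub> h" using tilingD(2)[OF til] by blast
  then have "x = A \<otimes>\<^bsub>M\<^esub> t \<oplus>\<^bsub>M\<^esub> A \<otimes>\<^bsub>M\<^esub> h" using s M_mult_add A TH by blast
  then show "\<exists>t\<in>(\<lambda>B. A \<otimes>\<^bsub>M\<^esub> B) ` T. \<exists>h\<in>(\<lambda>B. A \<otimes>\<^bsub>M\<^esub> B) ` H. x = t \<oplus>\<^bsub>M\<^esub> h"
    using th by blast
qed

lemma factor_through:
  assumes A: "A \<in> carrier M" and C: "C \<in> cols (mat_vec A ` carrier V)"
  obtains B where "B \<in> carrier M" "C = A \<otimes>\<^bsub>M\<^esub> B"
proof -
  have CM: "C \<in> carrier M" using C by (simp add: cols_def)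
  have "\<exists>b. b \<in> carrier V \<and> col C j = mat_vec A b" if "j < k" for j
    using C that unfolding cols_def by blast
  then obtain b where b: "\<And>j. j < k \<Longrightarrow> b j \<in> carrier V" "\<And>j. j < k \<Longrightarrow> col C j = mat_vec A (b j)"
    by metis
  show ?thesis
  proof (rule that)
    show "of_cols b \<in> carrier M" using b by simp
    then show "C = A \<otimes>\<^bsub>M\<^esub> of_cols b" using A CM b by (intro M_ext) (auto simp: col_mult)
  qed
qed

lemma mult_image_M:
  assumes A: "A \<in> carrier M"
  shows "(\<lambda>B. A \<otimes>\<^bsub>M\<^esub> B) ` carrier M = cols (mat_vec A ` carrier V)"
proof
  show "cols (mat_vec A ` carrier V) \<subseteq> (\<lambda>B. A \<otimes>\<^bsub>M\<^esub> B) ` carrier M"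
    using factor_through[OF A] by blast
qed (use A in \<open>auto simp: cols_def col_mult\<close>)

text \<open>
  Two bases of the same lattice differ by an invertible matrix.
\<close>

lemma mult_image_spanning:
  assumes A: "A \<in> carrier M" and inj: "inj_on (mat_vec A) (carrier V)"
  shows "(\<lambda>B. A \<otimes>\<^bsub>M\<^esub> B) ` spanning (carrier V) = spanning (mat_vec A ` carrier V)"
proof (intro subset_antisym subsetI)
  have img: "mat_vec (A \<otimes>\<^bsub>M\<^esub> B) ` carrier V = mat_vec A ` mat_vec B ` carrier V" if "B \<in> carrier M" for B
    unfolding image_image using A that by (intro image_cong) (auto simp: mat_vec_mult)
  fix C assume "C \<in> (\<lambda>B. A \<otimes>\<^bsub>M\<^esub> B) ` spanning (carrier V)"
  then obtain B where "C = A \<otimes>\<^bsub>M\<^esub> B" "B \<in> carrier M" "mat_vec B ` carrier V = carrier V"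
    unfolding spanning_def by blast
  then show "C \<in> spanning (mat_vec A ` carrier V)" using A img[of B] by (simp add: spanning_def)
next
  have img: "mat_vec (A \<otimes>\<^bsub>M\<^esub> B) ` carrier V = mat_vec A ` mat_vec B ` carrier V" if "B \<in> carrier M" for B
    unfolding image_image using A that by (intro image_cong) (auto simp: mat_vec_mult)
  fix C assume C: "C \<in> spanning (mat_vec A ` carrier V)"
  then have CM: "C \<in> carrier M" and Cimg: "mat_vec C ` carrier V = mat_vec A ` carrier V"
    by (auto simp: spanning_def)
  have "col C j \<in> mat_vec A ` carrier V" if "j < k" for j
    using mat_vec_unit_vec[OF CM that] unit_vec_closed[of j] unfolding Cimg[symmetric] by (metis imageI)
  then have "C \<in> cols (mat_vec A ` carrier V)" using CM by (simp add: cols_def)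
  then obtain B where B: "B \<in> carrier M" "C = A \<otimes>\<^bsub>M\<^esub> B" using factor_through[OF A] by blast
  have "mat_vec A ` mat_vec B ` carrier V = mat_vec A ` carrier V" using img[OF B(1)] Cimg B by simp
  moreover have "mat_vec B ` carrier V \<subseteq> carrier V" using B(1) by auto
  ultimately have "mat_vec B ` carrier V = carrier V"
    using inj_on_image_eq_iff[OF inj, of "mat_vec B ` carrier V" "carrier V"] B(1) by auto
  then show "C \<in> (\<lambda>B. A \<otimes>\<^bsub>M\<^esub> B) ` spanning (carrier V)" using B by (auto simp: spanning_def)
qed

text \<open>
  If \<open>J\<close> contains \<open>p\<^sup>m \<int>\<^sub>p\<^sup>k\<close>, then \<open>p J\<close> contains \<open>p\<^sup>m\<^sup>+\<^sup>1 \<int>\<^sub>p\<^sup>k\<close>.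
\<close>

lemma mult_pM_saturated:
  assumes A: "A \<in> carrier M"
    and m: "\<And>x. x \<in> carrier V \<Longrightarrow> ppow m \<odot>\<^bsub>V\<^esub> x \<in> mat_vec A ` carrier V"
  shows "saturated KK (m + 1) ((\<lambda>B. A \<otimes>\<^bsub>M\<^esub> B) ` pM)"
  unfolding saturated_def vecs_M
proof (intro conjI ballI impI)
  have pMM: "pM \<subseteq> carrier M" by (auto simp: pM_def)
  then show "(\<lambda>B. A \<otimes>\<^bsub>M\<^esub> B) ` pM \<subseteq> carrier M" using A by auto
  fix C D assume "C \<in> (\<lambda>B. A \<otimes>\<^bsub>M\<^esub> B) ` pM" and D: "D \<in> carrier M" "redM (m + 1) C = redM (m + 1) D"
  then obtain B where B: "B \<in> pM" "C = A \<otimes>\<^bsub>M\<^esub> B" by blast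
  have CM: "C \<in> carrier M" using A B pMM by auto
  obtain Z where Z: "Z \<in> carrier M"
    "\<And>i j. i < k \<Longrightarrow> j < k \<Longrightarrow> D (i, j) = C (i, j) \<oplus> ppow (m + 1) \<otimes> Z (i, j)"
    using redM_eq_imp_ppow[OF CM D] by blast
  have "\<exists>b. b \<in> carrier V \<and> mat_vec A b = ppow m \<odot>\<^bsub>V\<^esub> col Z j" if "j < k" for j
    using m[OF col_closed[OF Z(1) that]] by (metis imageE)
  then obtain b where b: "\<And>j. j < k \<Longrightarrow> b j \<in> carrier V"
    "\<And>j. j < k \<Longrightarrow> mat_vec A (b j) = ppow m \<odot>\<^bsub>V\<^esub> col Z j" by metis
  define E where "E = of_cols (\<lambda>j. ppow 1 \<odot>\<^bsub>V\<^esub> b j)"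
  have E: "E \<in> carrier M" unfolding E_def using b by (intro of_cols_closed) auto
  have colE: "col E j = ppow 1 \<odot>\<^bsub>V\<^esub> b j" if "j < k" for j
    unfolding E_def using b that by (intro col_of_cols) auto
  have "E (i, j) = ppow 1 \<otimes> b j i" if "i < k" "j < k" for i j
    using fun_cong[OF colE[OF that(2)], of i] that by simp
  then have "B \<oplus>\<^bsub>M\<^esub> E \<in> pM"
    using B E by (auto simp: pM_def add_eq ppow_level)
  moreover have "D = A \<otimes>\<^bsub>M\<^esub> (B \<oplus>\<^bsub>M\<^esub> E)"
  proof (rule M_ext)
    fix j assume j: "j < k"
    have "col D j = col C j \<oplus>\<^bsub>V\<^esub> ppow (1 + m) \<odot>\<^bsub>V\<^esub> col Z j"
      using Z D CM j by (intro V_ext) auto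
    also have "ppow (1 + m) \<odot>\<^bsub>V\<^esub> col Z j = mat_vec A (col E j)"
      using V_ppow_add[of "col Z j" 1 m] A b j Z by (simp add: colE mat_vec_smult)
    finally show "col D j = col (A \<otimes>\<^bsub>M\<^esub> (B \<oplus>\<^bsub>M\<^esub> E)) j"
      using A B E pMM j by (auto simp: col_mult col_add mat_vec_add)
  qed (use A B D E pMM in auto)
  ultimately show "D \<in> (\<lambda>B. A \<otimes>\<^bsub>M\<^esub> B) ` pM" by blast
qed

text \<open>
  Count modulo \<open>p\<^sup>n\<close> with \<open>n = m + 1\<close>, where \<open>p\<^sup>m \<int>\<^sub>p\<^sup>k \<subseteq> J = A \<int>\<^sub>p\<^sup>k\<close>. Let \<open>d\<close> be the number of
  digit matrices, \<open>u\<close> the number of invertible ones, \<open>q\<close> the index of \<open>J\<close>, and let \<open>h\<close> and \<open>h'\<close> count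
  \<open>p M\<^sub>k(\<int>\<^sub>p)\<close> and \<open>A p M\<^sub>k(\<int>\<^sub>p)\<close>. The number of all matrices is \<open>d h = q\<^sup>k d h'\<close>, so \<open>h = q\<^sup>k h'\<close>,
  while the two sides of the claim are \<open>u h' q\<^sup>k\<close> and \<open>u h\<close>.
\<close>

lemma spanning_count:
  assumes "lattice J"
  obtains n where "saturated KK n (spanning J)" "saturated KK n (spanning (carrier V))"
    "residue_count n (spanning J) * submodule_index V J ^ k = residue_count n (spanning (carrier V))"
proof -
  obtain m where m: "\<And>x. x \<in> carrier V \<Longrightarrow> ppow m \<odot>\<^bsub>V\<^esub> x \<in> J" and sub: "submodule J R V"
    using assms unfolding lattice_def by blast
  obtain A where A: "A \<in> carrier M" and AJ: "mat_vec A ` carrier V = J"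
    using lattice_has_basis[OF assms] by blast
  have inj: "inj_on (mat_vec A) (carrier V)"
    using mat_vec_inj_if_kernel[OF A] kernel_zero_if_lattice[OF A] assms AJ by blast
  obtain T where T: "T \<subseteq> carrier V" "finite T" "card T = submodule_index V J"
    "bij_betw (\<lambda>(t, h). t \<oplus>\<^bsub>V\<^esub> h) (T \<times> J) (carrier V)"
    using coset_reps[OF assms] by metis
  let ?n = "m + 1" and ?\<phi> = "\<lambda>B. A \<otimes>\<^bsub>M\<^esub> B" and ?U = "digits \<inter> spanning (carrier V)"
  have pMM: "pM \<subseteq> carrier M" by (auto simp: pM_def)
  have satH: "saturated KK ?n (?\<phi> ` pM)" using mult_pM_saturated[OF A] m AJ by blast
  have satpM: "saturated KK ?n pM" by (rule saturated_mono[OF pM_saturated]) simp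
  have satJ: "saturated KK ?n (cols J)"
    by (rule saturated_mono[OF cols_saturated[OF submodule_saturated[OF sub m]]]) auto
  have card_image: "card (?\<phi> ` D) = card D" if "D \<subseteq> digits" for D
    using inj_on_subset[OF M_mult_inj[OF A inj]] digits(1) that
    by (meson card_image order_trans)
  have J_til: "tiling (?\<phi> ` digits) (?\<phi> ` pM) (cols J)"
    using mult_tiling[OF A inj digits(1) pMM digit_tiling] mult_image_M[OF A] AJ by simp
  have X_til: "tiling (?\<phi> ` ?U) (?\<phi> ` pM) (spanning J)"
    using mult_tiling[OF A inj _ pMM unit_tiling] digits(1) mult_image_spanning[OF A inj] AJ
    by auto
  have colsV: "cols (carrier V) = carrier M" by (auto simp: cols_def)
  have M_til: "tiling (cols T) (cols J) (carrier M)"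
    using cols_tiling[OF T(1) _ T(4)] V.submoduleE(1)[OF sub] colsV by simp
  have img: "?\<phi> ` D \<subseteq> carrier M" "finite (?\<phi> ` D)" if "D \<subseteq> digits" for D
    using that digits(1) A finite_subset[OF that digits(2)] by auto
  have 1: "residue_count ?n (spanning J) = card ?U * residue_count ?n (?\<phi> ` pM)"
    using tiling_count[OF X_til satH] img[of ?U] card_image[of ?U] by simp
  have 2: "residue_count ?n (cols J) = card digits * residue_count ?n (?\<phi> ` pM)"
    using tiling_count[OF J_til satH] img[of digits] card_image[of digits] by simp
  have 3: "residue_count ?n (carrier M) = submodule_index V J ^ k * residue_count ?n (cols J)"
    using tiling_count[OF M_til satJ] card_cols[OF T(1,2)] T(3) by (simp add: cols_def)
  have 4: "residue_count ?n (carrier M) = card digits * residue_count ?n pM"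
    using tiling_count[OF digit_tiling satpM] digits by simp
  have 5: "residue_count ?n (spanning (carrier V)) = card ?U * residue_count ?n pM"
    using tiling_count[OF unit_tiling satpM] digits by (simp add: le_infI1)
  have "card digits * residue_count ?n pM = card digits * (submodule_index V J ^ k * residue_count ?n (?\<phi> ` pM))"
    unfolding 4[symmetric] 3 2 by (simp only: mult.left_commute)
  moreover have "card digits > 0" using digits by (simp add: card_gt_0_iff)
  ultimately have "residue_count ?n pM = submodule_index V J ^ k * residue_count ?n (?\<phi> ` pM)" by simp
  then have "residue_count ?n (spanning J) * submodule_index V J ^ k = residue_count ?n (spanning (carrier V))"
    using 1 5 by simp
  moreover have "saturated KK ?n (spanning J)"
    using tiling_saturated[OF X_til satH] img[of ?U] by simp
  moreover have "saturated KK ?n (spanning (carrier V))"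
    by (rule saturated_mono[OF spanning_V_saturated]) simp
  ultimately show ?thesis using that by blast
qed

section \<open>Singular matrices\<close>

text \<open>
  The coefficient 1 at \<open>i\<close> turns the relation into an expression of column \<open>i\<close> by the other columns
  modulo \<open>p\<^sup>n\<close>, which makes these matrices rare.
\<close>

definition singular_mod :: "nat \<Rightarrow> (nat \<times> nat \<Rightarrow> nat \<Rightarrow> int) set" where
  "singular_mod n = {A \<in> carrier M.
     \<exists>i<k. \<exists>c\<in>carrier V. c i = \<one> \<and> redV n (mat_vec A c) = redV n \<zero>\<^bsub>V\<^esub>}"

lemma singular_mod_saturated: "saturated KK n (singular_mod n)"
  unfolding saturated_def vecs_M
proof (intro conjI ballI impI)
  fix A B assume AB: "A \<in> singular_mod n" "B \<in> carrier M" "redM n A = redM n B"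
  then obtain i c where c: "i < k" "c \<in> carrier V" "c i = \<one>" "redV n (mat_vec A c) = redV n \<zero>\<^bsub>V\<^esub>"
    and A: "A \<in> carrier M" unfolding singular_mod_def by blast
  have "redV n (mat_vec A c) = redV n (mat_vec B c)"
    using redV_mat_vec_cong[OF A AB(2) c(2) c(2) AB(3) refl] .
  then show "B \<in> singular_mod n" using AB(2) c unfolding singular_mod_def by auto
qed (auto simp: singular_mod_def)

text \<open>
  A nonzero vector of the kernel becomes primitive after division by a power of \<open>p\<close>, and a
  primitive vector has a unit among its entries, which can be scaled to 1.
\<close>

lemma singular_mod_if_not_lattice:
  assumes A: "A \<in> carrier M" and nl: "\<not> lattice (mat_vec A ` carrier V)"
  shows "A \<in> singular_mod n"
proof -
  obtain x where x: "x \<in> carrier V" "mat_vec A x = \<zero>\<^bsub>V\<^esub>" "x \<noteq> \<zero>\<^bsub>V\<^esub>"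
    using lattice_if_kernel_zero[OF A] nl by blast
  have "\<exists>l. redV l x \<noteq> redV l \<zero>\<^bsub>V\<^esub>"
    using vecs_ext[of x "{..<k}" "\<zero>\<^bsub>V\<^esub>"] x by (auto simp: vecs_V)
  then obtain l where l: "redV l x \<noteq> redV l \<zero>\<^bsub>V\<^esub>"
    and min: "\<And>l'. l' < l \<Longrightarrow> redV l' x = redV l' \<zero>\<^bsub>V\<^esub>"
    using exists_least_iff[of "\<lambda>l. redV l x \<noteq> redV l \<zero>\<^bsub>V\<^esub>"] by auto
  have "redV 0 x = redV 0 \<zero>\<^bsub>V\<^esub>"
  proof -
    have "x i 0 = 0" if "i < k" for i using level_range[of "x i" 0] x that by simp
    then show ?thesis by (auto simp: red_eq_iff zero_eq)
  qed
  then obtain l' where l': "l = l' + 1" using l by (cases l) auto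
  then obtain y where y: "y \<in> carrier V" "x = ppow l' \<odot>\<^bsub>V\<^esub> y"
    using min[of l'] redV_zero_iff[OF x(1)] by auto
  have "\<exists>i<k. y i 1 \<noteq> 0"
  proof (rule ccontr)
    assume "\<not> ?thesis"
    then have "redV 1 y = redV 1 \<zero>\<^bsub>V\<^esub>" by (auto simp: red_eq_iff zero_eq)
    then obtain z where z: "z \<in> carrier V" "y = ppow 1 \<odot>\<^bsub>V\<^esub> z" using redV_zero_iff[OF y(1)] by blast
    then have "x = ppow l \<odot>\<^bsub>V\<^esub> z" using y l' V_ppow_add[of z l' 1] by simp
    then show False using l redV_zero_iff[OF x(1)] z by blast
  qed
  then obtain i where i: "i < k" "y i \<in> Units R" using y unit_if_level_1 by auto
  have "ppow l' \<odot>\<^bsub>V\<^esub> mat_vec A y = \<zero>\<^bsub>V\<^esub>" using x y A by (simp add: mat_vec_smult)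
  then have Ay: "mat_vec A y = \<zero>\<^bsub>V\<^esub>" using V_smult_eq_zero[of "ppow l'" "mat_vec A y"] A y by simp
  define c where "c = inv (y i) \<odot>\<^bsub>V\<^esub> y"
  have c: "c \<in> carrier V" "c i = \<one>" using y i by (auto simp: c_def)
  moreover have "mat_vec A c = \<zero>\<^bsub>V\<^esub>" using A y i Ay by (simp add: c_def mat_vec_smult)
  ultimately show ?thesis using A i unfolding singular_mod_def by fastforce
qed

text \<open>
  Modulo \<open>p\<^sup>n\<close> such a matrix is determined by \<open>i\<close>, by the columns other than \<open>i\<close>, and by their
  \<open>k - 1\<close> coefficients, whereas an arbitrary column has \<open>k\<close> free entries.
\<close>

lemma singular_mod_count: "residue_count n (singular_mod n) * p ^ n \<le> k * (p ^ n) ^ (k * k)"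
proof -
  let ?F = "{0..<int p ^ n}"
  define P where "P i = ({..<k} \<times> ({..<k} - {i}) \<rightarrow>\<^sub>E ?F) \<times> ({..<k} - {i} \<rightarrow>\<^sub>E ?F)" for i
  \<comment> \<open>column \<open>i\<close> is recovered from the other columns and the coefficients of the relation\<close>
  define g where "g i = (\<lambda>(b, c). \<lambda>(r, j)\<in>KK.
    if j = i then (- (\<Sum>l\<in>{..<k} - {i}. b (r, l) * c l)) mod int p ^ n else b (r, j))"
    for i :: nat
  have "redM n ` singular_mod n \<subseteq> (\<Union>i<k. g i ` P i)"
  proof
    fix r assume "r \<in> redM n ` singular_mod n"
    then obtain A i c where A: "A \<in> carrier M" "r = redM n A" and i: "i < k"
      and c: "c \<in> carrier V" "c i = \<one>" "redV n (mat_vec A c) = redV n \<zero>\<^bsub>V\<^esub>"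
      unfolding singular_mod_def by blast
    define b where "b = (\<lambda>(s, j)\<in>{..<k} \<times> ({..<k} - {i}). A (s, j) n)"
    define d where "d = (\<lambda>j\<in>{..<k} - {i}. c j n)"
    have "(b, d) \<in> P i"
      using level_range A c by (auto simp: P_def b_def d_def)
    moreover have "r = g i (b, d)"
    proof -
      have "A (s, i) n = (- (\<Sum>l\<in>{..<k} - {i}. b (s, l) * d l)) mod int p ^ n" if s: "s < k" for s
      proof -
        have "(\<Sum>l<k. A (s, l) n * c l n) mod int p ^ n = 0"
          using c(3) s mat_vec_level[OF A(1) c(1) s, of n] by (auto simp: red_eq_iff zero_eq)
        also have "(\<Sum>l<k. A (s, l) n * c l n)
            = A (s, i) n * (1 mod int p ^ n) + (\<Sum>l\<in>{..<k} - {i}. b (s, l) * d l)"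
          using i c(2) s by (subst sum.remove[of _ i]) (auto simp: one_eq b_def d_def)
        finally have "(A (s, i) n * (1 mod int p ^ n) + (\<Sum>l\<in>{..<k} - {i}. b (s, l) * d l))
            mod int p ^ n = 0" .
        moreover have "(A (s, i) n * (1 mod int p ^ n)) mod int p ^ n = A (s, i) n mod int p ^ n"
          by (simp add: mod_mult_right_eq)
        ultimately have "(A (s, i) n + (\<Sum>l\<in>{..<k} - {i}. b (s, l) * d l)) mod int p ^ n = 0"
          by (metis mod_add_left_eq)
        then have "int p ^ n dvd A (s, i) n - - (\<Sum>l\<in>{..<k} - {i}. b (s, l) * d l)"
          by (simp add: mod_0_imp_dvd)
        then have "A (s, i) n mod int p ^ n = (- (\<Sum>l\<in>{..<k} - {i}. b (s, l) * d l)) mod int p ^ n"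
          by (simp only: mod_eq_dvd_iff)
        then show ?thesis using A s i by simp
      qed
      then show ?thesis unfolding A(2) g_def red_def by (auto simp: fun_eq_iff b_def)
    qed
    ultimately show "r \<in> (\<Union>i<k. g i ` P i)" using i by blast
  qed
  moreover have finP: "finite (P i)" for i by (simp add: P_def finite_PiE)
  ultimately have "residue_count n (singular_mod n) \<le> card (\<Union>i<k. g i ` P i)"
    unfolding residue_count_def by (intro card_mono) auto
  also have "\<dots> \<le> (\<Sum>i<k. card (g i ` P i))" by (rule card_UN_le) simp
  also have "\<dots> \<le> (\<Sum>i<k. (p ^ n) ^ (k * (k - 1) + (k - 1)))"
  proof (rule sum_mono)
    fix i assume "i \<in> {..<k}"
    then have "card (P i) = (p ^ n) ^ (k * (k - 1) + (k - 1))"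
      unfolding power_add by (simp add: P_def card_cartesian_product card_PiE nat_power_eq)
    then show "card (g i ` P i) \<le> (p ^ n) ^ (k * (k - 1) + (k - 1))"
      using card_image_le[OF finP, of "g i" i] by simp
  qed
  also have "\<dots> = k * (p ^ n) ^ (k * (k - 1) + (k - 1))"
    by (simp only: sum_constant card_lessThan of_nat_id)
  finally have "residue_count n (singular_mod n) * p ^ n \<le> k * ((p ^ n) ^ (k * (k - 1) + (k - 1)) * p ^ n)"
    by (simp add: mult.assoc)
  also have "\<dots> = k * (p ^ n) ^ (k * k)"
    by (cases k) (simp_all flip: power_Suc2 add: ac_simps)
  finally show ?thesis .
qed

lemma countable_lattices: "countable {J. lattice J}"
proof (rule countable_subset)
  show "{J. lattice J} \<subseteq> (\<Union>m. {S. saturated {..<k} m S})"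
    unfolding lattice_def using submodule_saturated by blast
  show "countable (\<Union>m. {S. saturated {..<k} m S})"
    by (intro countable_UN) (auto intro!: countable_finite finite_saturated)
qed

end

section \<open>Fractions\<close>

context padic
begin

abbreviation "Q \<equiv> padic_field p"
abbreviation "emb \<equiv> padic_embed p"

lemma Q_def: "Q = fraction_field R"
  by (simp add: padic_field_def R_def)

lemma emb_eq: "emb a = frac_of R a \<one>"
  by (simp add: padic_embed_def R_def)

lemma frac_of_iff:
  assumes "a \<in> carrier R" "b \<in> carrier R" "b \<noteq> \<zero>"
  shows "(c, d) \<in> frac_of R a b \<longleftrightarrow>
    c \<in> carrier R \<and> d \<in> carrier R \<and> d \<noteq> \<zero> \<and> a \<otimes> d = c \<otimes> b"
  using assms by (auto simp: frac_of_def frac_rel_def)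

lemma frac_of_eqI:
  assumes "a \<in> carrier R" "b \<in> carrier R" "b \<noteq> \<zero>" "c \<in> carrier R" "d \<in> carrier R" "d \<noteq> \<zero>"
    and "a \<otimes> d = c \<otimes> b"
  shows "frac_of R a b = frac_of R c d"
proof -
  have imp: "c \<otimes> y = x \<otimes> d"
    if "x \<in> carrier R" "y \<in> carrier R" "a \<otimes> y = x \<otimes> b"
      "a \<in> carrier R" "b \<in> carrier R" "b \<noteq> \<zero>" "c \<in> carrier R" "d \<in> carrier R" "a \<otimes> d = c \<otimes> b"
    for a b c d x y
  proof -
    have "b \<otimes> (c \<otimes> y) = (a \<otimes> y) \<otimes> d" using that by (metis m_assoc m_comm)
    also have "\<dots> = b \<otimes> (x \<otimes> d)" using that by (metis m_assoc m_comm)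
    finally show ?thesis using that m_lcancel[of b "c \<otimes> y" "x \<otimes> d"] by simp
  qed
  have "(x, y) \<in> frac_of R a b \<longleftrightarrow> (x, y) \<in> frac_of R c d" for x y
    using imp[of x y a b c d] imp[of x y c d a b] assms by (auto simp: frac_of_iff)
  then show ?thesis by auto
qed

lemma frac_of_eqD:
  assumes "a \<in> carrier R" "b \<in> carrier R" "b \<noteq> \<zero>" "c \<in> carrier R" "d \<in> carrier R" "d \<noteq> \<zero>"
    and "frac_of R a b = frac_of R c d"
  shows "a \<otimes> d = c \<otimes> b"
proof -
  have "(c, d) \<in> frac_of R c d" using assms by (simp add: frac_of_iff)
  then show ?thesis using assms by (metis frac_of_iff)
qed

lemma Q_carrier: "carrier Q = {frac_of R a b | a b. a \<in> carrier R \<and> b \<in> carrier R \<and> b \<noteq> \<zero>}"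
  unfolding Q_def fraction_field_def quotient_def frac_of_def by auto

lemma emb_inj: "inj_on emb (carrier R)"
  by (rule inj_onI) (use frac_of_eqD[of _ \<one> _ \<one>] in \<open>auto simp: emb_eq\<close>)

text \<open>
  Addition of fractions is a union over all representatives; here every choice gives the same
  class. With \<open>P = p\<^sup>n\<close> this describes the translates of \<open>\<int>\<^sub>p\<close>, and with \<open>P = 1\<close> the additivity of the embedding.
\<close>

lemma Q_add_emb:
  assumes y: "y \<in> carrier R" and P: "P \<in> carrier R" "P \<noteq> \<zero>" and z: "z \<in> carrier R"
  shows "frac_of R y P \<oplus>\<^bsub>Q\<^esub> emb z = frac_of R (y \<oplus> P \<otimes> z) P"
proof -
  let ?f = "\<lambda>a b c d. frac_of R (a \<otimes> d \<oplus> c \<otimes> b) (b \<otimes> d)"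
  have f: "?f a b c d = frac_of R (y \<oplus> P \<otimes> z) P"
    if "(a, b) \<in> frac_of R y P" "(c, d) \<in> frac_of R z \<one>" for a b c d
  proof (rule frac_of_eqI)
    have ab: "a \<in> carrier R" "b \<in> carrier R" "b \<noteq> \<zero>" "y \<otimes> b = a \<otimes> P"
      and cd: "c \<in> carrier R" "d \<in> carrier R" "d \<noteq> \<zero>" "z \<otimes> d = c"
      using that assms by (simp_all add: frac_of_iff)
    show "a \<otimes> d \<oplus> c \<otimes> b \<in> carrier R" "b \<otimes> d \<in> carrier R" "b \<otimes> d \<noteq> \<zero>"
      "y \<oplus> P \<otimes> z \<in> carrier R" "P \<in> carrier R" "P \<noteq> \<zero>"
      using ab cd assms by (auto simp: integral_iff)
    have "(a \<otimes> d \<oplus> c \<otimes> b) \<otimes> P = (a \<otimes> P) \<otimes> d \<oplus> c \<otimes> b \<otimes> P"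
      using ab(1-3) cd(1-3) assms by algebra
    also have "\<dots> = (y \<otimes> b) \<otimes> d \<oplus> (z \<otimes> d) \<otimes> b \<otimes> P" using ab cd by simp
    also have "\<dots> = (y \<oplus> P \<otimes> z) \<otimes> (b \<otimes> d)"
      using ab(1-3) cd(1-3) assms by algebra
    finally show "(a \<otimes> d \<oplus> c \<otimes> b) \<otimes> P = (y \<oplus> P \<otimes> z) \<otimes> (b \<otimes> d)" .
  qed
  have mem: "(y, P) \<in> frac_of R y P" "(z, \<one>) \<in> frac_of R z \<one>"
    using assms by (simp_all add: frac_of_iff)
  have "frac_of R y P \<oplus>\<^bsub>Q\<^esub> emb z =
      (\<Union>(a, b)\<in>frac_of R y P. \<Union>(c, d)\<in>frac_of R z \<one>. ?f a b c d)"
    by (simp add: Q_def fraction_field_def emb_eq)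
  also have "\<dots> = (\<Union>(a, b)\<in>frac_of R y P. \<Union>(c, d)\<in>frac_of R z \<one>. frac_of R (y \<oplus> P \<otimes> z) P)"
    using f by (intro SUP_cong refl) (auto intro!: SUP_cong)
  also have "\<dots> = frac_of R (y \<oplus> P \<otimes> z) P"
    using mem by (auto intro: exI)
  finally show ?thesis .
qed

lemma emb_add: "a \<in> carrier R \<Longrightarrow> z \<in> carrier R \<Longrightarrow> emb a \<oplus>\<^bsub>Q\<^esub> emb z = emb (a \<oplus> z)"
  using Q_add_emb[of a \<one> z] by (simp add: emb_eq)

lemma open_fractions:
  assumes S: "S \<subseteq> carrier R" "\<And>x y. x \<in> S \<Longrightarrow> y \<in> carrier R \<Longrightarrow> x n = y n \<Longrightarrow> y \<in> S"
    and P: "P \<in> carrier R" "P \<noteq> \<zero>"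
  shows "padic_open p ((\<lambda>s. frac_of R s P) ` S)"
  unfolding padic_open_def
proof (intro conjI ballI)
  show "(\<lambda>s. frac_of R s P) ` S \<subseteq> carrier Q" using S(1) P by (auto simp: Q_carrier)
  fix x assume "x \<in> (\<lambda>s. frac_of R s P) ` S"
  then obtain s where s: "s \<in> S" "x = frac_of R s P" by blast
  have sR: "s \<in> carrier R" using s S(1) by blast
  show "\<exists>n. \<forall>z\<in>carrier (padic_int p).
      x \<oplus>\<^bsub>Q\<^esub> emb (add_pow (padic_int p) (p ^ n) z) \<in> (\<lambda>s. frac_of R s P) ` S"
  proof (intro exI ballI)
    fix z assume "z \<in> carrier (padic_int p)"
    then have z: "z \<in> carrier R" by (simp add: R_def)
    let ?z = "add_pow R (p ^ n) z"
    have zR: "?z \<in> carrier R" using z by (simp add: add.nat_pow_closed)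
    have "?z n = 0" by (simp add: add_pow_eq)
    then have "(s \<oplus> P \<otimes> ?z) n = s n" using sR by (simp add: add_eq mult_eq)
    then have "s \<oplus> P \<otimes> ?z \<in> S" using S(2)[OF s(1)] sR P zR by simp
    moreover have "x \<oplus>\<^bsub>Q\<^esub> emb ?z = frac_of R (s \<oplus> P \<otimes> ?z) P"
      using Q_add_emb[OF sR P zR] s by simp
    ultimately show "x \<oplus>\<^bsub>Q\<^esub> emb (add_pow (padic_int p) (p ^ n) z) \<in> (\<lambda>s. frac_of R s P) ` S"
      by (simp add: R_def)
  qed
qed

definition residue_class :: "nat \<Rightarrow> int \<Rightarrow> (nat \<Rightarrow> int) set" where
  "residue_class n r = {x \<in> carrier R. x n = r}"

lemma residue_class_translate:
  assumes "r \<in> {0..<int p ^ n}"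
  shows "residue_class n r = (\<lambda>z. of_integer r \<oplus> ppow n \<otimes> z) ` carrier R"
proof (intro subset_antisym subsetI)
  have lev: "of_integer r n = r" using assms by (simp add: of_integer_def)
  show "x \<in> (\<lambda>z. of_integer r \<oplus> ppow n \<otimes> z) ` carrier R" if "x \<in> residue_class n r" for x
    using that level_eq_iff_ppow[of "of_integer r" x n] lev by (auto simp: residue_class_def)
  fix x assume "x \<in> (\<lambda>z. of_integer r \<oplus> ppow n \<otimes> z) ` carrier R"
  then obtain z where z: "z \<in> carrier R" "x = of_integer r \<oplus> ppow n \<otimes> z" by blast
  then have "x n = r" using level_eq_iff_ppow[of "of_integer r" x n] lev by auto
  then show "x \<in> residue_class n r" using z by (simp add: residue_class_def)
qed

end

section \<open>The measure of a set of matrices given by congruences\<close>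

locale padic_measure = padic p R for p and R (structure) +
  fixes \<mu> :: "((nat \<Rightarrow> int) \<times> (nat \<Rightarrow> int)) set measure"
  assumes haar: "padic_haar p \<mu>"
begin

lemma sets_mu: "sets \<mu> = sigma_sets (carrier Q) {U. padic_open p U}"
proof -
  have "{U. padic_open p U} \<subseteq> Pow (carrier Q)" by (auto simp: padic_open_def)
  then show ?thesis using haar by (simp add: padic_haar_def padic_borel_def)
qed

lemma space_mu: "space \<mu> = carrier Q"
proof -
  have "{U. padic_open p U} \<subseteq> Pow (carrier Q)" by (auto simp: padic_open_def)
  moreover have "sets \<mu> = sets (padic_borel p)" using haar by (simp add: padic_haar_def)
  ultimately show ?thesis
    using sets_eq_imp_space_eq[of \<mu> "padic_borel p"] by (simp add: padic_borel_def space_measure_of)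
qed

lemma open_sets: "padic_open p U \<Longrightarrow> U \<in> sets \<mu>"
  by (simp add: sets_mu sigma_sets.Basic)

lemma translate:
  "x \<in> carrier Q \<Longrightarrow> A \<in> sets \<mu> \<Longrightarrow> emeasure \<mu> ((\<lambda>y. x \<oplus>\<^bsub>Q\<^esub> y) ` A) = emeasure \<mu> A"
  using haar by (simp add: padic_haar_def)

lemma unit_ball: "emeasure \<mu> (emb ` carrier R) = 1"
  using haar by (simp add: padic_haar_def R_def)

lemma frac_class_sets:
  "P \<in> carrier R \<Longrightarrow> P \<noteq> \<zero> \<Longrightarrow> (\<lambda>s. frac_of R s P) ` residue_class n r \<in> sets \<mu>"
  by (intro open_sets open_fractions[of _ n]) (auto simp: residue_class_def)

lemma emb_class_sets: "emb ` residue_class n r \<in> sets \<mu>"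
  using frac_class_sets[of \<one> n r] by (simp add: emb_eq[abs_def])

lemma carrier_residue_class: "carrier R = residue_class 0 0"
  using level_range[of _ 0] by (fastforce simp: residue_class_def)

lemma emb_class_translate:
  assumes "r \<in> {0..<int p ^ n}"
  shows "emb ` residue_class n r = (\<lambda>y. emb (of_integer r) \<oplus>\<^bsub>Q\<^esub> y) ` emb ` residue_class n 0"
proof -
  have "residue_class n r = (\<lambda>z. of_integer r \<oplus> z) ` residue_class n 0"
  proof -
    have "of_integer 0 = \<zero>" by (simp add: of_integer_def zero_eq)
    then have "residue_class n 0 = (\<lambda>z. ppow n \<otimes> z) ` carrier R"
      using residue_class_translate[of 0 n] p_gt_1 by simp
    then show ?thesis using residue_class_translate[OF assms] by (simp add: image_image)
  qed
  then show ?thesis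
    by (auto simp: image_image emb_add residue_class_def intro!: image_cong)
qed

lemma emb_carrier: "a \<in> carrier R \<Longrightarrow> emb a \<in> carrier Q"
  unfolding emb_eq Q_carrier using one_closed one_not_zero by blast

text \<open>
  The \<open>p\<^sup>n\<close> residue classes are translates of one another and make up \<open>\<int>\<^sub>p\<close>.
\<close>

lemma emeasure_class:
  assumes "r \<in> {0..<int p ^ n}"
  shows "emeasure \<mu> (emb ` residue_class n r) = ennreal (1 / real p ^ n)"
proof -
  let ?c = "emeasure \<mu> (emb ` residue_class n 0)"
  have eq: "emeasure \<mu> (emb ` residue_class n r) = ?c" if "r \<in> {0..<int p ^ n}" for r
    unfolding emb_class_translate[OF that] by (intro translate emb_carrier emb_class_sets) simp
  have union: "emb ` carrier R = (\<Union>r\<in>{0..<int p ^ n}. emb ` residue_class n r)"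
    using level_range by (fastforce simp: residue_class_def)
  have "disjoint_family_on (\<lambda>r. emb ` residue_class n r) {0..<int p ^ n}"
    using inj_onD[OF emb_inj] by (auto simp: disjoint_family_on_def residue_class_def)
  then have "(\<Sum>r\<in>{0..<int p ^ n}. emeasure \<mu> (emb ` residue_class n r)) = 1"
    using sum_emeasure[of "\<lambda>r. emb ` residue_class n r" "{0..<int p ^ n}" \<mu>]
    by (simp add: unit_ball[unfolded union] emb_class_sets image_subset_iff)
  then have one: "of_nat (p ^ n) * ?c = 1" by (simp add: eq nat_power_eq)
  have N: "real (p ^ n) > 0" using p_gt_1 by simp
  have "?c \<noteq> \<infinity>"
  proof
    assume "?c = \<infinity>"
    then show False using one p_gt_1 by (simp add: ennreal_mult_top split: if_splits)
  qed
  then obtain c where c: "?c = ennreal c" "c \<ge> 0" by (metis ennreal_cases infinity_ennreal_def)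
  have "ennreal (real (p ^ n) * c) = ennreal 1"
    using one c by (simp add: ennreal_mult ennreal_of_nat_eq_real_of_nat)
  then have "real (p ^ n) * c = 1" using c by (subst (asm) ennreal_inj) auto
  then have "c = 1 / real p ^ n" using N by (simp add: field_simps)
  then show ?thesis using eq[OF assms] c by simp
qed

text \<open>
  Every fraction has the form \<open>s / p\<^sup>n\<close>, so the translates of \<open>\<int>\<^sub>p\<close> by the countably many
  \<open>r / p\<^sup>n\<close> with \<open>0 \<le> r < p\<^sup>n\<close> cover \<open>\<rat>\<^sub>p\<close>. Sigma-finiteness is what gives
  boxes their product measure.
\<close>

sublocale sigma_finite_measure \<mu>
proof
  \<comment> \<open>the fractions \<open>s / p\<^sup>n\<close> with \<open>s \<equiv> r\<close> modulo \<open>p\<^sup>n\<close>, that is, \<open>r / p\<^sup>n + \<int>\<^sub>p\<close>\<close>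
  define B where "B = (\<lambda>(n, r). (\<lambda>s. frac_of R s (ppow n)) ` residue_class n r)"
  have meas: "emeasure \<mu> (B (n, r)) = 1" if r: "r \<in> {0..<int p ^ n}" for n r
  proof -
    have "B (n, r) = (\<lambda>y. frac_of R (of_integer r) (ppow n) \<oplus>\<^bsub>Q\<^esub> y) ` emb ` carrier R"
      unfolding B_def prod.case residue_class_translate[OF r] image_image
      by (intro image_cong refl) (simp add: Q_add_emb)
    moreover have "frac_of R (of_integer r) (ppow n) \<in> carrier Q"
      unfolding Q_carrier using of_integer_closed ppow_closed ppow_nonzero by blast
    moreover have "emb ` carrier R \<in> sets \<mu>"
      unfolding carrier_residue_class by (rule emb_class_sets)
    ultimately show ?thesis using translate unit_ball by simp
  qed
  let ?I = "SIGMA n:UNIV. {0..<int p ^ n}"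
  have "\<Union> (B ` ?I) = carrier Q"
  proof (intro subset_antisym subsetI)
    fix X assume "X \<in> carrier Q"
    then obtain a b where ab: "a \<in> carrier R" "b \<in> carrier R" "b \<noteq> \<zero>" "X = frac_of R a b"
      unfolding Q_carrier by blast
    obtain n u where u: "u \<in> Units R" "b = ppow n \<otimes> u" using nonzero_decomp ab by metis
    define s where "s = a \<otimes> inv u"
    have s: "s \<in> carrier R" using ab u by (simp add: s_def)
    have uR: "u \<in> carrier R" "inv u \<in> carrier R" using u by auto
    have "s \<otimes> b = a \<otimes> ppow n \<otimes> (u \<otimes> inv u)"
      unfolding s_def u(2) using uR ab(1) ppow_closed[of n] by algebra
    then have "a \<otimes> ppow n = s \<otimes> b" using u ab by simp
    then have "X = frac_of R s (ppow n)"
      unfolding ab(4) using ab s by (intro frac_of_eqI) auto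
    then have "X \<in> B (n, s n)" using s by (auto simp: B_def residue_class_def)
    moreover have "(n, s n) \<in> ?I" using level_range[OF s, of n] by simp
    ultimately show "X \<in> \<Union> (B ` ?I)" by blast
  next
    fix X assume "X \<in> \<Union> (B ` ?I)"
    then obtain s n where "s \<in> carrier R" "X = frac_of R s (ppow n)"
      by (auto simp: B_def residue_class_def)
    then show "X \<in> carrier Q" unfolding Q_carrier using ppow_closed ppow_nonzero by blast
  qed
  moreover have "B ` ?I \<subseteq> sets \<mu>" using frac_class_sets by (auto simp: B_def)
  moreover have "\<forall>a\<in>B ` ?I. emeasure \<mu> a \<noteq> \<infinity>" using meas by auto
  moreover have "countable (B ` ?I)" by simp
  ultimately show "\<exists>A. countable A \<and> A \<subseteq> sets \<mu> \<and> \<Union> A = space \<mu> \<and> (\<forall>a\<in>A. emeasure \<mu> a \<noteq> \<infinity>)"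
    unfolding space_mu by blast
qed

definition emb_vec :: "'i set \<Rightarrow> ('i \<Rightarrow> nat \<Rightarrow> int) \<Rightarrow> 'i \<Rightarrow> ((nat \<Rightarrow> int) \<times> (nat \<Rightarrow> int)) set" where
  "emb_vec I x = (\<lambda>i\<in>I. emb (x i))"

lemma emb_vec_inj: "inj_on (emb_vec I) (vecs I)"
proof (rule inj_onI)
  fix x y assume xy: "x \<in> vecs I" "y \<in> vecs I" "emb_vec I x = emb_vec I y"
  show "x = y"
  proof (rule PiE_ext[OF xy(1,2)[unfolded vecs_def]])
    fix i assume i: "i \<in> I"
    then have "emb (x i) = emb (y i)" using fun_cong[OF xy(3), of i] by (simp add: emb_vec_def)
    then show "x i = y i" using inj_onD[OF emb_inj] xy i by (simp add: vecs_entry)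
  qed
qed

lemma emb_vec_box:
  "emb_vec I ` {x \<in> vecs I. \<forall>i\<in>I. x i n = r i} = (\<Pi>\<^sub>E i\<in>I. emb ` residue_class n (r i))"
proof (intro subset_antisym subsetI)
  fix X assume X: "X \<in> (\<Pi>\<^sub>E i\<in>I. emb ` residue_class n (r i))"
  then have "\<exists>x. x \<in> residue_class n (r i) \<and> X i = emb x" if "i \<in> I" for i
    using that by (auto simp: PiE_iff)
  then obtain x where x: "\<And>i. i \<in> I \<Longrightarrow> x i \<in> residue_class n (r i)" "\<And>i. i \<in> I \<Longrightarrow> X i = emb (x i)"
    by metis
  show "X \<in> emb_vec I ` {x \<in> vecs I. \<forall>i\<in>I. x i n = r i}"
  proof (rule image_eqI)
    show "restrict x I \<in> {x \<in> vecs I. \<forall>i\<in>I. x i n = r i}"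
      using x(1) by (auto simp: vecs_def residue_class_def)
    have "X = restrict X I" using PiE_restrict[OF X] by simp
    also have "\<dots> = emb_vec I (restrict x I)" using x(2) by (auto simp: emb_vec_def intro!: restrict_ext)
    finally show "X = emb_vec I (restrict x I)" .
  qed
qed (auto simp: emb_vec_def residue_class_def vecs_entry)

text \<open>
  Each residue class of vectors is a box, whose measure is a product of measures of residue classes.
\<close>

lemma measure_saturated:
  assumes I: "finite I" and S: "saturated I n S"
  shows "emb_vec I ` S \<in> sets (PiM I (\<lambda>_. \<mu>))"
    and "emeasure (PiM I (\<lambda>_. \<mu>)) (emb_vec I ` S)
      = ennreal (real (card (red I n ` S)) / real ((p ^ n) ^ card I))"
proof -
  interpret product_sigma_finite "\<lambda>_::'a. \<mu>"
    by (simp add: product_sigma_finite_def sigma_finite_measure_axioms)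
  let ?M = "PiM I (\<lambda>_. \<mu>)"
  define box where "box r = emb_vec I ` {x \<in> vecs I. \<forall>i\<in>I. x i n = r i}" for r
  have red_box: "{x \<in> vecs I. \<forall>i\<in>I. x i n = r i} = {x \<in> vecs I. red I n x = r}"
    if "r \<in> red I n ` S" for r
    using that by (auto simp: red_eq_iff) (auto simp: red_def)
  have range: "r i \<in> {0..<int p ^ n}" if "r \<in> red I n ` S" "i \<in> I" for r i
    using that S red_in[of _ I n] unfolding saturated_def by blast
  have union: "emb_vec I ` S = (\<Union>r\<in>red I n ` S. box r)"
  proof -
    have "S = (\<Union>r\<in>red I n ` S. {x \<in> vecs I. red I n x = r})"
      using S by (auto simp: saturated_def)
    then have "emb_vec I ` S = (\<Union>r\<in>red I n ` S. emb_vec I ` {x \<in> vecs I. red I n x = r})"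
      by blast
    then show ?thesis unfolding box_def using red_box by simp
  qed
  have box_sets: "box r \<in> sets ?M" for r
    unfolding box_def emb_vec_box by (intro sets_PiM_I_finite I emb_class_sets)
  have box_meas: "emeasure ?M (box r) = ennreal (1 / real ((p ^ n) ^ card I))"
    if "r \<in> red I n ` S" for r
  proof -
    have "emeasure ?M (box r) = (\<Prod>i\<in>I. emeasure \<mu> (emb ` residue_class n (r i)))"
      unfolding box_def emb_vec_box by (intro emeasure_PiM I emb_class_sets)
    also have "\<dots> = (\<Prod>i\<in>I. ennreal (1 / real p ^ n))"
      using emeasure_class range[OF that] by (intro prod.cong) auto
    also have "\<dots> = ennreal (1 / real ((p ^ n) ^ card I))"
      by (simp add: ennreal_power power_divide)
    finally show ?thesis .
  qed
  have fin: "finite (red I n ` S)"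
    using finite_red_image[OF I] S unfolding saturated_def by (meson finite_subset image_mono)
  show "emb_vec I ` S \<in> sets ?M" unfolding union using fin box_sets by (rule sets.finite_UN)
  have disj: "disjoint_family_on box (red I n ` S)"
    unfolding disjoint_family_on_def
  proof (intro ballI impI)
    fix r s assume rs: "r \<in> red I n ` S" "s \<in> red I n ` S" "r \<noteq> s"
    show "box r \<inter> box s = {}"
      unfolding box_def red_box[OF rs(1)] red_box[OF rs(2)]
      using inj_onD[OF emb_vec_inj] rs(3) by blast
  qed
  have "emeasure ?M (emb_vec I ` S) = (\<Sum>r\<in>red I n ` S. emeasure ?M (box r))"
    unfolding union using box_sets by (intro sum_emeasure[symmetric] disj fin) auto
  also have "\<dots> = of_nat (card (red I n ` S)) * ennreal (1 / real ((p ^ n) ^ card I))"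
    using box_meas by simp
  also have "\<dots> = ennreal (real (card (red I n ` S)) / real ((p ^ n) ^ card I))"
    by (subst ennreal_of_nat_eq_real_of_nat, subst ennreal_mult[symmetric]) auto
  finally show "emeasure ?M (emb_vec I ` S)
      = ennreal (real (card (red I n ` S)) / real ((p ^ n) ^ card I))" .
qed

end

section \<open>Partition of the integral matrices by their column lattice\<close>

locale padic_matrix_measure = padic_lattice p R k V + padic_measure p R \<mu>
  for p and R (structure) and k V \<mu>
begin

abbreviation "N \<equiv> padic_mat_measure \<mu> k"
abbreviation "emb_mat \<equiv> emb_vec KK"

lemma N_saturated:
  assumes "saturated KK n S"
  shows "emb_mat ` S \<in> sets N"
    and "emeasure N (emb_mat ` S) = ennreal (real (residue_count n S) / real ((p ^ n) ^ (k * k)))"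
    and "measure N (emb_mat ` S) = real (residue_count n S) / real ((p ^ n) ^ (k * k))"
  using measure_saturated[OF _ assms]
  by (simp_all add: padic_mat_measure_def residue_count_def card_cartesian_product measure_def)

lemma N_carrier: "emb_mat ` carrier M \<in> sets N" "emeasure N (emb_mat ` carrier M) = 1"
proof -
  have sat: "saturated KK 0 (carrier M)" by (auto simp: saturated_def vecs_M)
  have "residue_count 0 (carrier M) = 1"
    using card_red_image[of KK 0] by (simp add: residue_count_def vecs_M)
  then show "emb_mat ` carrier M \<in> sets N" "emeasure N (emb_mat ` carrier M) = 1"
    using N_saturated[OF sat] by simp_all
qed

lemma measure_spanning:
  assumes "lattice J"
  shows "emb_mat ` spanning J \<in> sets N"
    and "emeasure N (emb_mat ` spanning J) = ennreal (measure N (emb_mat ` spanning J))"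
    and "measure N (emb_mat ` spanning J)
      = real (submodule_index V J) powi (- int k) * measure N (emb_mat ` spanning (carrier V))"
proof -
  obtain n where sat: "saturated KK n (spanning J)" "saturated KK n (spanning (carrier V))"
    and residue_count: "residue_count n (spanning J) * submodule_index V J ^ k = residue_count n (spanning (carrier V))"
    using spanning_count[OF assms] by blast
  show "emb_mat ` spanning J \<in> sets N"
    and "emeasure N (emb_mat ` spanning J) = ennreal (measure N (emb_mat ` spanning J))"
    using N_saturated[OF sat(1)] by simp_all
  have "real (residue_count n (spanning (carrier V))) =
      real (residue_count n (spanning J)) * real (submodule_index V J) ^ k"
    unfolding residue_count[symmetric] by simp
  then show "measure N (emb_mat ` spanning J)
      = real (submodule_index V J) powi (- int k) * measure N (emb_mat ` spanning (carrier V))"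
    using submodule_index_pos[OF assms]
    by (simp add: N_saturated(3)[OF sat(1)] N_saturated(3)[OF sat(2)] power_int_minus field_simps)
qed

text \<open>
  The set need not be a union of residue classes, but for every \<open>n\<close> it is contained in one of measure
  at most \<open>k / p\<^sup>n\<close>.
\<close>

lemma not_spanning_null:
  assumes "S \<in> sets N" "S \<subseteq> emb_mat ` {A \<in> carrier M. \<not> lattice (mat_vec A ` carrier V)}"
  shows "emeasure N S = 0"
proof -
  have le: "emeasure N S \<le> ennreal (real k / real (p ^ n))" for n
  proof -
    have "S \<subseteq> emb_mat ` singular_mod n"
      using assms(2) singular_mod_if_not_lattice by blast
    then have "emeasure N S \<le> emeasure N (emb_mat ` singular_mod n)"
      by (rule emeasure_mono) (rule N_saturated(1)[OF singular_mod_saturated])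
    also have "\<dots> = ennreal (real (residue_count n (singular_mod n)) / real ((p ^ n) ^ (k * k)))"
      by (rule N_saturated(2)[OF singular_mod_saturated])
    also have "\<dots> \<le> ennreal (real k / real (p ^ n))"
    proof (rule ennreal_leI)
      have "real (residue_count n (singular_mod n) * p ^ n) \<le> real (k * (p ^ n) ^ (k * k))"
        using singular_mod_count[of n] by (simp only: of_nat_le_iff)
      moreover have "real (p ^ n) > 0" "real ((p ^ n) ^ (k * k)) > 0" using p_gt_1 by simp_all
      ultimately show "real (residue_count n (singular_mod n)) / real ((p ^ n) ^ (k * k)) \<le> real k / real (p ^ n)"
        by (subst frac_le_eq) (auto simp: field_simps divide_le_0_iff)
    qed
    finally show ?thesis .
  qed
  have "(\<lambda>n. ennreal (real k / real (p ^ n))) \<longlonglongrightarrow> ennreal 0"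
  proof (rule tendsto_ennrealI)
    have "(\<lambda>n. real k * inverse (real p) ^ n) \<longlonglongrightarrow> real k * 0"
      using p_gt_1 by (intro tendsto_mult tendsto_const LIMSEQ_realpow_zero) (auto simp: field_simps)
    then show "(\<lambda>n. real k / real (p ^ n)) \<longlonglongrightarrow> 0"
      by (simp add: divide_inverse power_inverse)
  qed
  then have "emeasure N S \<le> ennreal 0"
    using le by (intro LIMSEQ_le_const) auto
  then show ?thesis by simp
qed

lemma infsum_spanning: "infsum (\<lambda>J. measure N (emb_mat ` spanning J)) {J. lattice J} = 1"
proof -
  let ?X = "\<lambda>J. emb_mat ` spanning J"
  let ?f = "\<lambda>J. measure N (?X J)"
  let ?U = "\<Union> (?X ` {J. lattice J})"
  have X: "?X J \<in> sets N" if "J \<in> {J. lattice J}" for J using that measure_spanning(1) by simp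
  have inj: "inj_on emb_mat (carrier M)" using emb_vec_inj[of KK] by (simp add: vecs_M)
  have disj: "disjoint_family_on ?X {J. lattice J}"
    unfolding disjoint_family_on_def
  proof (intro ballI impI)
    fix J J' assume "J \<in> {J. lattice J}" "J' \<in> {J. lattice J}" "J \<noteq> J'"
    then show "?X J \<inter> ?X J' = {}"
      using inj_onD[OF inj] unfolding spanning_def by blast
  qed
  have U: "?U \<in> sets N" using X countable_lattices by (intro sets.countable_UN'') auto
  have UM: "?U \<subseteq> emb_mat ` carrier M" by (auto simp: spanning_def)
  have "emeasure N (emb_mat ` carrier M - ?U) = 0"
  proof (rule not_spanning_null)
    show "emb_mat ` carrier M - ?U \<in> sets N" using N_carrier(1) U by blast
    show "emb_mat ` carrier M - ?U \<subseteq> emb_mat ` {A \<in> carrier M. \<not> lattice (mat_vec A ` carrier V)}"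
      unfolding spanning_def by blast
  qed
  moreover have "emeasure N (?U \<union> (emb_mat ` carrier M - ?U)) = emeasure N ?U + emeasure N (emb_mat ` carrier M - ?U)"
    using U N_carrier(1) by (intro plus_emeasure[symmetric]) auto
  moreover have "?U \<union> (emb_mat ` carrier M - ?U) = emb_mat ` carrier M" using UM by blast
  ultimately have "emeasure N ?U = 1" using N_carrier(2) by simp
  then have "(\<integral>\<^sup>+J. emeasure N (?X J) \<partial>count_space {J. lattice J}) = 1"
    using emeasure_UN_countable[OF X countable_lattices disj] by simp
  moreover have "(\<integral>\<^sup>+J. emeasure N (?X J) \<partial>count_space {J. lattice J})
      = (\<integral>\<^sup>+J. ennreal (?f J) \<partial>count_space {J. lattice J})"
    by (intro nn_integral_cong) (simp add: measure_spanning(2))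
  ultimately have one: "(\<integral>\<^sup>+J. ennreal (?f J) \<partial>count_space {J. lattice J}) = 1" by simp
  have "Infinite_Set_Sum.abs_summable_on ?f {J. lattice J}"
    unfolding Infinite_Set_Sum.abs_summable_on_def
    by (rule integrableI_bounded) (simp_all add: one)
  then have "infsum ?f {J. lattice J} = infsetsum ?f {J. lattice J}"
    by (rule infsetsum_infsum[symmetric])
  also have "\<dots> = enn2real (\<integral>\<^sup>+J. ennreal (?f J) \<partial>count_space {J. lattice J})"
    by (rule infsetsum_conv_nn_integral) (simp_all add: one)
  finally show ?thesis by (simp add: one)
qed

end

theorem mainTheorem3:
  fixes k p :: nat
    and \<mu> :: "((nat \<Rightarrow> int) \<times> (nat \<Rightarrow> int)) set measure"
  assumes "k \<ge> 1" and "prime p" and "padic_haar p \<mu>"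
  shows "1 = (\<Sum>\<^sub>\<infinity>J\<in>full_rank_submodules p k.
                real (submodule_index (free_module (padic_int p) k) J) powi (- int k))
             * measure (padic_mat_measure \<mu> k) (padic_GL p k)"
proof -
  interpret padic_matrix_measure p "padic_int p" k "free_module (padic_int p) k" \<mu>
    using assms by unfold_locales auto
  let ?V = "free_module (padic_int p) k"
  let ?g = "measure N (padic_GL p k)"
  have GL: "padic_GL p k = emb_mat ` spanning (carrier ?V)"
    by (simp add: padic_GL_def emb_vec_def spanning_def Units_M)
  have "1 = infsum (\<lambda>J. measure N (emb_mat ` spanning J)) {J. lattice J}"
    using infsum_spanning by simp
  also have "\<dots> = infsum (\<lambda>J. real (submodule_index ?V J) powi (- int k) * ?g) {J. lattice J}"
    unfolding GL by (intro infsum_cong) (simp add: measure_spanning(3))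
  also have "\<dots> = infsum (\<lambda>J. real (submodule_index ?V J) powi (- int k)) {J. lattice J} * ?g"
    by (rule infsum_cmult_left')
  also have "{J. lattice J} = full_rank_submodules p k"
    using full_rank_iff_lattice by blast
  finally show ?thesis .
qed

end
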